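(* Consider the Markovian proximal Bellman-ADMM iteration described in the context, under the coverage and noise/bias assumption and the algorithmic-margin assumption stated there, where the centered reward noise in batch $k$ has conditional variance at most $\sigma_k^2$ and the average bias in each visited state-action reward row of batch $k$ has magnitude at most $b_k$. If $$\sum_{k=0}^\infty\frac{1+\sigma_k^2}{m_k}<\infty,\qquad\sum_{k=0}^\infty b_k^2<\infty,$$ then almost surely $\Delta\pi_k\to0$, $\Delta V_k\to0$, $\Delta\lambda_k\to0$, $R(\pi^k,V^k)\to0$, and the true KKT residual converges to zero, $G(\pi^k,V^k,\lambda^k)\to0$. Every accumulation point $(\pi^\star,V^\star,\lambda^\star)$ of the iterates satisfies the KKT conditions $0\in\partial\psi(\pi^\star)+J_\pi(\pi^\star,V^\star)^{\mathsf T}\lambda^\star$, $c+M_{\pi^\star}^{\mathsf T}\lambda^\star=0$, $R(\pi^\star,V^\star)=0$ of the problem $\min_{\pi\in\Pi,V}\phi(\pi)+c^{\mathsf T}V$ subject to $R(\pi,V)=0$.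
   Context: Norms are Euclidean for vectors and spectral for matrices. MDP: $(\mathcal S,\mathcal A,P,r,\rho,\gamma)$ is a finite discounted MDP with $0<\gamma<1$. Policies are $\pi\in\Pi=\prod_{s\in\mathcal S}\Delta(\mathcal A)\subset\mathbb R^{|\mathcal S||\mathcal A|}$. Set $P_\pi(s,s')=\sum_a\pi(a|s)P(s'|s,a)$, $r_\pi(s)=\sum_a\pi(a|s)r(s,a)$, $M_\pi=I-\gamma P_\pi$, $R(\pi,V)=M_\pi V-r_\pi$ for $V\in\mathbb R^{|\mathcal S|}$, $J_\pi(\pi,V)=D_\pi R(\pi,V)$. The vector $c\in\mathbb R^{|\mathcal S|}$ is fixed and $\phi$ (possibly nonsmooth, nonconvex) is proper, lower semicontinuous and bounded below on $\Pi$ with $\operatorname{dom}\phi\cap\Pi\neq\varnothing$; $\psi=\phi+\delta_\Pi$ with $\delta_\Pi$ the indicator of $\Pi$, and $\partial\psi$ is the limiting subdifferential. Squared KKT residual: $G(\pi,V,\lambda)=\operatorname{dist}^2(0,\partial\psi(\pi)+J_\pi(\pi,V)^{\mathsf T}\lambda)+\|c+M_\pi^{\mathsf T}\lambda\|^2+\|R(\pi,V)\|^2$. The augmented Lagrangian is $\mathcal L_\beta(\pi,V,\lambda)=\phi(\pi)+c^{\mathsf T}V+\langle\lambda,R(\pi,V)\rangle+\frac\beta2\|R(\pi,V)\|^2$. Sampling: at outer iteration $k$ an exploratory behavior policy $\bar\pi^k$ is frozen and a batch of $m_k\geq1$ steps of the reset chain with kernel $K_k(s,s')=(1-\gamma)\rho(s')+\gamma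 P_{\bar\pi^k}(s,s')$ is simulated: at step $t$, in state $S_{k,t}$, an action $A_{k,t}\sim\bar\pi^k(\cdot|S_{k,t})$ and a reset indicator (reset with probability $1-\gamma$) are drawn; on a reset the next state is drawn from $\rho$, otherwise an environment transition from $P(\cdot|S_{k,t},A_{k,t})$ is observed with reward observation $Y_{k,t}$. From the non-reset transitions of batch $k$ only, form the empirical conditional transition rows $\widehat P_k(\cdot|s,a)$ and average observed rewards $\widehat r_k(s,a)$ for each $(s,a)$; an unvisited transition row is replaced by a fixed probability vector and an unvisited reward entry by a fixed bounded value. Set $\widehat P_{\pi,k}(s,\cdot)=\sum_a\pi(a|s)\widehat P_k(\cdot|s,a)$, $\widehat r_{\pi,k}(s)=\sum_a\pi(a|s)\widehat r_k(s,a)$, $\widehat M_{\pi,k}=I-\gamma\widehat P_{\pi,k}$, $\widehat R_k(\pi,V)=\widehat M_{\pi,k}V-\widehat r_{\pi,k}$, and let $\widehat{\mathcal L}_{\beta,k}$ be $\mathcal L_\beta$ with $R$ replaced by $\widehat R_k$. The constant $\bar\kappa<\infty$ satisfies $\|M_\pi^{-1}\|\le\bar\kappa$ and $\|\widehat M_{\pi,k}^{-1}\|\le\bar\kappa$ for all $\pi,k$ and all realizations. Algorithm: from $(\pi^0,V^0,\lambda^0)$, with $\beta,\eta_\pi,\eta_V>0$, for $k=0,1,\dots$: $\pi^{k+1}\in\arg\min_{\pi\in\Pi}\{\widehat{\mathcal L}_{\beta,k}(\pi,V^k,\lambda^k)+\frac1{2\eta_\pi}\|\pi-\pi^k\|^2\}$;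 $V^{k+1}=\arg\min_V\{\widehat{\mathcal L}_{\beta,k}(\pi^{k+1},V,\lambda^k)+\frac1{2\eta_V}\|V-V^k\|^2\}$; $\lambda^{k+1}=\lambda^k+\beta\widehat R_k(\pi^{k+1},V^{k+1})$. Write $\Delta\pi_{k+1}=\pi^{k+1}-\pi^k$, and similarly $\Delta V_{k+1},\Delta\lambda_{k+1}$. All of $(\pi^k,V^k,\lambda^k,\bar\pi^k)$ is determined before batch $k$ is drawn. Coverage and noise/bias assumption: there are $\rho_{\min},\alpha>0$, $R_{\max}<\infty$ with $\rho(s)\ge\rho_{\min}$, $\bar\pi^k(a|s)\ge\alpha$, $|r(s,a)|\le R_{\max}$ for all $k,s,a$. Let $\mathcal G_{k,t}$ contain all past observations and the current state, action and reset indicator, before the current reward and next state are drawn. Fresh reset coins, reset states and action randomization are independent of the preceding history; on non-reset steps the conditional next-state law given $\mathcal G_{k,t}$ is $P(\cdot|S_{k,t},A_{k,t})$; the current reward and next state may be dependent. Reward observations are $Y_{k,t}=r(S_{k,t},A_{k,t})+b_{k,t}+\zeta_{k,t}$ with $\mathbb E[\zeta_{k,t}|\mathcal G_{k,t}]=0$, $\mathbb E[|\zeta_{k,t}|^2|\mathcal G_{k,t}]\le\sigma_k^2$, and for every $(s,a)$ visited by non-reset transitions in batch $k$ the average of $b_{k,t}$ over those visits has absolute value at most $b_k$; $(\sigma_k)$ and $(b_k)$ are deterministic nonnegative sequences. Algorithmic-margin assumption: the policy subproblem admits a global minimizer and is solved exactly; the value subproblem is solved exactly; $\pi^0$ is deterministic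 and lies in $\operatorname{dom}\psi$; $\|M_{\pi'}-M_\pi\|\le L_M\|\pi'-\pi\|$ for some $L_M<\infty$; $b(\pi)=\phi(\pi)+c^{\mathsf T}M_\pi^{-1}r_\pi$ is bounded below on $\Pi$; $\beta>\max\{60\bar\kappa^2/\eta_V,\;30\eta_\pi\bar\kappa^4L_M^2\|c\|^2\}$; $\mathbb E\|V^0\|^4+\mathbb E\|\lambda^0\|^4<\infty$.
   Formalization: The formal theorem also assumes that past reward noises ζ belong to the history 𝒢_{k,t} (martingale-difference noise). If 𝒢 held only past observations, hidden biases could mask a common noise sign across a batch and the claim would fail. *)

theory Defs
  imports "HOL-Probability.Probability"
begin

section \<open>Variational notions for extended-real-valued functions\<close>

definition proper_fun :: "('x \<Rightarrow> ereal) \<Rightarrow> bool" where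
  "proper_fun f \<longleftrightarrow> (\<forall>x. f x \<noteq> -\<infinity>) \<and> (\<exists>x. f x \<noteq> \<infinity>)"

definition lsc_on :: "'x::topological_space set \<Rightarrow> ('x \<Rightarrow> ereal) \<Rightarrow> bool" where
  "lsc_on X f \<longleftrightarrow> (\<forall>x\<in>X. f x \<le> Liminf (at x within X) f)"

definition effective_domain :: "('x \<Rightarrow> ereal) \<Rightarrow> 'x set" where
  "effective_domain f = {x. f x < \<infinity>}"

definition bounded_below_on :: "'x set \<Rightarrow> ('x \<Rightarrow> ereal) \<Rightarrow> bool" where
  "bounded_below_on X f \<longleftrightarrow> (\<exists>B::real. \<forall>x\<in>X. ereal B \<le> f x)"

definition indicator_fun :: "'x set \<Rightarrow> 'x \<Rightarrow> ereal" where
  "indicator_fun X x = (if x \<in> X then 0 else \<infinity>)"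

definition regular_subdifferential ::
  "('x::real_inner \<Rightarrow> ereal) \<Rightarrow> 'x \<Rightarrow> 'x set" where
  "regular_subdifferential f x =
     {v. \<bar>f x\<bar> \<noteq> \<infinity> \<and>
         0 \<le> Liminf (at x) (\<lambda>y. (f y - f x - ereal (v \<bullet> (y - x))) / ereal (norm (y - x)))}"

text \<open>The limiting (Mordukhovich) subdifferential; it is empty outside the effective domain.\<close>

definition limiting_subdifferential ::
  "('x::real_inner \<Rightarrow> ereal) \<Rightarrow> 'x \<Rightarrow> 'x set" where
  "limiting_subdifferential f x =
     {v. \<bar>f x\<bar> \<noteq> \<infinity> \<and>
         (\<exists>xs vs. xs \<longlonglongrightarrow> x \<and> (\<lambda>n. f (xs n)) \<longlonglongrightarrow> f x \<and>
            (\<forall>n. vs n \<in> regular_subdifferential f (xs n)) \<and> vs \<longlonglongrightarrow> v)}"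

text \<open>Distance to a set with the convention that the distance to the empty set is infinite
  (the library functions infdist and setdist return 0 there).\<close>

definition edist_set :: "'x::metric_space \<Rightarrow> 'x set \<Rightarrow> ereal" where
  "edist_set x X = (INF y\<in>X. ereal (dist x y))"

definition spectral_norm :: "real^'n^'m \<Rightarrow> real" where
  "spectral_norm A = onorm ((*v) A)"

section \<open>Policies and Bellman residual\<close>

text \<open>A policy is a vector in \<open>real^'a^'s\<close>, whose norm is the Euclidean norm of all
  its entries; \<open>\<pi> $ s $ a\<close> is the probability of action \<open>a\<close> in state \<open>s\<close>.\<close>

definition policies :: "(real^'a^'s) set" where
  "policies = {\<pi>. \<forall>s. (\<forall>a. 0 \<le> \<pi> $ s $ a) \<and> (\<Sum>a\<in>UNIV. \<pi> $ s $ a) = 1}"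

text \<open>The functions below take the transition array \<open>p s a s'\<close> and the reward array
  \<open>r s a\<close> as arguments, so that they apply both to the true model and to
  the empirical model of a batch.\<close>

definition P_pol :: "('s \<Rightarrow> 'a \<Rightarrow> 's \<Rightarrow> real) \<Rightarrow> real^'a^'s \<Rightarrow> real^'s^'s" where
  "P_pol p \<pi> = (\<chi> s s'. \<Sum>a\<in>UNIV. \<pi> $ s $ a * p s a s')"

definition r_pol :: "('s \<Rightarrow> 'a \<Rightarrow> real) \<Rightarrow> real^'a^'s \<Rightarrow> real^'s" where
  "r_pol r \<pi> = (\<chi> s. \<Sum>a\<in>UNIV. \<pi> $ s $ a * r s a)"

definition M_pol ::
  "real \<Rightarrow> ('s \<Rightarrow> 'a \<Rightarrow> 's \<Rightarrow> real) \<Rightarrow> real^'a^'s \<Rightarrow> real^'s^'s" where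
  "M_pol \<gamma> p \<pi> = mat 1 - \<gamma> *\<^sub>R P_pol p \<pi>"

definition bellman_res ::
  "real \<Rightarrow> ('s::finite \<Rightarrow> 'a::finite \<Rightarrow> 's \<Rightarrow> real) \<Rightarrow> ('s \<Rightarrow> 'a \<Rightarrow> real) \<Rightarrow>
   real^'a^'s \<Rightarrow> real^'s \<Rightarrow> real^'s" where
  "bellman_res \<gamma> p r \<pi> V = M_pol \<gamma> p \<pi> *v V - r_pol r \<pi>"

text \<open>The derivative of the residual in the policy, and its transpose applied to a multiplier.\<close>

definition J_pol ::
  "real \<Rightarrow> ('s::finite \<Rightarrow> 'a::finite \<Rightarrow> 's \<Rightarrow> real) \<Rightarrow> ('s \<Rightarrow> 'a \<Rightarrow> real) \<Rightarrow>
   real^'a^'s \<Rightarrow> real^'s \<Rightarrow> (real^'a^'s \<Rightarrow> real^'s)" where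
  "J_pol \<gamma> p r \<pi> V = frechet_derivative (\<lambda>\<pi>'. bellman_res \<gamma> p r \<pi>' V) (at \<pi>)"

definition policy_stationarity_set ::
  "real \<Rightarrow> ('s::finite \<Rightarrow> 'a::finite \<Rightarrow> 's \<Rightarrow> real) \<Rightarrow> ('s \<Rightarrow> 'a \<Rightarrow> real) \<Rightarrow>
   (real^'a^'s \<Rightarrow> ereal) \<Rightarrow> real^'a^'s \<Rightarrow> real^'s \<Rightarrow> real^'s \<Rightarrow> (real^'a^'s) set" where
  "policy_stationarity_set \<gamma> p r \<phi> \<pi> V \<Lambda> =
     (\<lambda>v. v + adjoint (J_pol \<gamma> p r \<pi> V) \<Lambda>) `
       limiting_subdifferential (\<lambda>\<pi>'. \<phi> \<pi>' + indicator_fun policies \<pi>') \<pi>"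

definition kkt_residual ::
  "real \<Rightarrow> ('s::finite \<Rightarrow> 'a::finite \<Rightarrow> 's \<Rightarrow> real) \<Rightarrow> ('s \<Rightarrow> 'a \<Rightarrow> real) \<Rightarrow>
   (real^'a^'s \<Rightarrow> ereal) \<Rightarrow> real^'s \<Rightarrow> real^'a^'s \<Rightarrow> real^'s \<Rightarrow> real^'s \<Rightarrow> ereal" where
  "kkt_residual \<gamma> p r \<phi> c \<pi> V \<Lambda> =
     (edist_set 0 (policy_stationarity_set \<gamma> p r \<phi> \<pi> V \<Lambda>))\<^sup>2
     + ereal ((norm (c + transpose (M_pol \<gamma> p \<pi>) *v \<Lambda>))\<^sup>2)
     + ereal ((norm (bellman_res \<gamma> p r \<pi> V))\<^sup>2)"

definition kkt_point ::
  "real \<Rightarrow> ('s::finite \<Rightarrow> 'a::finite \<Rightarrow> 's \<Rightarrow> real) \<Rightarrow> ('s \<Rightarrow> 'a \<Rightarrow> real) \<Rightarrow>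
   (real^'a^'s \<Rightarrow> ereal) \<Rightarrow> real^'s \<Rightarrow> real^'a^'s \<Rightarrow> real^'s \<Rightarrow> real^'s \<Rightarrow> bool" where
  "kkt_point \<gamma> p r \<phi> c \<pi> V \<Lambda> \<longleftrightarrow>
     0 \<in> policy_stationarity_set \<gamma> p r \<phi> \<pi> V \<Lambda> \<and>
     c + transpose (M_pol \<gamma> p \<pi>) *v \<Lambda> = 0 \<and>
     bellman_res \<gamma> p r \<pi> V = 0"

definition aug_lagrangian ::
  "real \<Rightarrow> ('s::finite \<Rightarrow> 'a::finite \<Rightarrow> 's \<Rightarrow> real) \<Rightarrow> ('s \<Rightarrow> 'a \<Rightarrow> real) \<Rightarrow>
   (real^'a^'s \<Rightarrow> ereal) \<Rightarrow> real^'s \<Rightarrow> real \<Rightarrow> real^'a^'s \<Rightarrow> real^'s \<Rightarrow> real^'s \<Rightarrow> ereal" where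
  "aug_lagrangian \<gamma> p r \<phi> c \<beta> \<pi> V \<Lambda> =
     \<phi> \<pi> + ereal (c \<bullet> V + \<Lambda> \<bullet> bellman_res \<gamma> p r \<pi> V
                  + \<beta> / 2 * (norm (bellman_res \<gamma> p r \<pi> V))\<^sup>2)"

section \<open>Empirical model of one realised batch\<close>

text \<open>A batch of length \<open>n\<close> has states \<open>S t\<close>, actions \<open>A t\<close>, reset indicators \<open>C t\<close>
  (true means reset), rewards \<open>Y t\<close> and next states \<open>N t\<close>.  Only non-reset steps enter the
  estimates, so \<open>Y t\<close> is irrelevant on reset steps.\<close>

definition visits ::
  "nat \<Rightarrow> (nat \<Rightarrow> 's) \<Rightarrow> (nat \<Rightarrow> 'a) \<Rightarrow> (nat \<Rightarrow> bool) \<Rightarrow> 's \<Rightarrow> 'a \<Rightarrow> nat set" where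
  "visits n S A C s a = {t. t < n \<and> \<not> C t \<and> S t = s \<and> A t = a}"

definition empirical_P ::
  "('s \<Rightarrow> 'a \<Rightarrow> 's pmf) \<Rightarrow> nat \<Rightarrow> (nat \<Rightarrow> 's) \<Rightarrow> (nat \<Rightarrow> 'a) \<Rightarrow> (nat \<Rightarrow> bool) \<Rightarrow>
   (nat \<Rightarrow> 's) \<Rightarrow> 's \<Rightarrow> 'a \<Rightarrow> 's \<Rightarrow> real" where
  "empirical_P P\<^sub>0 n S A C N s a s' =
     (if visits n S A C s a = {} then pmf (P\<^sub>0 s a) s'
      else real (card {t \<in> visits n S A C s a. N t = s'}) / real (card (visits n S A C s a)))"

definition empirical_r ::
  "('s \<Rightarrow> 'a \<Rightarrow> real) \<Rightarrow> nat \<Rightarrow> (nat \<Rightarrow> 's) \<Rightarrow> (nat \<Rightarrow> 'a) \<Rightarrow> (nat \<Rightarrow> bool) \<Rightarrow>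
   (nat \<Rightarrow> real) \<Rightarrow> 's \<Rightarrow> 'a \<Rightarrow> real" where
  "empirical_r r\<^sub>0 n S A C Y s a =
     (if visits n S A C s a = {} then r\<^sub>0 s a
      else (\<Sum>t\<in>visits n S A C s a. Y t) / real (card (visits n S A C s a)))"

section \<open>Markovian sampling with resets, and noisy biased rewards\<close>

text \<open>\<open>H k t\<close> is the history at step \<open>t\<close> of batch \<open>k\<close> including the current state, before
  the action and the reset coin are drawn; \<open>G k t\<close> also contains the current action and coin, but
  not the current reward and next state.  Both may contain additional information.  The state in
  which a batch starts is unrestricted.  The history that follows step \<open>t\<close> of batch \<open>k\<close> is
  \<open>H k (Suc t)\<close> inside the batch and \<open>H (Suc k) 0\<close> after its last step.\<close>

definition next_history ::
  "(nat \<Rightarrow> nat) \<Rightarrow> (nat \<Rightarrow> nat \<Rightarrow> 'w measure) \<Rightarrow> nat \<Rightarrow> nat \<Rightarrow> 'w measure" where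
  "next_history m H k t = (if Suc t < m k then H k (Suc t) else H (Suc k) 0)"

locale markovian_sampling = prob_space M for M :: "'w measure" +
  fixes \<gamma> :: real
    and P :: "'s::finite \<Rightarrow> 'a::finite \<Rightarrow> 's pmf"
    and \<rho> :: "'s pmf"
    and m :: "nat \<Rightarrow> nat"
    and \<pi>b :: "nat \<Rightarrow> 'w \<Rightarrow> real^'a^'s"
    and H G :: "nat \<Rightarrow> nat \<Rightarrow> 'w measure"
    and S N :: "nat \<Rightarrow> nat \<Rightarrow> 'w \<Rightarrow> 's"
    and A :: "nat \<Rightarrow> nat \<Rightarrow> 'w \<Rightarrow> 'a"
    and C :: "nat \<Rightarrow> nat \<Rightarrow> 'w \<Rightarrow> bool"
    and Y :: "nat \<Rightarrow> nat \<Rightarrow> 'w \<Rightarrow> real"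
  assumes batch_nonempty: "\<And>k. 1 \<le> m k"
    and subalg_next: "\<And>k t. t < m k \<Longrightarrow> subalgebra M (next_history m H k t)"
    and subalg_H: "\<And>k t. t < m k \<Longrightarrow> subalgebra (G k t) (H k t)"
    and subalg_G: "\<And>k t. t < m k \<Longrightarrow> subalgebra (next_history m H k t) (G k t)"
    and behavior_policy: "\<And>k \<omega>. \<omega> \<in> space M \<Longrightarrow> \<pi>b k \<omega> \<in> policies"
    and behavior_frozen: "\<And>k. \<pi>b k \<in> measurable (H k 0) borel"
    and state_meas: "\<And>k t. t < m k \<Longrightarrow> S k t \<in> measurable (H k t) (count_space UNIV)"
    and action_meas: "\<And>k t. t < m k \<Longrightarrow> A k t \<in> measurable (G k t) (count_space UNIV)"
    and coin_meas: "\<And>k t. t < m k \<Longrightarrow> C k t \<in> measurable (G k t) (count_space UNIV)"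
    and next_meas:
      "\<And>k t. t < m k \<Longrightarrow> N k t \<in> measurable (next_history m H k t) (count_space UNIV)"
    and reward_meas: "\<And>k t. t < m k \<Longrightarrow> Y k t \<in> measurable (next_history m H k t) borel"
    and chain: "\<And>k t \<omega>. Suc t < m k \<Longrightarrow> \<omega> \<in> space M \<Longrightarrow> S k (Suc t) \<omega> = N k t \<omega>"
    and action_coin_law:
      "\<And>k t a d. t < m k \<Longrightarrow>
         AE \<omega> in M. real_cond_exp M (H k t)
             (indicator {\<omega>' \<in> space M. A k t \<omega>' = a \<and> C k t \<omega>' = d}) \<omega>
           = \<pi>b k \<omega> $ S k t \<omega> $ a * (if d then 1 - \<gamma> else \<gamma>)"
    and next_state_law:
      "\<And>k t s'. t < m k \<Longrightarrow>
         AE \<omega> in M. real_cond_exp M (G k t) (indicator {\<omega>' \<in> space M. N k t \<omega>' = s'}) \<omega>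
           = (if C k t \<omega> then pmf \<rho> s' else pmf (P (S k t \<omega>) (A k t \<omega>)) s')"

text \<open>The noise of a completed step belongs to the subsequent history, so that the noise forms a
  martingale difference sequence within a batch; observing \<open>Y\<close> alone would not give this,
  because the bias \<open>b\<close> is not assumed to be known.\<close>

locale markovian_sampling_rewards =
  markovian_sampling M \<gamma> P \<rho> m \<pi>b H G S N A C Y
  for M :: "'w measure"
    and \<gamma> :: real
    and P :: "'s::finite \<Rightarrow> 'a::finite \<Rightarrow> 's pmf"
    and \<rho> :: "'s pmf"
    and m :: "nat \<Rightarrow> nat"
    and \<pi>b :: "nat \<Rightarrow> 'w \<Rightarrow> real^'a^'s"
    and H G :: "nat \<Rightarrow> nat \<Rightarrow> 'w measure"
    and S N :: "nat \<Rightarrow> nat \<Rightarrow> 'w \<Rightarrow> 's"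
    and A :: "nat \<Rightarrow> nat \<Rightarrow> 'w \<Rightarrow> 'a"
    and C :: "nat \<Rightarrow> nat \<Rightarrow> 'w \<Rightarrow> bool"
    and Y :: "nat \<Rightarrow> nat \<Rightarrow> 'w \<Rightarrow> real" +
  fixes r :: "'s \<Rightarrow> 'a \<Rightarrow> real"
    and b \<zeta> :: "nat \<Rightarrow> nat \<Rightarrow> 'w \<Rightarrow> real"
    and bias \<sigma> :: "nat \<Rightarrow> real"
  assumes sigma_nonneg: "\<And>k. 0 \<le> \<sigma> k"
    and bias_nonneg: "\<And>k. 0 \<le> bias k"
    and noise_meas: "\<And>k t. t < m k \<Longrightarrow> \<zeta> k t \<in> measurable (next_history m H k t) borel"
    and reward_observation:
      "\<And>k t \<omega>. t < m k \<Longrightarrow> \<omega> \<in> space M \<Longrightarrow> \<not> C k t \<omega> \<Longrightarrow>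
         Y k t \<omega> = r (S k t \<omega>) (A k t \<omega>) + b k t \<omega> + \<zeta> k t \<omega>"
    and noise_centered:
      "\<And>k t. t < m k \<Longrightarrow> AE \<omega> in M. real_cond_exp M (G k t) (\<zeta> k t) \<omega> = 0"
    and noise_variance:
      "\<And>k t. t < m k \<Longrightarrow>
         AE \<omega> in M. nn_cond_exp M (G k t) (\<lambda>\<omega>'. ennreal (\<bar>\<zeta> k t \<omega>'\<bar>\<^sup>2)) \<omega> \<le> ennreal ((\<sigma> k)\<^sup>2)"
    and average_bias:
      "\<And>k. AE \<omega> in M. \<forall>s a.
         let T = visits (m k) (\<lambda>t. S k t \<omega>) (\<lambda>t. A k t \<omega>) (\<lambda>t. C k t \<omega>) s a
         in T \<noteq> {} \<longrightarrow> \<bar>(\<Sum>t\<in>T. b k t \<omega>) / real (card T)\<bar> \<le> bias k"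

end

(* The stochastic part and the algorithmic part are decoupled pathwise: the sampling argument only
   shows that almost surely the entrywise errors e_k of the empirical models are square-summable, and
   the rest is a deterministic statement about each such realization.

   Sampling: weighted sums of centered indicators and of the noise over a batch are sums of
   martingale differences, so their second moments are O(m_k (1 + sigma_k^2)), and their averages over the batch are
   almost surely square-summable. In particular they tend to zero, and since resets reach every
   state, the number of visits of every state-action pair eventually exceeds a fixed multiple of m_k.

   Algorithm: stationarity of the value step reads c + M^T Lambda_{k+1} = - dV / eta_V for the
   empirical M, and the empirical residual is dLambda / beta. With beta > 60 kappa^2 / eta_V this
   gives a linear recursion which bounds V, hence Lambda, on each realization. The augmented
   Lagrangian of the true model, rather than of the current empirical one, then decreases up to errors
   e_k * (|dpi| + |dV| + |dLambda|), which Young's inequality turns into O(e_k^2). *)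

theory Submission
  imports Defs
begin

section \<open>Bellman operators\<close>

text \<open>The batch condition makes the model errors square-summable, but they need not be
  summable, so any term linear in e_k alone would ruin the descent. Changing the model at a fixed
  point changes the augmented Lagrangian by just such a term. The empirical decrease of each step is
  therefore transferred to one fixed model as an increment: the error of an increment is a product
  of e_k and the length of the step. The second obstacle is that \<phi> is nonsmooth and nonconvex.
  In place of convexity, the smooth part of the policy objective is exactly quadratic, the residual
  being affine in the policy. Global minimality then gives an inequality with a quadratic error
  whose constant is the same for all k. It yields a regular subgradient at each new policy and, in
  the limit, convergence of the \<phi>-values, which lower semicontinuity gives only from one side.
  Boundedness has to precede the descent: the constants in the transfer of increments and the lower
  bound of the Lyapunov function are bounds on the values and multipliers of the
  realization.\<close>

definition bellman_lin ::
  "real \<Rightarrow> ('s::finite \<Rightarrow> 'a::finite \<Rightarrow> 's \<Rightarrow> real) \<Rightarrow> ('s \<Rightarrow> 'a \<Rightarrow> real) \<Rightarrow>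
   real^'s \<Rightarrow> real^'a^'s \<Rightarrow> real^'s" where
  "bellman_lin \<gamma> p r V h =
     (\<chi> s. - (\<Sum>a\<in>UNIV. h $ s $ a * (\<gamma> * (\<Sum>s'\<in>UNIV. p s a s' * V $ s') + r s a)))"

lemma P_pol_mult_nth:
  "(P_pol p \<pi> *v V) $ s = (\<Sum>a\<in>UNIV. \<pi> $ s $ a * (\<Sum>s'\<in>UNIV. p s a s' * V $ s'))"
proof -
  have "(P_pol p \<pi> *v V) $ s = (\<Sum>s'\<in>UNIV. \<Sum>a\<in>UNIV. \<pi> $ s $ a * p s a s' * V $ s')"
    by (simp add: P_pol_def matrix_vector_mult_def sum_distrib_right)
  also have "\<dots> = (\<Sum>a\<in>UNIV. \<Sum>s'\<in>UNIV. \<pi> $ s $ a * p s a s' * V $ s')"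
    by (rule sum.swap)
  finally show ?thesis by (simp add: sum_distrib_left mult.assoc)
qed

lemma M_pol_mult: "M_pol \<gamma> p \<pi> *v V = V - \<gamma> *\<^sub>R (P_pol p \<pi> *v V)"
  by (simp add: M_pol_def matrix_vector_mult_diff_rdistrib scaleR_matrix_vector_assoc)

lemma M_pol_mult_eq: "M_pol \<gamma> p \<pi> *v V = V + bellman_lin \<gamma> p (\<lambda>_ _. 0) V \<pi>"
  by (simp add: vec_eq_iff M_pol_mult bellman_lin_def P_pol_mult_nth sum_distrib_left mult_ac)

text \<open>For fixed \<open>V\<close> the residual is affine in the policy, with linear part
  \<open>bellman_lin\<close>, which is therefore the policy derivative. The same operator with zero
  reward describes the matrix (\<open>M_pol_mult_eq\<close>) and differences of values, so that one
  norm estimate serves them all.\<close>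

lemma bellman_res_eq: "bellman_res \<gamma> p r \<pi> V = V + bellman_lin \<gamma> p r V \<pi>"
  by (simp add: vec_eq_iff bellman_res_def M_pol_mult bellman_lin_def P_pol_mult_nth r_pol_def
      sum_distrib_left algebra_simps sum.distrib)

lemma bellman_res_value_diff:
  "bellman_res \<gamma> p r \<pi> V' - bellman_res \<gamma> p r \<pi> V = M_pol \<gamma> p \<pi> *v (V' - V)"
  by (simp add: bellman_res_def matrix_vector_mult_diff_distrib)

lemma linear_bellman_lin: "linear (bellman_lin \<gamma> p r V)"
  by (rule linearI) (simp_all add: vec_eq_iff bellman_lin_def algebra_simps sum.distrib sum_distrib_left)

lemma bellman_res_policy_diff:
  "bellman_res \<gamma> p r \<pi>' V - bellman_res \<gamma> p r \<pi> V = bellman_lin \<gamma> p r V (\<pi>' - \<pi>)"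
  by (simp add: bellman_res_eq linear_diff[OF linear_bellman_lin])

lemma J_pol_eq: "J_pol \<gamma> p r \<pi> V = bellman_lin \<gamma> p r V"
proof -
  have "((\<lambda>\<pi>'. bellman_res \<gamma> p r \<pi>' V) has_derivative bellman_lin \<gamma> p r V) (at \<pi>)"
    unfolding bellman_res_eq
    by (auto intro!: derivative_eq_intros linear_imp_has_derivative linear_bellman_lin)
  then show ?thesis unfolding J_pol_def by (metis frechet_derivative_at)
qed

lemma bellman_lin_model_diff:
  "bellman_lin \<gamma> p r V h - bellman_lin \<gamma> p' r' V h =
   bellman_lin \<gamma> (\<lambda>s a s'. p s a s' - p' s a s') (\<lambda>s a. r s a - r' s a) V h"
  by (simp add: vec_eq_iff bellman_lin_def algebra_simps sum_subtractf sum.distrib sum_distrib_left)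

lemma bellman_lin_value_diff:
  "bellman_lin \<gamma> p r V h - bellman_lin \<gamma> p r V' h = bellman_lin \<gamma> p (\<lambda>_ _. 0) (V - V') h"
  by (simp add: vec_eq_iff bellman_lin_def algebra_simps sum_subtractf sum.distrib sum_distrib_left)

text \<open>The cardinality factor is crude; what matters is linearity in the entry bounds
  \<open>e\<close> and \<open>d\<close>. For a single model these are 1 and a bound on the rewards,
  for the difference of two models both are the model error.\<close>

lemma norm_bellman_lin_le:
  fixes V :: "real^'s::finite" and h :: "real^'a::finite^'s"
  assumes \<gamma>: "0 \<le> \<gamma>" "\<gamma> \<le> 1"
    and p: "\<And>s a s'. \<bar>p s a s'\<bar> \<le> e" and r: "\<And>s a. \<bar>r s a\<bar> \<le> d"
  shows "norm (bellman_lin \<gamma> p r V h)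
    \<le> real (CARD('s) * CARD('a) * CARD('s)) * (e * norm V + d) * norm h"
proof -
  have e: "0 \<le> e" using p[of undefined undefined undefined] by linarith
  have d: "0 \<le> d" using r[of undefined undefined] by linarith
  have inner: "\<bar>\<gamma> * (\<Sum>s'\<in>UNIV. p s a s' * V $ s') + r s a\<bar> \<le> real CARD('s) * (e * norm V + d)" for s a
  proof -
    have "\<bar>\<Sum>s'\<in>UNIV. p s a s' * V $ s'\<bar> \<le> (\<Sum>s'\<in>(UNIV::'s set). e * norm V)"
      by (rule order_trans[OF sum_abs], rule sum_mono)
        (use p e component_le_norm_cart[of V] in \<open>auto simp: abs_mult intro!: mult_mono\<close>)
    then have "\<bar>\<gamma> * (\<Sum>s'\<in>UNIV. p s a s' * V $ s')\<bar> \<le> 1 * (real CARD('s) * (e * norm V))"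
      unfolding abs_mult using \<gamma> by (intro mult_mono) auto
    moreover have "d \<le> real CARD('s) * d"
      using d mult_right_mono[of 1 "real CARD('s)" d] by (simp add: Suc_leI)
    ultimately show ?thesis using r[of s a] by (simp add: algebra_simps)
  qed
  have entry: "\<bar>h $ s $ a\<bar> \<le> norm h" for s a
    by (rule order_trans[OF component_le_norm_cart Finite_Cartesian_Product.norm_nth_le])
  have "\<bar>bellman_lin \<gamma> p r V h $ s\<bar>
      \<le> (\<Sum>a\<in>(UNIV::'a set). norm h * (real CARD('s) * (e * norm V + d)))" for s
    unfolding bellman_lin_def vec_lambda_beta abs_minus_cancel
    by (rule order_trans[OF sum_abs], rule sum_mono)
      (auto simp: abs_mult intro!: mult_mono entry inner)
  then have "norm (bellman_lin \<gamma> p r V h)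
      \<le> (\<Sum>s\<in>(UNIV::'s set). \<Sum>a\<in>(UNIV::'a set). norm h * (real CARD('s) * (e * norm V + d)))"
    by (intro order_trans[OF norm_le_l1_cart] sum_mono)
  then show ?thesis by (simp add: mult_ac)
qed

lemma norm_policy_le:
  fixes \<pi> :: "real^'a::finite^'s::finite"
  assumes "\<pi> \<in> policies"
  shows "norm \<pi> \<le> real CARD('s)"
proof -
  have "norm \<pi> \<le> (\<Sum>s\<in>UNIV. norm (\<pi> $ s))"
    by (simp add: norm_vec_def L2_set_le_sum)
  also have "\<dots> \<le> (\<Sum>s\<in>(UNIV::'s set). 1)"
  proof (rule sum_mono)
    fix s
    have "norm (\<pi> $ s) \<le> (\<Sum>a\<in>UNIV. \<bar>\<pi> $ s $ a\<bar>)" by (rule norm_le_l1_cart)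
    then show "norm (\<pi> $ s) \<le> 1" using assms by (simp add: policies_def)
  qed
  finally show ?thesis by simp
qed

definition stochastic_rows :: "('s::finite \<Rightarrow> 'a \<Rightarrow> 's \<Rightarrow> real) \<Rightarrow> bool" where
  "stochastic_rows p \<longleftrightarrow> (\<forall>s a s'. 0 \<le> p s a s') \<and> (\<forall>s a. (\<Sum>s'\<in>UNIV. p s a s') = 1)"

lemma stochastic_rows_le_1:
  assumes "stochastic_rows p"
  shows "\<bar>p s a s'\<bar> \<le> 1"
proof -
  have "p s a s' \<le> (\<Sum>s'\<in>UNIV. p s a s')"
    using assms by (intro member_le_sum) (auto simp: stochastic_rows_def)
  then show ?thesis using assms by (simp add: stochastic_rows_def)
qed

lemma stochastic_empirical_P: "stochastic_rows (empirical_P P\<^sub>0 n S A C N)"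
proof -
  have "(\<Sum>s'\<in>UNIV. empirical_P P\<^sub>0 n S A C N s a s') = 1" for s a
  proof (cases "visits n S A C s a = {}")
    case True
    then show ?thesis by (simp add: empirical_P_def sum_pmf_eq_1)
  next
    case False
    let ?V = "visits n S A C s a"
    have fin: "finite ?V" by (simp add: visits_def)
    have "card ?V = card (\<Union>s'\<in>UNIV. {t \<in> ?V. N t = s'})" by (rule arg_cong[of _ _ card]) auto
    also have "\<dots> = (\<Sum>s'\<in>UNIV. card {t \<in> ?V. N t = s'})"
      by (rule card_UN_disjoint) (use fin in auto)
    finally have "(\<Sum>s'\<in>UNIV. real (card {t \<in> ?V. N t = s'})) = real (card ?V)" by simp
    then show ?thesis using False fin
      by (simp add: empirical_P_def flip: sum_divide_distrib)
  qed
  then show ?thesis by (simp add: stochastic_rows_def empirical_P_def)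
qed

text \<open>At an entry of largest modulus \<open>m\<close>, a kernel vector satisfies
  \<open>m\<close> = \<gamma> times an average of entries, hence m \<le> \<gamma> m and m = 0.
  Invertibility gives the bounds on \<open>matrix_inv\<close> their meaning, since
  \<open>matrix_inv\<close> of a singular matrix is an arbitrary choice.\<close>

lemma invertible_M_pol:
  fixes \<pi> :: "real^'a::finite^'s::finite"
  assumes \<gamma>: "0 \<le> \<gamma>" "\<gamma> < 1" and p: "stochastic_rows p" and \<pi>: "\<pi> \<in> policies"
  shows "invertible (M_pol \<gamma> p \<pi>)"
proof -
  have "v = 0" if v: "M_pol \<gamma> p \<pi> *v v = 0" for v
  proof -
    define m where "m = Max (range (\<lambda>s. \<bar>v $ s\<bar>))"
    have m: "\<bar>v $ s\<bar> \<le> m" for s unfolding m_def by (rule Max_ge) auto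
    have "m \<in> range (\<lambda>s. \<bar>v $ s\<bar>)" unfolding m_def by (rule Max_in) auto
    then obtain s where s: "m = \<bar>v $ s\<bar>" by auto
    have row: "\<bar>\<Sum>s'\<in>UNIV. p s a s' * v $ s'\<bar> \<le> m" for a
    proof -
      have "\<bar>\<Sum>s'\<in>UNIV. p s a s' * v $ s'\<bar> \<le> (\<Sum>s'\<in>UNIV. p s a s' * m)"
        by (rule order_trans[OF sum_abs], rule sum_mono)
          (use p m in \<open>auto simp: abs_mult stochastic_rows_def intro!: mult_left_mono\<close>)
      then show ?thesis using p by (simp add: stochastic_rows_def flip: sum_distrib_right)
    qed
    have "\<bar>(P_pol p \<pi> *v v) $ s\<bar> \<le> (\<Sum>a\<in>UNIV. \<pi> $ s $ a * m)"
      unfolding P_pol_mult_nth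
      by (rule order_trans[OF sum_abs], rule sum_mono)
        (use \<pi> row in \<open>auto simp: abs_mult policies_def intro!: mult_left_mono\<close>)
    also have "\<dots> = m" using \<pi> by (simp add: policies_def flip: sum_distrib_right)
    finally have *: "\<bar>(P_pol p \<pi> *v v) $ s\<bar> \<le> m" .
    have "v $ s = \<gamma> * (P_pol p \<pi> *v v) $ s" using v by (simp add: M_pol_mult vec_eq_iff)
    then have "m = \<gamma> * \<bar>(P_pol p \<pi> *v v) $ s\<bar>" using s \<gamma> by (simp add: abs_mult)
    then have "m \<le> \<gamma> * m" using * \<gamma> by (simp add: mult_left_mono)
    then have "m \<le> 0" using \<gamma> by (simp add: mult_le_cancel_right1)
    then show "v = 0" using m by (simp add: vec_eq_iff) (meson abs_le_zero_iff order_trans)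
  qed
  then show ?thesis by (simp add: invertible_left_inverse matrix_left_invertible_ker)
qed

section \<open>Norms of matrices, inverses and adjoints\<close>

lemma norm_le_spectral_norm: "norm (A *v x) \<le> spectral_norm A * norm (x::real^'n)"
  unfolding spectral_norm_def by (rule onorm) simp

lemma transpose_mult_inner: "(transpose A *v x) \<bullet> y = x \<bullet> (A *v (y::real^'n))"
  by (simp add: dot_lmul_matrix)

text \<open>Testing \<open>z = transpose A *v x\<close> against itself gives |z|^2 = x . (A z) \<le>
  K |x| |z|.\<close>

lemma norm_transpose_mult_le:
  fixes A :: "real^'n^'m"
  assumes "\<And>y. norm (A *v y) \<le> K * norm y"
  shows "norm (transpose A *v x) \<le> K * norm x"
proof -
  let ?z = "transpose A *v x"
  have "?z \<bullet> ?z = x \<bullet> (A *v ?z)" by (rule transpose_mult_inner)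
  also have "\<dots> \<le> norm x * (K * norm ?z)"
    by (rule order_trans[OF norm_cauchy_schwarz]) (intro mult_left_mono assms norm_ge_zero)
  finally have "norm ?z * norm ?z \<le> (K * norm x) * norm ?z"
    by (simp add: power2_norm_eq_inner[symmetric] power2_eq_square mult_ac)
  moreover have "0 \<le> K * norm x"
  proof (cases "x = 0")
    case False
    have "0 \<le> K" using assms[of "axis undefined 1"] norm_ge_zero[of "A *v axis undefined 1"]
      by (metis mult_1_right norm_axis_1 order_trans)
    then show ?thesis by simp
  qed simp
  ultimately show ?thesis by (cases "norm ?z = 0") (auto simp: mult_le_cancel_right)
qed

lemma matrix_inv_cancel:
  fixes A :: "real^'n^'n"
  assumes "invertible A"
  shows "matrix_inv A *v (A *v x) = x" "A *v (matrix_inv A *v x) = x"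
proof -
  have "A ** matrix_inv A = mat 1 \<and> matrix_inv A ** A = mat 1"
    using assms unfolding invertible_def matrix_inv_def by (rule someI_ex)
  then show "matrix_inv A *v (A *v x) = x" "A *v (matrix_inv A *v x) = x"
    by (simp_all add: matrix_vector_mul_assoc)
qed

lemma transpose_matrix_inv_cancel:
  fixes A :: "real^'n^'n"
  assumes "invertible A"
  shows "transpose A *v (transpose (matrix_inv A) *v x) = x"
proof -
  have "A ** matrix_inv A = mat 1 \<and> matrix_inv A ** A = mat 1"
    using assms unfolding invertible_def matrix_inv_def by (rule someI_ex)
  then have "transpose A ** transpose (matrix_inv A) = mat 1"
    by (metis matrix_transpose_mul transpose_mat)
  then show ?thesis
    by (simp add: matrix_vector_mul_assoc del: transpose_matrix_vector)
qed

lemma transpose_diff: "transpose (A - B) = transpose A - transpose (B::real^'n^'m)"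
  by (simp add: vec_eq_iff transpose_def)

lemma norm_le_inverse_bound:
  fixes A :: "real^'n^'n"
  assumes A: "invertible A" and K: "spectral_norm (matrix_inv A) \<le> K"
  shows "norm x \<le> K * norm (A *v x)" "norm x \<le> K * norm (transpose A *v x)"
proof -
  have bound: "norm (matrix_inv A *v y) \<le> K * norm y" for y
    by (rule order_trans[OF norm_le_spectral_norm]) (intro mult_right_mono K norm_ge_zero)
  show "norm x \<le> K * norm (A *v x)"
    using bound[of "A *v x"] by (simp add: matrix_inv_cancel[OF A])
  have "transpose (matrix_inv A) *v (transpose A *v x) = x"
  proof (rule vector_eq_ldot[THEN iffD1], rule allI)
    fix y
    show "y \<bullet> (transpose (matrix_inv A) *v (transpose A *v x)) = y \<bullet> x"
      using transpose_mult_inner[of "matrix_inv A" "transpose A *v x" y]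
        transpose_mult_inner[of A x "matrix_inv A *v y"]
      by (simp add: matrix_inv_cancel[OF A] inner_commute)
  qed
  then show "norm x \<le> K * norm (transpose A *v x)"
    using norm_transpose_mult_le[of "matrix_inv A" K "transpose A *v x", OF bound] by simp
qed

text \<open>Pair the difference z with itself and move both adjoints across: |z|^2 = f z . (x - y) +
  (f z - g z) . y. This separates the change of the multiplier from the change of the
  Jacobian.\<close>

lemma norm_adjoint_diff_le:
  fixes f g :: "'n::euclidean_space \<Rightarrow> 'm::euclidean_space"
  assumes f: "linear f" and g: "linear g"
    and K: "\<And>h. norm (f h) \<le> K * norm h" and K': "\<And>h. norm (f h - g h) \<le> K' * norm h"
    and nonneg: "0 \<le> K" "0 \<le> K'"
  shows "norm (adjoint f x - adjoint g y) \<le> K * norm (x - y) + K' * norm y"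
proof -
  let ?z = "adjoint f x - adjoint g y"
  have "?z \<bullet> ?z = ?z \<bullet> adjoint f x - ?z \<bullet> adjoint g y" by (simp add: inner_diff_right)
  also have "\<dots> = f ?z \<bullet> x - g ?z \<bullet> y" by (simp add: adjoint_works[OF f] adjoint_works[OF g])
  also have "\<dots> = f ?z \<bullet> (x - y) + (f ?z - g ?z) \<bullet> y" by (simp add: inner_diff_right inner_diff_left)
  also have "\<dots> \<le> (K * norm ?z) * norm (x - y) + (K' * norm ?z) * norm y"
    by (intro add_mono order_trans[OF norm_cauchy_schwarz] mult_right_mono K K' norm_ge_zero)
  finally have "norm ?z * norm ?z \<le> (K * norm (x - y) + K' * norm y) * norm ?z"
    by (simp add: power2_norm_eq_inner[symmetric] power2_eq_square algebra_simps)
  moreover have "0 \<le> K * norm (x - y) + K' * norm y" using nonneg by simp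
  ultimately show ?thesis by (cases "norm ?z = 0") (auto simp: mult_le_cancel_right)
qed

lemma continuous_bellman_res:
  assumes "(\<pi> \<longlongrightarrow> \<pi>0) F" "(V \<longlongrightarrow> V0) F"
  shows "((\<lambda>k. bellman_res \<gamma> p r (\<pi> k) (V k)) \<longlongrightarrow> bellman_res \<gamma> p r \<pi>0 V0) F"
  unfolding bellman_res_eq bellman_lin_def
  by (intro tendsto_intros assms tendsto_vec_lambda tendsto_vec_nth)

lemma continuous_transpose_M_pol:
  assumes "(\<pi> \<longlongrightarrow> \<pi>0) F" "(V \<longlongrightarrow> V0) F"
  shows "((\<lambda>k. transpose (M_pol \<gamma> p (\<pi> k)) *v V k) \<longlongrightarrow> transpose (M_pol \<gamma> p \<pi>0) *v V0) F"
  unfolding transpose_matrix_vector vector_matrix_mult_def M_pol_def P_pol_def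
  by (intro tendsto_intros assms tendsto_vec_lambda)

lemma norm_adjoint_bellman_lin_diff:
  fixes V V' :: "real^'s::finite" and p :: "'s \<Rightarrow> 'a::finite \<Rightarrow> 's \<Rightarrow> real"
  assumes \<gamma>: "0 \<le> \<gamma>" "\<gamma> \<le> 1" and p: "stochastic_rows p" and K: "0 \<le> K"
    and bound: "\<And>h. norm (bellman_lin \<gamma> p r V h) \<le> K * norm h"
  shows "norm (adjoint (bellman_lin \<gamma> p r V) x - adjoint (bellman_lin \<gamma> p r V') y)
    \<le> K * norm (x - y) + real (CARD('s) * CARD('a) * CARD('s)) * norm (V - V') * norm y"
proof (rule norm_adjoint_diff_le[OF linear_bellman_lin linear_bellman_lin bound])
  show "norm (bellman_lin \<gamma> p r V h - bellman_lin \<gamma> p r V' h)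
      \<le> real (CARD('s) * CARD('a) * CARD('s)) * norm (V - V') * norm h" for h
    using norm_bellman_lin_le[OF \<gamma> stochastic_rows_le_1[OF p], where r = "\<lambda>_ _. 0" and d = 0 and V = "V - V'" and h = h]
    by (simp add: bellman_lin_value_diff)
qed (use K in auto)

lemma closed_policies: "closed (policies :: (real^'a::finite^'s::finite) set)"
proof -
  have "policies = (\<Inter>s. \<Inter>a. {\<pi>. 0 \<le> \<pi> $ s $ a}) \<inter> (\<Inter>s. {\<pi>::real^'a^'s. (\<Sum>a\<in>UNIV. \<pi> $ s $ a) = 1})"
    by (auto simp: policies_def)
  also have "closed \<dots>"
    by (intro closed_Int closed_INT ballI closed_Collect_le closed_Collect_eq continuous_intros)
  finally show ?thesis .
qed

section \<open>Subgradients and elementary estimates\<close>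

text \<open>A minorant with quadratic error suffices, without convexity: after division by |y - x|
  the error is at most K |y - x|, which vanishes as y tends to x.\<close>

lemma regular_subgradient_at_minimizer:
  fixes f :: "'x::euclidean_space \<Rightarrow> ereal"
  assumes fin: "\<bar>f x\<bar> \<noteq> \<infinity>" and K: "0 \<le> K"
    and min: "\<And>y. f x + ereal (w \<bullet> (y - x)) \<le> f y + ereal (K * (norm (y - x))\<^sup>2)"
  shows "w \<in> regular_subdifferential f x"
proof -
  obtain a where a: "f x = ereal a" using fin by (cases "f x") auto
  have "((\<lambda>y. ereal (- (K * norm (y - x)))) \<longlongrightarrow> ereal (- (K * norm (x - x)))) (at x)"
    by (intro tendsto_intros)
  then have "Liminf (at x) (\<lambda>y. ereal (- (K * norm (y - x)))) = 0"
    by (simp add: lim_imp_Liminf zero_ereal_def)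
  moreover have "Liminf (at x) (\<lambda>y. ereal (- (K * norm (y - x))))
      \<le> Liminf (at x) (\<lambda>y. (f y - f x - ereal (w \<bullet> (y - x))) / ereal (norm (y - x)))"
  proof (rule Liminf_mono, unfold eventually_at_filter, rule always_eventually, intro allI impI)
    fix y assume "y \<noteq> x"
    then have n: "0 < norm (y - x)" by simp
    show "ereal (- (K * norm (y - x))) \<le> (f y - f x - ereal (w \<bullet> (y - x))) / ereal (norm (y - x))"
    proof (cases "f y")
      case (real b)
      have "- (K * norm (y - x)) * norm (y - x) \<le> b - a - w \<bullet> (y - x)"
        using min[of y] a real by (simp add: power2_eq_square algebra_simps)
      then have "- (K * norm (y - x)) \<le> (b - a - w \<bullet> (y - x)) / norm (y - x)"
        using n by (simp add: pos_le_divide_eq)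
      then show ?thesis using a real n by simp
    next
      case PInf
      then show ?thesis using a n by (simp add: divide_ereal_def)
    next
      case MInf
      then show ?thesis using min[of y] a by simp
    qed
  qed
  ultimately show ?thesis using fin by (simp add: regular_subdifferential_def)
qed

text \<open>\<open>Liminf (at x within X)\<close> ignores the point \<open>x\<close> itself, which
  the sequence may hit; there the premise \<open>y < f x\<close> takes over.\<close>

lemma lsc_on_sequentially:
  assumes "lsc_on X f" "x \<in> X" "\<And>j. xs j \<in> X" "xs \<longlonglongrightarrow> x" "y < f x"
  shows "\<forall>\<^sub>F j in sequentially. y < f (xs j)"
proof -
  have "f x \<le> Liminf (at x within X) f" using assms by (simp add: lsc_on_def)
  then have "\<forall>\<^sub>F z in at x within X. y < f z" using assms(5) by (simp add: le_Liminf_iff)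
  then have "\<forall>\<^sub>F z in nhds x. z \<in> X \<longrightarrow> y < f z"
    unfolding eventually_at_filter by (rule eventually_mono) (use assms(5) in auto)
  then have "\<forall>\<^sub>F j in sequentially. xs j \<in> X \<longrightarrow> y < f (xs j)"
    using assms(4) by (rule eventually_compose_filterlim)
  then show ?thesis using assms(3) by simp
qed

lemma regular_subset_limiting: "regular_subdifferential f x \<subseteq> limiting_subdifferential f x"
proof
  fix v assume v: "v \<in> regular_subdifferential f x"
  then have "\<bar>f x\<bar> \<noteq> \<infinity>" by (simp add: regular_subdifferential_def)
  moreover have "\<exists>xs vs. xs \<longlonglongrightarrow> x \<and> (\<lambda>n. f (xs n)) \<longlonglongrightarrow> f x \<and>
      (\<forall>n. vs n \<in> regular_subdifferential f (xs n)) \<and> vs \<longlonglongrightarrow> v"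
    by (rule exI[of _ "\<lambda>_. x"], rule exI[of _ "\<lambda>_. v"]) (simp add: v)
  ultimately show "v \<in> limiting_subdifferential f x"
    unfolding limiting_subdifferential_def by blast
qed

lemma two_step_recursion_bounded:
  fixes x :: "nat \<Rightarrow> real"
  assumes nonneg: "\<And>k. 0 \<le> x k" and K: "0 \<le> K" and \<theta>: "0 \<le> \<theta>" "\<theta> \<le> 1 / 60"
    and rec: "\<And>k. x (Suc (Suc k)) \<le> K + \<theta> * (x (Suc (Suc k)) + 2 * x (Suc k) + x k)"
  shows "\<exists>B. \<forall>k. x k \<le> B"
proof -
  \<comment> \<open>\<open>B\<close> dominates both initial terms and \<open>2 * K\<close>, so the
    induction step reads (59/60) x \<le> B/2 + 3B/60 = (33/60) B.\<close>
  define B where "B = x 0 + x 1 + 2 * K"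
  have "x k \<le> B \<and> x (Suc k) \<le> B" for k
  proof (induction k)
    case 0
    then show ?case using nonneg[of 0] nonneg[of 1] K by (simp add: B_def)
  next
    case (Suc k)
    have "x (Suc (Suc k)) \<le> K + (1 / 60) * (x (Suc (Suc k)) + 2 * x (Suc k) + x k)"
      using rec[of k] mult_right_mono[OF \<theta>(2), of "x (Suc (Suc k)) + 2 * x (Suc k) + x k"]
        nonneg[of k] nonneg[of "Suc k"] nonneg[of "Suc (Suc k)"] by linarith
    moreover have "2 * K \<le> B" using nonneg[of 0] nonneg[of 1] by (simp add: B_def)
    ultimately have "59 * x (Suc (Suc k)) \<le> 33 * B" "0 \<le> B" using conjunct1[OF Suc] conjunct2[OF Suc] K by (simp_all add: field_simps)
    then show ?case using Suc by auto
  qed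
  then show ?thesis by blast
qed

lemma descent_summable:
  fixes W d \<epsilon> :: "nat \<Rightarrow> real"
  assumes step: "\<And>k. W (Suc k) + d k \<le> W k + \<epsilon> k"
    and d: "\<And>k. 0 \<le> d k" and \<epsilon>: "\<And>k. 0 \<le> \<epsilon> k" "summable \<epsilon>" and W: "\<And>k. B \<le> W k"
  shows "summable d"
proof (rule summableI_nonneg_bounded[OF d])
  fix n
  have "W n + (\<Sum>i<n. d i) \<le> W 0 + (\<Sum>i<n. \<epsilon> i)"
  proof (induction n)
    case (Suc n)
    then show ?case using step[of n] by simp
  qed simp
  also have "\<dots> \<le> W 0 + suminf \<epsilon>" using \<epsilon> by (simp add: sum_le_suminf)
  finally show "(\<Sum>i<n. d i) \<le> W 0 + suminf \<epsilon> - B" using W[of n] by linarith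
qed

text \<open>Along \<open>- t *\<^sub>R g\<close> the linear term dominates the quadratic one for
  small t; the choice of \<open>t\<close> makes K t < 1 for either sign of \<open>K\<close>.\<close>

lemma zero_if_affine_quadratic_nonneg:
  fixes g :: "'v::real_inner"
  assumes "\<And>d. 0 \<le> g \<bullet> d + K * (norm d)\<^sup>2"
  shows "g = 0"
proof (rule ccontr)
  assume "g \<noteq> 0"
  then have g: "0 < (norm g)\<^sup>2" by simp
  define t where "t = 1 / (2 * (\<bar>K\<bar> + 1))"
  have t: "0 < t" "K * t < 1"
    by (auto simp: t_def field_simps abs_if)
  have "0 \<le> g \<bullet> (- t *\<^sub>R g) + K * (norm (- t *\<^sub>R g))\<^sup>2" by (rule assms)
  also have "\<dots> = (t * (norm g)\<^sup>2) * (K * t - 1)"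
  proof -
    have "g \<bullet> (- t *\<^sub>R g) = - t * (norm g)\<^sup>2" by (simp add: power2_norm_eq_inner)
    moreover have "(norm (- t *\<^sub>R g))\<^sup>2 = t\<^sup>2 * (norm g)\<^sup>2" by (simp add: power_mult_distrib)
    ultimately show ?thesis by (simp only:) (simp add: power2_eq_square algebra_simps)
  qed
  also have "\<dots> < 0" using t g by (intro mult_pos_neg) auto
  finally show False by simp
qed

lemma norm_add_sq: "(norm (x + y))\<^sup>2 = (norm x)\<^sup>2 + 2 * (x \<bullet> y) + (norm (y::'v::real_inner))\<^sup>2"
  by (simp add: power2_norm_eq_inner inner_add_left inner_add_right inner_commute)

text \<open>Here \<open>x\<close>, \<open>x'\<close> are true and \<open>y\<close>,
  \<open>y'\<close> empirical residuals before and after a step of length \<open>d\<close>. The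
  difference of the two increments consists of inner products, each having either the mixed
  difference D, of size e d, or an error of size e against a step of size d. No term is of order e
  alone.\<close>

lemma quadratic_increment_error:
  fixes l x x' y y' :: "'v::real_inner"
  assumes \<beta>: "0 \<le> \<beta>" and K: "0 \<le> K" and e: "0 \<le> e" and d: "0 \<le> d"
    and l: "norm l \<le> K" and x': "norm x' \<le> K" and y': "norm y' \<le> K"
    and xy: "norm (x - y) \<le> K * e" and xy': "norm ((x' - y') - (x - y)) \<le> K * e * d"
    and dx: "norm (x' - x) \<le> K * d" and dy: "norm (y' - y) \<le> K * d"
  shows "(l \<bullet> x' + \<beta> / 2 * (norm x')\<^sup>2) - (l \<bullet> x + \<beta> / 2 * (norm x)\<^sup>2)
    \<le> (l \<bullet> y' + \<beta> / 2 * (norm y')\<^sup>2) - (l \<bullet> y + \<beta> / 2 * (norm y)\<^sup>2) + (1 + 2 * \<beta>) * K\<^sup>2 * (e * d)"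
proof -
  let ?D = "(x' - y') - (x - y)"
  have "(l \<bullet> x' + \<beta> / 2 * (norm x')\<^sup>2) - (l \<bullet> x + \<beta> / 2 * (norm x)\<^sup>2)
      - ((l \<bullet> y' + \<beta> / 2 * (norm y')\<^sup>2) - (l \<bullet> y + \<beta> / 2 * (norm y)\<^sup>2))
    = l \<bullet> ?D + \<beta> / 2 * ((x' + y') \<bullet> ?D + ((x' - x) + (y' - y)) \<bullet> (x - y))"
    by (simp add: power2_norm_eq_inner inner_add_left inner_add_right inner_diff_left inner_diff_right
        inner_commute algebra_simps)
  also have "\<dots> \<le> K * (K * e * d) + \<beta> / 2 * ((K + K) * (K * e * d) + (K * d + K * d) * (K * e))"
    using K e d \<beta>
    by (intro add_mono mult_left_mono order_trans[OF norm_cauchy_schwarz] mult_mono l xy xy'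
        order_trans[OF norm_triangle_ineq] add_mono x' y' dx dy) auto
  also have "\<dots> = (1 + 2 * \<beta>) * K\<^sup>2 * (e * d)"
    by (simp add: power2_eq_square algebra_simps)
  finally show ?thesis by simp
qed

text \<open>The parameter \<open>t\<close> decides how much of the squared increment is spent:
  \<open>x\<^sup>2 / t\<close> is absorbed by the descent, the rest is summable.\<close>

lemma young_ineq:
  fixes C e x t :: real
  assumes "0 < t"
  shows "C * e * x \<le> x\<^sup>2 / t + t * C\<^sup>2 * e\<^sup>2"
proof -
  have "0 \<le> (x - t * C * e / 2)\<^sup>2" by simp
  then have "t * (C * e * x) \<le> x\<^sup>2 + (t * C * e)\<^sup>2 / 4" by (simp add: power2_eq_square algebra_simps)
  also have "\<dots> \<le> x\<^sup>2 + (t * C * e)\<^sup>2" by simp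
  finally show ?thesis using assms
    by (simp add: field_simps power2_eq_square)
qed

lemma four_squares_le:
  fixes l :: real
  assumes "0 \<le> l" "l \<le> x + y + z + w"
  shows "l\<^sup>2 \<le> 4 * (x\<^sup>2 + y\<^sup>2 + z\<^sup>2 + w\<^sup>2)"
proof -
  have "l\<^sup>2 \<le> (x + y + z + w)\<^sup>2" using assms by (intro power_mono) auto
  also have "\<dots> \<le> 4 * (x\<^sup>2 + y\<^sup>2 + z\<^sup>2 + w\<^sup>2)"
    using zero_le_power2[of "x - y"] zero_le_power2[of "x - z"] zero_le_power2[of "x - w"]
      zero_le_power2[of "y - z"] zero_le_power2[of "y - w"] zero_le_power2[of "z - w"]
    unfolding power2_eq_square by (simp only: algebra_simps)
  finally show ?thesis .
qed

lemma LIMSEQ_zero_if_summable_square: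
  fixes x :: "nat \<Rightarrow> real"
  assumes "summable (\<lambda>k. (x k)\<^sup>2)"
  shows "x \<longlonglongrightarrow> 0"
  using tendsto_real_sqrt[OF summable_LIMSEQ_zero[OF assms]]
  by (simp add: tendsto_rabs_zero_iff)

lemma LIMSEQ_zero_if_norm_le:
  fixes x :: "nat \<Rightarrow> 'v::real_normed_vector"
  assumes "\<And>k. norm (x k) \<le> b k" "b \<longlonglongrightarrow> l" "l = 0"
  shows "x \<longlonglongrightarrow> 0"
  using assms by (intro Lim_null_comparison[of x b]) auto

text \<open>Replaces the random number \<open>N\<close> of visits by the batch length
  \<open>n\<close>, at the price of the factor \<open>1 / c\<^sup>2\<close>.\<close>

lemma square_divide_le:
  fixes x :: real
  assumes "0 < c" "0 < n" "c * n \<le> N"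
  shows "(x / N)\<^sup>2 \<le> (x / n)\<^sup>2 / c\<^sup>2"
proof -
  have cn: "0 < c * n" using assms by simp
  with assms(3) have N: "0 < N" by linarith
  have "(c * n)\<^sup>2 \<le> N\<^sup>2" by (rule power_mono[OF assms(3)]) (use cn in simp)
  then have "x\<^sup>2 / N\<^sup>2 \<le> x\<^sup>2 / (c * n)\<^sup>2"
    by (rule divide_left_mono) (use cn N in \<open>simp_all only: zero_le_power2 mult_pos_pos zero_less_power\<close>)
  then show ?thesis using assms by (simp add: power_divide power_mult_distrib field_simps)
qed

section \<open>ADMM with square-summable model errors\<close>

text \<open>A single realization, with \<open>ph k\<close> and \<open>rh k\<close> the models of its
  batches. Sampling enters only through the scalar sequence \<open>e\<close>; bounds on the
  empirical rewards come from those on the true ones through \<open>model_error\<close>.\<close>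

locale inexact_bellman_admm =
  fixes \<gamma> :: real
    and p :: "'s::finite \<Rightarrow> 'a::finite \<Rightarrow> 's \<Rightarrow> real"
    and r :: "'s \<Rightarrow> 'a \<Rightarrow> real"
    and \<phi> :: "real^'a^'s \<Rightarrow> ereal"
    and c :: "real^'s"
    and ph :: "nat \<Rightarrow> 's \<Rightarrow> 'a \<Rightarrow> 's \<Rightarrow> real"
    and rh :: "nat \<Rightarrow> 's \<Rightarrow> 'a \<Rightarrow> real"
    and \<pi> :: "nat \<Rightarrow> real^'a^'s"
    and V \<Lambda> :: "nat \<Rightarrow> real^'s"
    and \<kappa> \<beta> \<eta>\<^sub>\<pi> \<eta>\<^sub>V L\<^sub>M :: real
    and e :: "nat \<Rightarrow> real"
  assumes discount: "0 < \<gamma>" "\<gamma> < 1"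
    and stochastic: "stochastic_rows p" "\<And>k. stochastic_rows (ph k)"
    and phi_proper: "proper_fun \<phi>"
    and phi_lsc: "lsc_on policies \<phi>"
    and phi_bdd: "bounded_below_on policies \<phi>"
    and kappa_emp: "\<And>k q. q \<in> policies \<Longrightarrow>
      spectral_norm (matrix_inv (M_pol \<gamma> (ph k) q)) \<le> \<kappa>"
    and parameters: "0 < \<beta>" "0 < \<eta>\<^sub>\<pi>" "0 < \<eta>\<^sub>V"
    and policy_step: "\<And>k.
      is_arg_min (\<lambda>q. aug_lagrangian \<gamma> (ph k) (rh k) \<phi> c \<beta> q (V k) (\<Lambda> k)
                       + ereal (1 / (2 * \<eta>\<^sub>\<pi>) * (norm (q - \<pi> k))\<^sup>2))
        (\<lambda>q. q \<in> policies) (\<pi> (Suc k))"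
    and value_step: "\<And>k.
      is_arg_min (\<lambda>v. aug_lagrangian \<gamma> (ph k) (rh k) \<phi> c \<beta> (\<pi> (Suc k)) v (\<Lambda> k)
                       + ereal (1 / (2 * \<eta>\<^sub>V) * (norm (v - V k))\<^sup>2))
        (\<lambda>v. True) (V (Suc k))"
    and multiplier_step: "\<And>k.
      \<Lambda> (Suc k) = \<Lambda> k + \<beta> *\<^sub>R bellman_res \<gamma> (ph k) (rh k) (\<pi> (Suc k)) (V (Suc k))"
    and init_policy: "\<pi> 0 \<in> effective_domain (\<lambda>q. \<phi> q + indicator_fun policies q)"
    and M_lipschitz: "\<And>q q'. q \<in> policies \<Longrightarrow> q' \<in> policies \<Longrightarrow>
      spectral_norm (M_pol \<gamma> p q' - M_pol \<gamma> p q) \<le> L\<^sub>M * norm (q' - q)"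
    and margin: "\<beta> > 60 * \<kappa>\<^sup>2 / \<eta>\<^sub>V" "\<beta> > 30 * \<eta>\<^sub>\<pi> * \<kappa>^4 * L\<^sub>M\<^sup>2 * (norm c)\<^sup>2"
    and model_error: "\<And>k s a s'. \<bar>p s a s' - ph k s a s'\<bar> \<le> e k"
      "\<And>k s a. \<bar>r s a - rh k s a\<bar> \<le> e k"
    and error_summable: "summable (\<lambda>k. (e k)\<^sup>2)"
begin

abbreviation "Rh k \<equiv> bellman_res \<gamma> (ph k) (rh k)"
abbreviation "Mh k \<equiv> M_pol \<gamma> (ph k)"
abbreviation "\<psi> \<equiv> (\<lambda>q. \<phi> q + indicator_fun policies q)"

definition "d\<pi> k = norm (\<pi> (Suc k) - \<pi> k)"
definition "dV k = norm (V (Suc k) - V k)"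
definition "d\<Lambda> k = norm (\<Lambda> (Suc k) - \<Lambda> k)"
text \<open>The finite part of the policy objective, without the term
  \<open>c \<bullet> V k\<close>, which is constant in the policy step.\<close>

definition "smooth k q = \<Lambda> k \<bullet> Rh k q (V k) + \<beta> / 2 * (norm (Rh k q (V k)))\<^sup>2
  + 1 / (2 * \<eta>\<^sub>\<pi>) * (norm (q - \<pi> k))\<^sup>2"

section \<open>Feasibility of the policies and finiteness of \<phi> along the iteration\<close>

lemma gamma_le: "0 \<le> \<gamma>" "\<gamma> \<le> 1"
  using discount by auto

lemma e_nonneg: "0 \<le> e k"
  using model_error(2)[of undefined undefined k] by linarith

lemma e_tendsto: "e \<longlonglongrightarrow> 0"
  by (rule LIMSEQ_zero_if_summable_square[OF error_summable])

lemma phi_not_MInf: "\<phi> q \<noteq> -\<infinity>"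
  using phi_proper by (simp add: proper_fun_def)

lemma policy_in: "\<pi> k \<in> policies"
proof (cases k)
  case 0
  have "\<phi> (\<pi> 0) + indicator_fun policies (\<pi> 0) < \<infinity>"
    using init_policy by (simp add: effective_domain_def)
  then show ?thesis using 0 phi_not_MInf[of "\<pi> 0"]
    by (auto simp: indicator_fun_def split: if_splits)
next
  case (Suc j)
  then show ?thesis using policy_step[of j] by (simp add: is_arg_min_def)
qed

lemma policy_min:
  assumes "q \<in> policies"
  shows "\<phi> (\<pi> (Suc k)) + ereal (smooth k (\<pi> (Suc k))) \<le> \<phi> q + ereal (smooth k q)"
proof -
  have *: "aug_lagrangian \<gamma> (ph k) (rh k) \<phi> c \<beta> q (V k) (\<Lambda> k)
      + ereal (1 / (2 * \<eta>\<^sub>\<pi>) * (norm (q - \<pi> k))\<^sup>2)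
    = (\<phi> q + ereal (smooth k q)) + ereal (c \<bullet> V k)" for q
    by (cases "\<phi> q") (simp_all add: aug_lagrangian_def smooth_def)
  have "(\<phi> (\<pi> (Suc k)) + ereal (smooth k (\<pi> (Suc k)))) + ereal (c \<bullet> V k)
      \<le> (\<phi> q + ereal (smooth k q)) + ereal (c \<bullet> V k)"
    using policy_step[of k] assms unfolding is_arg_min_linorder * by blast
  then show ?thesis
    by (cases "\<phi> q"; cases "\<phi> (\<pi> (Suc k))") auto
qed

lemma phi_init_finite: "\<phi> (\<pi> 0) < \<infinity>"
proof -
  have "\<phi> (\<pi> 0) + indicator_fun policies (\<pi> 0) < \<infinity>"
    using init_policy by (simp add: effective_domain_def)
  then show ?thesis using policy_in[of 0] by (simp add: indicator_fun_def)
qed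

text \<open>Every new policy is compared with \<open>\<pi> 0\<close>, which is a competitor of
  finite value in each policy step; no induction over the iterates is involved.\<close>

lemma phi_finite: "\<bar>\<phi> (\<pi> k)\<bar> \<noteq> \<infinity>"
proof (cases k)
  case 0
  then show ?thesis using phi_init_finite phi_not_MInf[of "\<pi> 0"] by auto
next
  case (Suc j)
  then show ?thesis
    using policy_min[OF policy_in[of 0], of j] phi_init_finite phi_not_MInf[of "\<pi> k"]
    by (cases "\<phi> (\<pi> k)"; cases "\<phi> (\<pi> 0)") auto
qed

definition "f k = real_of_ereal (\<phi> (\<pi> k))"

lemma phi_eq: "\<phi> (\<pi> k) = ereal (f k)"
  using phi_finite[of k] by (simp add: f_def ereal_real)

section \<open>Optimality and decrease in the value step\<close>

lemma value_min:
  "c \<bullet> V (Suc k) + \<Lambda> k \<bullet> Rh k (\<pi> (Suc k)) (V (Suc k))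
      + \<beta> / 2 * (norm (Rh k (\<pi> (Suc k)) (V (Suc k))))\<^sup>2 + 1 / (2 * \<eta>\<^sub>V) * (norm (V (Suc k) - V k))\<^sup>2
   \<le> c \<bullet> v + \<Lambda> k \<bullet> Rh k (\<pi> (Suc k)) v
      + \<beta> / 2 * (norm (Rh k (\<pi> (Suc k)) v))\<^sup>2 + 1 / (2 * \<eta>\<^sub>V) * (norm (v - V k))\<^sup>2"
  using value_step[of k] unfolding is_arg_min_linorder aug_lagrangian_def phi_eq
  by (auto dest!: spec[of _ v])

text \<open>Exact expansion about the new value. In its gradient, \<open>\<Lambda> k\<close> plus
  \<beta> times the new empirical residual is \<open>\<Lambda> (Suc k)\<close>, so the multiplier
  update turns the gradient into the adjoint residual at the new multiplier. Arbitrary directions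
  give optimality, the direction back to \<open>V k\<close> gives the decrease.\<close>

lemma value_objective_expand:
  fixes d :: "real^'s"
  shows "c \<bullet> (V (Suc k) + d) + \<Lambda> k \<bullet> Rh k (\<pi> (Suc k)) (V (Suc k) + d)
      + \<beta> / 2 * (norm (Rh k (\<pi> (Suc k)) (V (Suc k) + d)))\<^sup>2
      + 1 / (2 * \<eta>\<^sub>V) * (norm (V (Suc k) + d - V k))\<^sup>2
   = c \<bullet> V (Suc k) + \<Lambda> k \<bullet> Rh k (\<pi> (Suc k)) (V (Suc k))
      + \<beta> / 2 * (norm (Rh k (\<pi> (Suc k)) (V (Suc k))))\<^sup>2 + 1 / (2 * \<eta>\<^sub>V) * (norm (V (Suc k) - V k))\<^sup>2
      + ((c + transpose (Mh k (\<pi> (Suc k))) *v \<Lambda> (Suc k) + (1 / \<eta>\<^sub>V) *\<^sub>R (V (Suc k) - V k)) \<bullet> d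
         + \<beta> / 2 * (norm (Mh k (\<pi> (Suc k)) *v d))\<^sup>2 + 1 / (2 * \<eta>\<^sub>V) * (norm d)\<^sup>2)"
proof -
  let ?A = "Mh k (\<pi> (Suc k))" and ?R = "Rh k (\<pi> (Suc k)) (V (Suc k))"
  have R: "Rh k (\<pi> (Suc k)) (V (Suc k) + d) = ?R + ?A *v d"
    using bellman_res_value_diff[of \<gamma> "ph k" "rh k" "\<pi> (Suc k)" "V (Suc k) + d" "V (Suc k)"]
    by (simp add: diff_eq_eq add.commute)
  have d: "V (Suc k) + d - V k = (V (Suc k) - V k) + d" by simp
  have t: "(transpose ?A *v \<Lambda> (Suc k)) \<bullet> d = \<Lambda> k \<bullet> (?A *v d) + \<beta> * (?R \<bullet> (?A *v d))"
    unfolding transpose_mult_inner multiplier_step by (simp add: inner_add_left)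
  have g: "(c + transpose ?A *v \<Lambda> (Suc k) + (1 / \<eta>\<^sub>V) *\<^sub>R (V (Suc k) - V k)) \<bullet> d
      = c \<bullet> d + (transpose ?A *v \<Lambda> (Suc k)) \<bullet> d + 1 / \<eta>\<^sub>V * ((V (Suc k) - V k) \<bullet> d)"
    by (simp only: inner_add_left inner_scaleR_left)
  show ?thesis unfolding R d norm_add_sq g t inner_add_right distrib_left by simp
qed

lemma value_optimality:
  "c + transpose (Mh k (\<pi> (Suc k))) *v \<Lambda> (Suc k) = - (1 / \<eta>\<^sub>V) *\<^sub>R (V (Suc k) - V k)"
proof -
  let ?A = "Mh k (\<pi> (Suc k))"
  let ?g = "c + transpose ?A *v \<Lambda> (Suc k) + (1 / \<eta>\<^sub>V) *\<^sub>R (V (Suc k) - V k)"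
  let ?K = "\<beta> / 2 * (spectral_norm ?A)\<^sup>2 + 1 / (2 * \<eta>\<^sub>V)"
  have "0 \<le> ?g \<bullet> d + ?K * (norm d)\<^sup>2" for d
  proof -
    have "0 \<le> ?g \<bullet> d + \<beta> / 2 * (norm (?A *v d))\<^sup>2 + 1 / (2 * \<eta>\<^sub>V) * (norm d)\<^sup>2"
      using value_min[of k "V (Suc k) + d"] unfolding value_objective_expand by linarith
    moreover have "\<beta> / 2 * (norm (?A *v d))\<^sup>2 \<le> \<beta> / 2 * (spectral_norm ?A * norm d)\<^sup>2"
      using parameters by (intro mult_left_mono power_mono norm_le_spectral_norm) auto
    ultimately show ?thesis by (simp add: power_mult_distrib algebra_simps)
  qed
  then have "?g = 0" by (rule zero_if_affine_quadratic_nonneg)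
  then show ?thesis by (simp add: eq_neg_iff_add_eq_0)
qed

text \<open>The expansion in the direction \<open>V k - V (Suc k)\<close>, where the gradient term
  vanishes. The proximal term counts twice, once from the minimizer and once from the curvature;
  hence \<open>1 / \<eta>\<^sub>V\<close> instead of half of it.\<close>

lemma value_decrease:
  "c \<bullet> V (Suc k) + \<Lambda> k \<bullet> Rh k (\<pi> (Suc k)) (V (Suc k))
      + \<beta> / 2 * (norm (Rh k (\<pi> (Suc k)) (V (Suc k))))\<^sup>2 + 1 / \<eta>\<^sub>V * (dV k)\<^sup>2
   \<le> c \<bullet> V k + \<Lambda> k \<bullet> Rh k (\<pi> (Suc k)) (V k) + \<beta> / 2 * (norm (Rh k (\<pi> (Suc k)) (V k)))\<^sup>2"
proof -
  let ?d = "V k - V (Suc k)"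
  have "0 \<le> \<beta> / 2 * (norm (Mh k (\<pi> (Suc k)) *v ?d))\<^sup>2" using parameters by simp
  moreover have "c + transpose (Mh k (\<pi> (Suc k))) *v \<Lambda> (Suc k) + (1 / \<eta>\<^sub>V) *\<^sub>R (V (Suc k) - V k) = 0"
    unfolding value_optimality by simp
  moreover have "norm ?d = dV k" by (simp add: dV_def norm_minus_commute)
  moreover have "1 / \<eta>\<^sub>V * (dV k)\<^sup>2 = 2 * (1 / (2 * \<eta>\<^sub>V) * (dV k)\<^sup>2)" by simp
  ultimately show ?thesis
    using value_objective_expand[of k ?d] by (simp add: dV_def del: transpose_matrix_vector)
qed

section \<open>Inverse bounds and the adjoint solution\<close>

lemma invertible_Mh: "q \<in> policies \<Longrightarrow> invertible (Mh k q)"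
  using discount stochastic by (intro invertible_M_pol) auto

lemma norm_le_Mh:
  assumes "q \<in> policies"
  shows "norm x \<le> \<kappa> * norm (Mh k q *v x)" "norm x \<le> \<kappa> * norm (transpose (Mh k q) *v x)"
  using norm_le_inverse_bound[OF invertible_Mh[OF assms] kappa_emp[OF assms]] by blast+

lemma kappa_nonneg: "0 \<le> \<kappa>"
proof -
  obtain x :: "real^'s" where x: "norm x = 1" using vector_choose_size[of 1] by auto
  show ?thesis
  proof (rule ccontr)
    assume "\<not> 0 \<le> \<kappa>"
    then have "\<kappa> * norm (Mh 0 (\<pi> 0) *v x) \<le> 0" by (simp add: mult_nonpos_nonneg)
    then show False using norm_le_Mh(1)[OF policy_in[of 0], of x 0] x by linarith
  qed
qed

text \<open>Unlike the multiplier, the solution of the adjoint equation of the empirical model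
  changes only with the policy and the model; the two differ by \<open>O(dV k)\<close>.\<close>

definition "U k = - (transpose (matrix_inv (Mh k (\<pi> (Suc k)))) *v c)"

lemma U_eq: "transpose (Mh k (\<pi> (Suc k))) *v U k = - c"
  unfolding U_def
  using transpose_matrix_inv_cancel[OF invertible_Mh[OF policy_in[of "Suc k"]], of k c]
  by (simp only: linear_neg[OF matrix_vector_mul_linear])

text \<open>The transposed matrix maps the difference to
  \<open>c + transpose (Mh k (\<pi> (Suc k))) *v \<Lambda> (Suc k)\<close>, which
  \<open>value_optimality\<close> identifies with a multiple of the value increment.\<close>

lemma Lambda_U: "norm (\<Lambda> (Suc k) - U k) \<le> \<kappa> / \<eta>\<^sub>V * dV k"
proof -
  let ?A = "transpose (Mh k (\<pi> (Suc k)))"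
  have "?A *v (\<Lambda> (Suc k) - U k) = (c + ?A *v \<Lambda> (Suc k))"
    using U_eq[of k] by (simp only: matrix_vector_mult_diff_distrib) simp
  then have "norm (?A *v (\<Lambda> (Suc k) - U k)) = dV k / \<eta>\<^sub>V"
    using parameters unfolding value_optimality by (simp add: dV_def)
  then show ?thesis using norm_le_Mh(2)[OF policy_in[of "Suc k"], of "\<Lambda> (Suc k) - U k" k] by simp
qed

lemma norm_U: "norm (U k) \<le> \<kappa> * norm c"
  using norm_le_Mh(2)[OF policy_in[of "Suc k"], of "U k" k] unfolding U_eq by simp

definition "n = real (CARD('s) * CARD('a) * CARD('s))"

lemma n_ge_1: "1 \<le> n"
proof -
  have "1 \<le> CARD('s) * CARD('a) * CARD('s)" by (simp add: Suc_leI)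
  then show ?thesis unfolding n_def by linarith
qed

lemma norm_policy_le_n: "norm (\<pi> k) \<le> n"
proof -
  have "CARD('s) * 1 \<le> CARD('s) * (CARD('a) * CARD('s))"
    by (intro mult_left_mono) (simp_all add: Suc_leI)
  then have "real CARD('s) \<le> n" unfolding n_def by (simp only: mult.assoc of_nat_le_iff)
  then show ?thesis using norm_policy_le[OF policy_in[of k]] by linarith
qed

lemma Mh_diff_le:
  assumes "q \<in> policies" "norm q \<le> n"
  shows "norm ((Mh k q - M_pol \<gamma> p q) *v x) \<le> n * n * e k * norm x"
proof -
  have "(Mh k q - M_pol \<gamma> p q) *v x
      = bellman_lin \<gamma> (\<lambda>s a s'. ph k s a s' - p s a s') (\<lambda>_ _. 0) x q"
    using bellman_lin_model_diff[of \<gamma> "ph k" "\<lambda>_ _. 0" x q p "\<lambda>_ _. 0"]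
    by (simp add: matrix_vector_mult_diff_rdistrib M_pol_mult_eq)
  moreover have "norm (bellman_lin \<gamma> (\<lambda>s a s'. ph k s a s' - p s a s') (\<lambda>_ _. 0) x q)
      \<le> n * (e k * norm x + 0) * norm q"
    unfolding n_def
    by (rule norm_bellman_lin_le[OF gamma_le]) (use model_error in \<open>auto simp: abs_minus_commute\<close>)
  also have "\<dots> \<le> n * (e k * norm x + 0) * n"
    using assms n_ge_1 e_nonneg[of k] by (intro mult_left_mono) auto
  ultimately show ?thesis by (simp add: mult_ac)
qed

text \<open>Both adjoint equations have the right-hand side -c, so the new transposed matrix maps
  the difference of the solutions to the change of matrix applied to the old solution. Since
  \<open>M_lipschitz\<close> concerns the true matrices, that change is routed through them, which
  costs one model error at each end.\<close>

lemma U_diff: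
  "norm (U (Suc k) - U k)
    \<le> \<kappa> * ((L\<^sub>M * d\<pi> (Suc k) + n * n * (e (Suc k) + e k)) * (\<kappa> * norm c))"
proof -
  let ?A = "Mh (Suc k) (\<pi> (Suc (Suc k)))" and ?B = "Mh k (\<pi> (Suc k))"
  let ?A' = "M_pol \<gamma> p (\<pi> (Suc (Suc k)))" and ?B' = "M_pol \<gamma> p (\<pi> (Suc k))"
  let ?K = "L\<^sub>M * d\<pi> (Suc k) + n * n * (e (Suc k) + e k)"
  have bound: "norm ((?B - ?A) *v y) \<le> ?K * norm y" for y
  proof -
    have "(?B - ?A) *v y = (?B - ?B') *v y - (?A - ?A') *v y - (?A' - ?B') *v y"
      by (simp add: matrix_vector_mult_diff_rdistrib)
    also have "norm \<dots> \<le> n * n * e k * norm y + n * n * e (Suc k) * norm y + L\<^sub>M * d\<pi> (Suc k) * norm y"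
    proof (intro order_trans[OF norm_triangle_ineq4] add_mono Mh_diff_le policy_in norm_policy_le_n)
      show "norm ((?A' - ?B') *v y) \<le> L\<^sub>M * d\<pi> (Suc k) * norm y"
        unfolding d\<pi>_def
        by (rule order_trans[OF norm_le_spectral_norm])
          (intro mult_right_mono M_lipschitz policy_in norm_ge_zero)
    qed
    finally show ?thesis by (simp add: algebra_simps)
  qed
  have "transpose ?A *v (U (Suc k) - U k) = transpose (?B - ?A) *v U k"
    unfolding transpose_diff matrix_vector_mult_diff_distrib matrix_vector_mult_diff_rdistrib U_eq ..
  then have "norm (transpose ?A *v (U (Suc k) - U k)) \<le> ?K * norm (U k)"
    using norm_transpose_mult_le[of "?B - ?A" ?K "U k", OF bound] by simp
  also have "\<dots> \<le> ?K * (\<kappa> * norm c)"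
  proof (rule mult_left_mono[OF norm_U])
    \<comment> \<open>The sign of \<open>L\<^sub>M\<close> is not given; the bound at a unit vector
      shows that the whole factor is nonnegative.\<close>
    obtain x :: "real^'s" where x: "norm x = 1" using vector_choose_size[of 1] by auto
    show "0 \<le> ?K" using order_trans[OF norm_ge_zero bound[of x]] x by simp
  qed
  finally have "\<kappa> * norm (transpose ?A *v (U (Suc k) - U k)) \<le> \<kappa> * (?K * (\<kappa> * norm c))"
    by (rule mult_left_mono[OF _ kappa_nonneg])
  then show ?thesis
    using norm_le_Mh(2)[OF policy_in[of "Suc (Suc k)"], of "U (Suc k) - U k" "Suc k"] by linarith
qed

text \<open>Consecutive multipliers are compared through \<open>U\<close>: two gaps from
  \<open>Lambda_U\<close> and the drift of \<open>U\<close>. The square of the coefficient of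
  \<open>d\<pi> (Suc k)\<close> is the quantity \<kappa>^4 L_M^2 |c|^2 of the margin
  condition.\<close>

lemma multiplier_increment:
  "d\<Lambda> (Suc k) \<le> \<kappa>\<^sup>2 * norm c * L\<^sub>M * d\<pi> (Suc k) + \<kappa> / \<eta>\<^sub>V * dV (Suc k) + \<kappa> / \<eta>\<^sub>V * dV k
    + \<kappa>\<^sup>2 * norm c * n * n * (e (Suc k) + e k)"
proof -
  have "\<Lambda> (Suc (Suc k)) - \<Lambda> (Suc k)
      = (\<Lambda> (Suc (Suc k)) - U (Suc k)) - (\<Lambda> (Suc k) - U k) + (U (Suc k) - U k)" by simp
  also have "norm \<dots> \<le> \<kappa> / \<eta>\<^sub>V * dV (Suc k) + \<kappa> / \<eta>\<^sub>V * dV k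
      + \<kappa> * ((L\<^sub>M * d\<pi> (Suc k) + n * n * (e (Suc k) + e k)) * (\<kappa> * norm c))"
    by (intro order_trans[OF norm_triangle_ineq] add_mono U_diff
        order_trans[OF norm_triangle_ineq4] Lambda_U)
  finally show ?thesis by (simp add: d\<Lambda>_def power2_eq_square algebra_simps)
qed

section \<open>Boundedness of the iterates and uniform operator bounds\<close>

lemma norm_Lambda_Suc: "norm (\<Lambda> (Suc k)) \<le> \<kappa> * norm c + \<kappa> / \<eta>\<^sub>V * dV k"
  using norm_triangle_ineq[of "U k" "\<Lambda> (Suc k) - U k"] norm_U[of k] Lambda_U[of k] by simp

text \<open>Inverting the residual equation bounds the new value by a constant plus \<kappa>/\<beta>
  times the norms of two consecutive multipliers, and each of these by a constant plus
  \<kappa>/\<eta>_V times a value increment. The product of the coefficients is \<theta>. Three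
  consecutive values occur because two consecutive increments do.\<close>

lemma value_bounded: "\<exists>B. \<forall>k. norm (V k) \<le> B"
proof -
  obtain E where E: "\<And>k. e k \<le> E"
    using e_tendsto by (metis Bseq_def abs_le_D1 convergentI convergent_imp_Bseq real_norm_def)
  define Q where "Q = (\<Sum>s\<in>UNIV. \<Sum>a\<in>UNIV. \<bar>r s a\<bar>)"
  have Q: "\<bar>r s a\<bar> \<le> Q" for s a
  proof -
    have "\<bar>r s a\<bar> \<le> (\<Sum>a\<in>UNIV. \<bar>r s a\<bar>)" by (rule member_le_sum) auto
    also have "\<dots> \<le> Q" unfolding Q_def
      by (rule member_le_sum) (auto intro: sum_nonneg)
    finally show ?thesis .
  qed
  \<comment> \<open>Bounds the empirical residual at the zero value, which is minus the empirical
    policy reward: one factor \<open>n\<close> for the operator, one for the norm of the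
    policy.\<close>
  define D where "D = n * (Q + E) * n"
  have QE: "0 \<le> Q + E"
    using Q[of undefined undefined] E[of 0] e_nonneg[of 0] by linarith
  have zero: "norm (Rh k (\<pi> (Suc k)) 0) \<le> D" for k
  proof -
    have "norm (bellman_lin \<gamma> (ph k) (rh k) 0 (\<pi> (Suc k))) \<le> n * (1 * norm (0::real^'s) + (Q + E)) * norm (\<pi> (Suc k))"
      unfolding n_def
    proof (rule norm_bellman_lin_le[OF gamma_le])
      show "\<bar>rh k s a\<bar> \<le> Q + E" for s a
        using model_error(2)[of s a k] Q[of s a] E[of k] by linarith
    qed (rule stochastic_rows_le_1[OF stochastic(2)])
    also have "\<dots> \<le> D" unfolding D_def using n_ge_1 QE
      by (auto intro!: mult_left_mono norm_policy_le_n)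
    finally show ?thesis by (simp add: bellman_res_eq)
  qed
  have D: "0 \<le> D" using zero[of 0] norm_ge_zero order_trans by blast
  define \<theta> where "\<theta> = \<kappa>\<^sup>2 / (\<beta> * \<eta>\<^sub>V)"
  have \<theta>: "0 \<le> \<theta>" "\<theta> \<le> 1 / 60"
    using margin(1) parameters by (auto simp: \<theta>_def field_simps)
  have V: "norm (V (Suc k)) \<le> \<kappa> * D + \<kappa> / \<beta> * (norm (\<Lambda> (Suc k)) + norm (\<Lambda> k))" for k
  proof -
    let ?A = "Mh k (\<pi> (Suc k))"
    have "?A *v V (Suc k) = Rh k (\<pi> (Suc k)) (V (Suc k)) - Rh k (\<pi> (Suc k)) 0"
      by (simp add: bellman_res_value_diff)
    also have "Rh k (\<pi> (Suc k)) (V (Suc k)) = (1 / \<beta>) *\<^sub>R (\<Lambda> (Suc k) - \<Lambda> k)"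
      using parameters unfolding multiplier_step by simp
    also have "norm ((1 / \<beta>) *\<^sub>R (\<Lambda> (Suc k) - \<Lambda> k) - Rh k (\<pi> (Suc k)) 0)
        \<le> 1 / \<beta> * (norm (\<Lambda> (Suc k)) + norm (\<Lambda> k)) + D"
      using parameters
      by (intro order_trans[OF norm_triangle_ineq4] add_mono zero)
        (auto intro!: divide_right_mono norm_triangle_ineq4)
    finally have "\<kappa> * norm (?A *v V (Suc k)) \<le> \<kappa> * (1 / \<beta> * (norm (\<Lambda> (Suc k)) + norm (\<Lambda> k)) + D)"
      by (rule mult_left_mono[OF _ kappa_nonneg])
    then show ?thesis using norm_le_Mh(1)[OF policy_in[of "Suc k"], of "V (Suc k)" k]
      by (simp add: algebra_simps)
  qed
  have dV: "dV k \<le> norm (V (Suc k)) + norm (V k)" for k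
    unfolding dV_def by (rule norm_triangle_ineq4)
  let ?K = "\<kappa> * D + 2 * \<kappa>\<^sup>2 * norm c / \<beta>"
  have "norm (V (Suc (Suc k)))
      \<le> ?K + \<theta> * (norm (V (Suc (Suc k))) + 2 * norm (V (Suc k)) + norm (V k))" for k
  proof -
    have "norm (\<Lambda> (Suc (Suc k))) + norm (\<Lambda> (Suc k))
        \<le> 2 * (\<kappa> * norm c) + \<kappa> / \<eta>\<^sub>V * (dV (Suc k) + dV k)"
      using norm_Lambda_Suc[of k] norm_Lambda_Suc[of "Suc k"] by (simp add: algebra_simps)
    also have "\<dots> \<le> 2 * (\<kappa> * norm c)
        + \<kappa> / \<eta>\<^sub>V * (norm (V (Suc (Suc k))) + 2 * norm (V (Suc k)) + norm (V k))"
      using dV[of k] dV[of "Suc k"] kappa_nonneg parameters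
      by (intro add_left_mono mult_left_mono) auto
    finally have "\<kappa> / \<beta> * (norm (\<Lambda> (Suc (Suc k))) + norm (\<Lambda> (Suc k))) \<le> \<kappa> / \<beta> * (2 * (\<kappa> * norm c)
        + \<kappa> / \<eta>\<^sub>V * (norm (V (Suc (Suc k))) + 2 * norm (V (Suc k)) + norm (V k)))"
      using kappa_nonneg parameters by (intro mult_left_mono) auto
    also have "\<dots> = 2 * \<kappa>\<^sup>2 * norm c / \<beta> + \<theta> * (norm (V (Suc (Suc k))) + 2 * norm (V (Suc k)) + norm (V k))"
      using parameters by (simp add: \<theta>_def power2_eq_square field_simps)
    finally show ?thesis using V[of "Suc k"] by linarith
  qed
  moreover have "0 \<le> ?K" using D kappa_nonneg parameters by simp
  ultimately show ?thesis using \<theta> by (intro two_step_recursion_bounded[of "\<lambda>k. norm (V k)"]) auto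
qed

lemma common_bound:
  obtains B where "1 \<le> B" "n \<le> B" "\<And>k. norm (V k) \<le> B" "\<And>k. norm (\<Lambda> k) \<le> B" "\<And>k. e k \<le> B"
    "\<And>s a. \<bar>r s a\<bar> \<le> B"
proof -
  obtain B1 where B1: "\<And>k. norm (V k) \<le> B1" using value_bounded by blast
  have dV: "dV k \<le> 2 * B1" for k
    unfolding dV_def using norm_triangle_ineq4[of "V (Suc k)" "V k"] B1[of k] B1[of "Suc k"] by linarith
  \<comment> \<open>\<open>norm_Lambda_Suc\<close> starts at index 1, so the initial multiplier is
    added separately.\<close>
  define B2 where "B2 = norm (\<Lambda> 0) + (\<kappa> * norm c + \<kappa> / \<eta>\<^sub>V * (2 * B1))"
  have B1_nonneg: "0 \<le> B1" using B1[of 0] norm_ge_zero order_trans by blast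
  have B2: "norm (\<Lambda> k) \<le> B2" for k
  proof (cases k)
    case 0
    then show ?thesis using kappa_nonneg parameters B1_nonneg by (simp add: B2_def)
  next
    case (Suc j)
    have "\<kappa> / \<eta>\<^sub>V * dV j \<le> \<kappa> / \<eta>\<^sub>V * (2 * B1)"
      using dV kappa_nonneg parameters by (intro mult_left_mono) auto
    moreover have "norm (\<Lambda> k) \<le> \<kappa> * norm c + \<kappa> / \<eta>\<^sub>V * dV j" unfolding Suc by (rule norm_Lambda_Suc)
    ultimately show ?thesis using norm_ge_zero[of "\<Lambda> 0"] unfolding B2_def by linarith
  qed
  obtain E where E: "\<And>k. e k \<le> E"
    using e_tendsto by (metis Bseq_def abs_le_D1 convergentI convergent_imp_Bseq real_norm_def)
  define Q where "Q = Max (range (\<lambda>(s, a). \<bar>r s a\<bar>))"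
  have Q: "\<bar>r s a\<bar> \<le> Q" for s a unfolding Q_def by (rule Max_ge) auto
  show thesis
  proof (rule that[of "max 1 (max n (max B1 (max B2 (max E Q))))"])
  qed (use B1 B2 E Q in \<open>auto simp: le_max_iff_disj\<close>)
qed

abbreviation "R \<equiv> bellman_res \<gamma> p r"

lemma operator_bounds:
  obtains K where "1 \<le> K" "\<And>k. norm (V k) \<le> K" "\<And>k. norm (\<Lambda> k) \<le> K"
    "\<And>j h. norm (bellman_lin \<gamma> p r (V j) h) \<le> K * norm h"
    "\<And>k j h. norm (bellman_lin \<gamma> (ph k) (rh k) (V j) h) \<le> K * norm h"
    "\<And>k j h. norm (bellman_lin \<gamma> p r (V j) h - bellman_lin \<gamma> (ph k) (rh k) (V j) h) \<le> K * e k * norm h"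
    "\<And>i x. norm (M_pol \<gamma> p (\<pi> i) *v x) \<le> K * norm x"
    "\<And>k i x. norm (Mh k (\<pi> i) *v x) \<le> K * norm x"
    "\<And>k i x. norm (M_pol \<gamma> p (\<pi> i) *v x - Mh k (\<pi> i) *v x) \<le> K * e k * norm x"
    "\<And>i j. norm (R (\<pi> i) (V j)) \<le> K"
    "\<And>k i j. norm (Rh k (\<pi> i) (V j)) \<le> K"
    "\<And>k i j. norm (R (\<pi> i) (V j) - Rh k (\<pi> i) (V j)) \<le> K * e k"
proof -
  obtain B where B: "1 \<le> B" and n: "n \<le> B" and V: "\<And>k. norm (V k) \<le> B"
    and \<Lambda>: "\<And>k. norm (\<Lambda> k) \<le> B" and e: "\<And>k. e k \<le> B" and r: "\<And>s a. \<bar>r s a\<bar> \<le> B"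
    by (rule common_bound) (rule that)
  \<comment> \<open>Linear maps and matrices, and their model errors divided by \<open>e k\<close>,
    are bounded by 3 B^2; a residual adds the value itself, which gives B + 3 B^3 \<le> 4
    B^3.\<close>
  define K where "K = 4 * B ^ 3"
  have pow: "1 \<le> B\<^sup>2" "B \<le> B\<^sup>2" "B\<^sup>2 \<le> B ^ 3"
    using B power_increasing[of 1 2 B] power_increasing[of 2 3 B] one_le_power[of B 2] by auto
  have \<pi>: "norm (\<pi> i) \<le> B" for i using norm_policy_le_n[of i] n by linarith
  have lin: "norm (bellman_lin \<gamma> q g (V j) h) \<le> 3 * B\<^sup>2 * norm h"
    if "stochastic_rows q" "\<And>s a. \<bar>g s a\<bar> \<le> 2 * B" for q :: "'s \<Rightarrow> 'a \<Rightarrow> 's \<Rightarrow> real" and g j h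
  proof -
    have "norm (bellman_lin \<gamma> q g (V j) h) \<le> n * (1 * norm (V j) + 2 * B) * norm h"
      unfolding n_def
      by (rule norm_bellman_lin_le[OF gamma_le]) (use that stochastic_rows_le_1 in auto)
    also have "\<dots> \<le> B * (1 * B + 2 * B) * norm h"
      using n_ge_1 n V[of j] B by (intro mult_right_mono mult_mono add_mono) auto
    finally show ?thesis by (simp add: power2_eq_square algebra_simps)
  qed
  have rh: "\<bar>rh k s a\<bar> \<le> 2 * B" for k s a
    using model_error(2)[of s a k] r[of s a] e[of k] by linarith
  have linp: "norm (bellman_lin \<gamma> p r (V j) h) \<le> 3 * B\<^sup>2 * norm h" for j h
  proof (intro lin stochastic)
    show "\<bar>r s a\<bar> \<le> 2 * B" for s a using r[of s a] B by linarith
  qed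
  have linh: "norm (bellman_lin \<gamma> (ph k) (rh k) (V j) h) \<le> 3 * B\<^sup>2 * norm h" for k j h
    by (intro lin stochastic rh)
  have lind: "norm (bellman_lin \<gamma> p r (V j) h - bellman_lin \<gamma> (ph k) (rh k) (V j) h)
      \<le> 2 * B\<^sup>2 * e k * norm h" for k j h
  proof -
    have "norm (bellman_lin \<gamma> p r (V j) h - bellman_lin \<gamma> (ph k) (rh k) (V j) h)
        \<le> n * (e k * norm (V j) + e k) * norm h"
      unfolding n_def bellman_lin_model_diff
      by (rule norm_bellman_lin_le[OF gamma_le]) (use model_error in auto)
    also have "\<dots> \<le> B * (e k * B + e k * B) * norm h"
      using n_ge_1 n V[of j] B e_nonneg[of k]
      by (intro mult_right_mono mult_mono add_mono mult_left_mono) (auto simp: mult_le_cancel_left1)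
    finally show ?thesis by (simp add: power2_eq_square algebra_simps)
  qed
  have M: "norm (M_pol \<gamma> q (\<pi> i) *v x) \<le> 2 * B\<^sup>2 * norm x" if "stochastic_rows q" for q i x
  proof -
    have "norm (M_pol \<gamma> q (\<pi> i) *v x) \<le> norm x + n * (1 * norm x + 0) * norm (\<pi> i)"
      unfolding M_pol_mult_eq n_def
      by (intro order_trans[OF norm_triangle_ineq] add_left_mono norm_bellman_lin_le[OF gamma_le])
        (use that stochastic_rows_le_1 in auto)
    also have "\<dots> \<le> norm x + B * (1 * norm x + 0) * B"
      using n_ge_1 n \<pi>[of i] B by (intro add_left_mono mult_mono) auto
    also have "\<dots> = (1 + B\<^sup>2) * norm x" by (simp add: power2_eq_square algebra_simps)
    also have "\<dots> \<le> (2 * B\<^sup>2) * norm x" using pow by (intro mult_right_mono) auto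
    finally show ?thesis .
  qed
  have Md: "norm (M_pol \<gamma> p (\<pi> i) *v x - Mh k (\<pi> i) *v x) \<le> B\<^sup>2 * e k * norm x" for i x k
  proof -
    have "norm (M_pol \<gamma> p (\<pi> i) *v x - Mh k (\<pi> i) *v x) \<le> n * n * e k * norm x"
      using Mh_diff_le[OF policy_in norm_policy_le_n, of k i x]
      by (simp add: matrix_vector_mult_diff_rdistrib norm_minus_commute)
    also have "\<dots> \<le> B * B * e k * norm x"
      using n n_ge_1 B e_nonneg[of k] by (intro mult_right_mono mult_mono) auto
    finally show ?thesis by (simp add: power2_eq_square)
  qed
  have res: "norm (V j + y) \<le> K" if "norm y \<le> 3 * B\<^sup>2 * norm (\<pi> i)" for i j y
  proof -
    have "norm y \<le> 3 * B\<^sup>2 * B" by (rule order_trans[OF that]) (intro mult_left_mono \<pi>, simp)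
    then show ?thesis using norm_triangle_ineq[of "V j" y] V[of j] pow
      by (simp add: K_def power3_eq_cube power2_eq_square)
  qed
  have resd: "norm (R (\<pi> i) (V j) - Rh k (\<pi> i) (V j)) \<le> K * e k" for i j k
  proof -
    have "norm (R (\<pi> i) (V j) - Rh k (\<pi> i) (V j)) \<le> 2 * B\<^sup>2 * e k * B"
      unfolding bellman_res_eq add_diff_cancel_left
      by (rule order_trans[OF lind]) (intro mult_left_mono \<pi>, simp add: e_nonneg)
    also have "\<dots> \<le> K * e k" using B e_nonneg[of k]
      by (simp add: K_def power3_eq_cube power2_eq_square)
    finally show ?thesis .
  qed
  have up: "x \<le> K * y" if "x \<le> c * y" "c \<le> 4 * B\<^sup>2" "0 \<le> y" for x y c
    using that pow mult_right_mono[of c K y] by (simp add: K_def)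
  have upe: "x \<le> K * e k * y" if "x \<le> c * e k * y" "c \<le> 4 * B\<^sup>2" "0 \<le> y" for x y c k
    using that pow mult_right_mono[of c K "e k * y"] e_nonneg[of k] by (simp add: K_def mult.assoc)
  have le: "x \<le> K" if "x \<le> B" for x using that pow B by (simp add: K_def)
  have resp: "norm (R (\<pi> i) (V j)) \<le> K" for i j
    unfolding bellman_res_eq by (rule res[OF linp])
  have resh: "norm (Rh k (\<pi> i) (V j)) \<le> K" for i j k
    unfolding bellman_res_eq by (rule res[OF linh])
  show thesis
    by (rule that[of K])
      (rule le[OF B] le[OF V] le[OF \<Lambda>] resp resh resd up[OF linp] up[OF linh]
        upe[OF lind] up[OF M] upe[OF Md] stochastic | simp; fail)+
qed

text \<open>The Lyapunov function uses the true model, so that the model error enters only multiplied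
  by increments of the iterates.\<close>

definition "F k = f k + c \<bullet> V k + \<Lambda> k \<bullet> R (\<pi> k) (V k) + \<beta> / 2 * (norm (R (\<pi> k) (V k)))\<^sup>2"

section \<open>Descent of the Lyapunov function and summability of the increments\<close>

lemma Rh_Suc: "Rh k (\<pi> (Suc k)) (V (Suc k)) = (1 / \<beta>) *\<^sub>R (\<Lambda> (Suc k) - \<Lambda> k)"
  using parameters unfolding multiplier_step by simp

text \<open>The policy and value steps decrease the Lagrangian of batch \<open>k\<close>;
  \<open>quadratic_increment_error\<close> carries each decrease over to the true model, since one
  argument stays fixed in each step.\<close>

lemma perturbed_descent:
  "\<exists>C\<ge>0. \<forall>k. F (Suc k) + 1 / (2 * \<eta>\<^sub>\<pi>) * (d\<pi> k)\<^sup>2 + 1 / \<eta>\<^sub>V * (dV k)\<^sup>2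
    \<le> F k + (d\<Lambda> k)\<^sup>2 / \<beta> + C * e k * d\<pi> k + C * e k * dV k + C * e k * d\<Lambda> k"
proof -
  obtain K where K: "1 \<le> K" "\<And>k. norm (\<Lambda> k) \<le> K"
    "\<And>j h. norm (bellman_lin \<gamma> p r (V j) h) \<le> K * norm h"
    "\<And>k j h. norm (bellman_lin \<gamma> (ph k) (rh k) (V j) h) \<le> K * norm h"
    "\<And>k j h. norm (bellman_lin \<gamma> p r (V j) h - bellman_lin \<gamma> (ph k) (rh k) (V j) h) \<le> K * e k * norm h"
    "\<And>i x. norm (M_pol \<gamma> p (\<pi> i) *v x) \<le> K * norm x"
    "\<And>k i x. norm (Mh k (\<pi> i) *v x) \<le> K * norm x"
    "\<And>k i x. norm (M_pol \<gamma> p (\<pi> i) *v x - Mh k (\<pi> i) *v x) \<le> K * e k * norm x"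
    "\<And>i j. norm (R (\<pi> i) (V j)) \<le> K"
    "\<And>k i j. norm (Rh k (\<pi> i) (V j)) \<le> K"
    "\<And>k i j. norm (R (\<pi> i) (V j) - Rh k (\<pi> i) (V j)) \<le> K * e k"
    by (rule operator_bounds) (rule that)
  define C where "C = (1 + 2 * \<beta>) * K\<^sup>2"
  have KC: "K \<le> C" 
  proof -
    have "1 * K \<le> (1 + 2 * \<beta>) * K\<^sup>2"
      using K(1) parameters by (intro mult_mono) (auto simp: power2_eq_square)
    then show ?thesis by (simp add: C_def)
  qed
  have C: "0 \<le> C" using K(1) KC by linarith
  have diff4: "(x' - y') - (x - y) = (x' - x) - (y' - y)" for x x' y y' :: "real^'s" by simp
  have "F (Suc k) + 1 / (2 * \<eta>\<^sub>\<pi>) * (d\<pi> k)\<^sup>2 + 1 / \<eta>\<^sub>V * (dV k)\<^sup>2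
    \<le> F k + (d\<Lambda> k)\<^sup>2 / \<beta> + C * e k * d\<pi> k + C * e k * dV k + C * e k * d\<Lambda> k" for k
  proof -
    let ?a = "\<pi> k" and ?b = "\<pi> (Suc k)" and ?v = "V k" and ?w = "V (Suc k)" and ?l = "\<Lambda> k"
    have "f (Suc k) + smooth k ?b \<le> f k + smooth k ?a"
      using policy_min[OF policy_in[of k], of k] by (simp add: phi_eq)
    then have pol: "f (Suc k) + (?l \<bullet> Rh k ?b ?v + \<beta> / 2 * (norm (Rh k ?b ?v))\<^sup>2)
        + 1 / (2 * \<eta>\<^sub>\<pi>) * (d\<pi> k)\<^sup>2 \<le> f k + (?l \<bullet> Rh k ?a ?v + \<beta> / 2 * (norm (Rh k ?a ?v))\<^sup>2)"
      by (simp add: smooth_def d\<pi>_def)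
    have err1: "(?l \<bullet> R ?b ?v + \<beta> / 2 * (norm (R ?b ?v))\<^sup>2) - (?l \<bullet> R ?a ?v + \<beta> / 2 * (norm (R ?a ?v))\<^sup>2)
      \<le> (?l \<bullet> Rh k ?b ?v + \<beta> / 2 * (norm (Rh k ?b ?v))\<^sup>2) - (?l \<bullet> Rh k ?a ?v + \<beta> / 2 * (norm (Rh k ?a ?v))\<^sup>2)
        + (1 + 2 * \<beta>) * K\<^sup>2 * (e k * d\<pi> k)"
    proof (rule quadratic_increment_error)
      show "norm (R ?b ?v - Rh k ?b ?v - (R ?a ?v - Rh k ?a ?v)) \<le> K * e k * d\<pi> k"
        unfolding diff4 bellman_res_policy_diff d\<pi>_def by (rule K)
    qed (use K parameters e_nonneg in \<open>auto simp: d\<pi>_def bellman_res_policy_diff\<close>)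
    have err2: "(?l \<bullet> R ?b ?w + \<beta> / 2 * (norm (R ?b ?w))\<^sup>2) - (?l \<bullet> R ?b ?v + \<beta> / 2 * (norm (R ?b ?v))\<^sup>2)
      \<le> (?l \<bullet> Rh k ?b ?w + \<beta> / 2 * (norm (Rh k ?b ?w))\<^sup>2) - (?l \<bullet> Rh k ?b ?v + \<beta> / 2 * (norm (Rh k ?b ?v))\<^sup>2)
        + (1 + 2 * \<beta>) * K\<^sup>2 * (e k * dV k)"
    proof (rule quadratic_increment_error)
      show "norm (R ?b ?w - Rh k ?b ?w - (R ?b ?v - Rh k ?b ?v)) \<le> K * e k * dV k"
        unfolding diff4 bellman_res_value_diff dV_def by (rule K)
    qed (use K parameters e_nonneg in \<open>auto simp: dV_def bellman_res_value_diff\<close>)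
    \<comment> \<open>The multiplier step is the ascent of the method. The true residual is split
      into the empirical one, which is the multiplier increment divided by \<beta> and produces a
      square, and the model error.\<close>
    have "\<Lambda> (Suc k) \<bullet> R ?b ?w - ?l \<bullet> R ?b ?w
        = (\<Lambda> (Suc k) - ?l) \<bullet> Rh k ?b ?w + (\<Lambda> (Suc k) - ?l) \<bullet> (R ?b ?w - Rh k ?b ?w)"
      by (simp add: inner_diff_left inner_diff_right)
    also have "(\<Lambda> (Suc k) - ?l) \<bullet> Rh k ?b ?w = (d\<Lambda> k)\<^sup>2 / \<beta>"
      unfolding Rh_Suc d\<Lambda>_def by (simp add: power2_norm_eq_inner)
    also have "(\<Lambda> (Suc k) - ?l) \<bullet> (R ?b ?w - Rh k ?b ?w) \<le> d\<Lambda> k * (K * e k)"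
      unfolding d\<Lambda>_def by (rule order_trans[OF norm_cauchy_schwarz]) (intro mult_left_mono K norm_ge_zero)
    also have "\<dots> \<le> C * e k * d\<Lambda> k"
      using KC e_nonneg[of k] mult_right_mono[of K C "e k * d\<Lambda> k"] by (simp add: d\<Lambda>_def mult_ac)
    finally have lam: "\<Lambda> (Suc k) \<bullet> R ?b ?w \<le> ?l \<bullet> R ?b ?w + (d\<Lambda> k)\<^sup>2 / \<beta> + C * e k * d\<Lambda> k" by simp
    show ?thesis
      using pol err1 err2 lam value_decrease[of k] by (simp add: F_def C_def mult.assoc)
  qed
  then show ?thesis using C by blast
qed

text \<open>The accounting behind the constants 60 and 30. The squared multiplier increment, split
  into four squares, enters with weight 3/2: 1 from the descent and 1/2 from its own Young term. In
  units of the squared policy increment over \<eta>_\<pi>, the gain 1/2 loses 1/10 to Young and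
  (3/2)(2/15) = 1/5 to the multiplier, leaving 1/5. In units of the squared value increment over
  \<eta>_V, the gain 1 loses 1/10 to Young, (3/2)(1/15) = 1/10 to the multiplier and 1/10 to the
  storage term of \<open>W\<close>, leaving 7/10.\<close>

lemma increments_summable: "summable (\<lambda>k. (d\<pi> k)\<^sup>2)" "summable (\<lambda>k. (dV k)\<^sup>2)"
proof -
  obtain C where C: "0 \<le> C" and step: "\<And>k. F (Suc k) + 1 / (2 * \<eta>\<^sub>\<pi>) * (d\<pi> k)\<^sup>2 + 1 / \<eta>\<^sub>V * (dV k)\<^sup>2
    \<le> F k + (d\<Lambda> k)\<^sup>2 / \<beta> + C * e k * d\<pi> k + C * e k * dV k + C * e k * d\<Lambda> k"
    using perturbed_descent by blast
  define c1 where "c1 = \<kappa>\<^sup>2 * norm c * n * n"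
  \<comment> \<open>The last coefficient is 12 = (3/2) * 8, where 8 = 4 * 2 comes from the four
    squares and from the square of the sum of two consecutive errors.\<close>
  define D where "D = 10 * \<eta>\<^sub>\<pi> * C\<^sup>2 + 10 * \<eta>\<^sub>V * C\<^sup>2 + 2 * \<beta> * C\<^sup>2 + 12 * c1\<^sup>2 / \<beta>"
  have D: "0 \<le> D" using parameters by (simp add: D_def)
  \<comment> \<open>Shifted by one because \<open>multiplier_increment\<close> bounds
    \<open>d\<Lambda> (Suc k)\<close>. The extra term stores exactly the share of
    \<open>(dV k)\<^sup>2\<close> that this bound consumes one step later.\<close>
  define W where "W k = F (Suc k) + (dV k)\<^sup>2 / (10 * \<eta>\<^sub>V)" for k
  define \<delta> where "\<delta> k = (d\<pi> (Suc k))\<^sup>2 / (5 * \<eta>\<^sub>\<pi>) + (7 / 10) * ((dV (Suc k))\<^sup>2 / \<eta>\<^sub>V)" for k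
  define \<epsilon> where "\<epsilon> k = D * ((e (Suc k))\<^sup>2 + (e k)\<^sup>2)" for k
  have "W (Suc k) + \<delta> k \<le> W k + \<epsilon> k" for k
  proof -
    let ?a = "d\<pi> (Suc k)" and ?v = "dV (Suc k)" and ?u = "dV k" and ?l = "d\<Lambda> (Suc k)" and ?e = "e (Suc k)"
    let ?X = "\<kappa>\<^sup>2 * norm c * L\<^sub>M * ?a" and ?Z = "c1 * (?e + e k)"
    have l2: "?l\<^sup>2 \<le> 4 * (?X\<^sup>2 + (\<kappa> / \<eta>\<^sub>V * ?v)\<^sup>2 + (\<kappa> / \<eta>\<^sub>V * ?u)\<^sup>2 + ?Z\<^sup>2)"
      using multiplier_increment[of k] by (intro four_squares_le) (auto simp: d\<Lambda>_def c1_def)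
    have "30 * \<eta>\<^sub>\<pi> * ?X\<^sup>2 = (30 * \<eta>\<^sub>\<pi> * \<kappa>^4 * L\<^sub>M\<^sup>2 * (norm c)\<^sup>2) * ?a\<^sup>2"
      by (simp add: power_mult_distrib)
    also have "\<dots> \<le> \<beta> * ?a\<^sup>2" using margin(2) by (intro mult_right_mono) auto
    finally have X: "4 * ?X\<^sup>2 / \<beta> \<le> (2 / 15) * (?a\<^sup>2 / \<eta>\<^sub>\<pi>)"
      using parameters by (simp add: field_simps)
    have Y: "4 * (\<kappa> / \<eta>\<^sub>V * x)\<^sup>2 / \<beta> \<le> (1 / 15) * (x\<^sup>2 / \<eta>\<^sub>V)" for x
    proof -
      have "(60 * \<kappa>\<^sup>2 / \<eta>\<^sub>V) * x\<^sup>2 \<le> \<beta> * x\<^sup>2" using margin(1) by (intro mult_right_mono) auto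
      then show ?thesis using parameters by (simp add: field_simps power2_eq_square)
    qed
    have Z: "4 * ?Z\<^sup>2 / \<beta> \<le> 8 * c1\<^sup>2 / \<beta> * (?e\<^sup>2 + (e k)\<^sup>2)"
    proof -
      have "(?e + e k)\<^sup>2 \<le> 2 * (?e\<^sup>2 + (e k)\<^sup>2)"
        using zero_le_power2[of "?e - e k"] by (simp add: power2_eq_square algebra_simps)
      then have "4 * ?Z\<^sup>2 / \<beta> \<le> 4 * (c1\<^sup>2 * (2 * (?e\<^sup>2 + (e k)\<^sup>2))) / \<beta>"
        unfolding power_mult_distrib using parameters by (intro divide_right_mono mult_left_mono) auto
      then show ?thesis by (simp add: distrib_left add_divide_distrib)
    qed
    have L: "?l\<^sup>2 / \<beta> \<le> (2 / 15) * (?a\<^sup>2 / \<eta>\<^sub>\<pi>) + (1 / 15) * (?v\<^sup>2 / \<eta>\<^sub>V) + (1 / 15) * (?u\<^sup>2 / \<eta>\<^sub>V)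
        + 8 * c1\<^sup>2 / \<beta> * (?e\<^sup>2 + (e k)\<^sup>2)"
    proof -
      have "?l\<^sup>2 / \<beta> \<le> 4 * (?X\<^sup>2 + (\<kappa> / \<eta>\<^sub>V * ?v)\<^sup>2 + (\<kappa> / \<eta>\<^sub>V * ?u)\<^sup>2 + ?Z\<^sup>2) / \<beta>"
        using l2 parameters by (intro divide_right_mono) auto
      also have "\<dots> = 4 * ?X\<^sup>2 / \<beta> + 4 * (\<kappa> / \<eta>\<^sub>V * ?v)\<^sup>2 / \<beta> + 4 * (\<kappa> / \<eta>\<^sub>V * ?u)\<^sup>2 / \<beta> + 4 * ?Z\<^sup>2 / \<beta>"
        by (simp add: add_divide_distrib distrib_left)
      finally show ?thesis using X Y[of ?v] Y[of ?u] Z by linarith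
    qed
    have y1: "C * ?e * ?a \<le> ?a\<^sup>2 / (10 * \<eta>\<^sub>\<pi>) + 10 * \<eta>\<^sub>\<pi> * C\<^sup>2 * ?e\<^sup>2"
      using parameters by (intro young_ineq) auto
    have y2: "C * ?e * ?v \<le> ?v\<^sup>2 / (10 * \<eta>\<^sub>V) + 10 * \<eta>\<^sub>V * C\<^sup>2 * ?e\<^sup>2"
      using parameters by (intro young_ineq) auto
    have y3: "C * ?e * ?l \<le> ?l\<^sup>2 / (2 * \<beta>) + 2 * \<beta> * C\<^sup>2 * ?e\<^sup>2"
      using parameters by (intro young_ineq) auto
    have "(D - 12 * c1\<^sup>2 / \<beta>) * (e k)\<^sup>2 \<ge> 0" using parameters by (simp add: D_def)
    then have "10 * \<eta>\<^sub>\<pi> * C\<^sup>2 * ?e\<^sup>2 + 10 * \<eta>\<^sub>V * C\<^sup>2 * ?e\<^sup>2 + 2 * \<beta> * C\<^sup>2 * ?e\<^sup>2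
        + (3 / 2) * (8 * c1\<^sup>2 / \<beta> * (?e\<^sup>2 + (e k)\<^sup>2)) \<le> \<epsilon> k"
      by (simp add: \<epsilon>_def D_def algebra_simps)
    then show ?thesis
      using step[of "Suc k"] L y1 y2 y3 by (simp add: W_def \<delta>_def)
  qed
  moreover have "0 \<le> \<delta> k" "0 \<le> \<epsilon> k" for k using parameters D by (auto simp: \<delta>_def \<epsilon>_def)
  moreover have "summable \<epsilon>" unfolding \<epsilon>_def
    by (intro summable_mult summable_add error_summable) (subst summable_Suc_iff[of "\<lambda>k. (e k)\<^sup>2"], rule error_summable)
  moreover obtain B where "\<And>k. B \<le> W k"
  proof -
    obtain b where b: "\<And>q. q \<in> policies \<Longrightarrow> ereal b \<le> \<phi> q"
      using phi_bdd unfolding bounded_below_on_def by blast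
    obtain K where K: "1 \<le> K" "\<And>k. norm (V k) \<le> K" "\<And>k. norm (\<Lambda> k) \<le> K" "\<And>i j. norm (R (\<pi> i) (V j)) \<le> K"
      by (rule operator_bounds) (rule that)
    have "b - norm c * K - K * K \<le> W k" for k
    proof -
      have "b \<le> f (Suc k)" using b[OF policy_in[of "Suc k"]] by (simp add: phi_eq)
      moreover have "\<bar>c \<bullet> V (Suc k)\<bar> \<le> norm c * K"
        by (rule order_trans[OF Cauchy_Schwarz_ineq2]) (intro mult_left_mono K norm_ge_zero)
      moreover have "\<bar>\<Lambda> (Suc k) \<bullet> R (\<pi> (Suc k)) (V (Suc k))\<bar> \<le> K * K"
        by (rule order_trans[OF Cauchy_Schwarz_ineq2]) (use K in \<open>auto intro!: mult_mono order_trans[OF norm_ge_zero]\<close>)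
      moreover have "0 \<le> \<beta> / 2 * (norm (R (\<pi> (Suc k)) (V (Suc k))))\<^sup>2 + (dV k)\<^sup>2 / (10 * \<eta>\<^sub>V)"
        using parameters by simp
      ultimately show ?thesis unfolding W_def F_def by linarith
    qed
    then show thesis by (rule that)
  qed
  ultimately have \<delta>: "summable \<delta>" by (rule descent_summable)
  have "summable (\<lambda>k. (d\<pi> (Suc k))\<^sup>2)"
  proof (rule summable_comparison_test'[OF summable_mult[OF \<delta>, of "5 * \<eta>\<^sub>\<pi>"]])
    show "norm ((d\<pi> (Suc k))\<^sup>2) \<le> 5 * \<eta>\<^sub>\<pi> * \<delta> k" for k
      using parameters by (simp add: \<delta>_def field_simps)
  qed
  then show "summable (\<lambda>k. (d\<pi> k)\<^sup>2)" by (simp add: summable_Suc_iff[of "\<lambda>k. (d\<pi> k)\<^sup>2"])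
  have "summable (\<lambda>k. (dV (Suc k))\<^sup>2)"
  proof (rule summable_comparison_test'[OF summable_mult[OF \<delta>, of "10 * \<eta>\<^sub>V / 7"]])
    show "norm ((dV (Suc k))\<^sup>2) \<le> 10 * \<eta>\<^sub>V / 7 * \<delta> k" for k
      using parameters by (simp add: \<delta>_def field_simps)
  qed
  then show "summable (\<lambda>k. (dV k)\<^sup>2)" by (simp add: summable_Suc_iff[of "\<lambda>k. (dV k)\<^sup>2"])
qed

text \<open>The descent controls only the policy and value increments; the multiplier increments
  follow them through \<open>multiplier_increment\<close>, from index 1 on.\<close>

lemma d_tendsto: "d\<pi> \<longlonglongrightarrow> 0" "dV \<longlonglongrightarrow> 0" "d\<Lambda> \<longlonglongrightarrow> 0"
proof -
  show \<pi>: "d\<pi> \<longlonglongrightarrow> 0" and V: "dV \<longlonglongrightarrow> 0"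
    by (rule LIMSEQ_zero_if_summable_square[OF increments_summable(1)],
        rule LIMSEQ_zero_if_summable_square[OF increments_summable(2)])
  have "(\<lambda>k. \<kappa>\<^sup>2 * norm c * L\<^sub>M * d\<pi> (Suc k) + \<kappa> / \<eta>\<^sub>V * dV (Suc k) + \<kappa> / \<eta>\<^sub>V * dV k
      + \<kappa>\<^sup>2 * norm c * n * n * (e (Suc k) + e k))
    \<longlonglongrightarrow> \<kappa>\<^sup>2 * norm c * L\<^sub>M * 0 + \<kappa> / \<eta>\<^sub>V * 0 + \<kappa> / \<eta>\<^sub>V * 0 + \<kappa>\<^sup>2 * norm c * n * n * (0 + 0)"
    by (intro tendsto_intros LIMSEQ_Suc \<pi> V e_tendsto)
  then have "(\<lambda>k. \<kappa>\<^sup>2 * norm c * L\<^sub>M * d\<pi> (Suc k) + \<kappa> / \<eta>\<^sub>V * dV (Suc k) + \<kappa> / \<eta>\<^sub>V * dV k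
      + \<kappa>\<^sup>2 * norm c * n * n * (e (Suc k) + e k)) \<longlonglongrightarrow> 0" by simp
  from tendsto_sandwich[OF _ _ tendsto_const this] have "(\<lambda>k. d\<Lambda> (Suc k)) \<longlonglongrightarrow> 0"
    using multiplier_increment by (auto simp: d\<Lambda>_def)
  then show "d\<Lambda> \<longlonglongrightarrow> 0" by (rule LIMSEQ_imp_Suc)
qed

section \<open>Approximate stationarity in the policy\<close>

definition "subgrad k = - (adjoint (bellman_lin \<gamma> (ph k) (rh k) (V k))
    (\<Lambda> k + \<beta> *\<^sub>R Rh k (\<pi> (Suc k)) (V k)) + (1 / \<eta>\<^sub>\<pi>) *\<^sub>R (\<pi> (Suc k) - \<pi> k))"

text \<open>The residual is affine in the policy, so the expansion is exact, and
  \<open>subgrad k\<close> is the negative gradient of \<open>smooth k\<close> at the new policy.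
  Its residual is taken at the old value \<open>V k\<close>, because the policy step precedes the
  value step.\<close>

lemma smooth_expand:
  "smooth k q = smooth k (\<pi> (Suc k)) - subgrad k \<bullet> (q - \<pi> (Suc k))
    + \<beta> / 2 * (norm (bellman_lin \<gamma> (ph k) (rh k) (V k) (q - \<pi> (Suc k))))\<^sup>2
    + 1 / (2 * \<eta>\<^sub>\<pi>) * (norm (q - \<pi> (Suc k)))\<^sup>2"
proof -
  let ?J = "bellman_lin \<gamma> (ph k) (rh k) (V k)" and ?h = "q - \<pi> (Suc k)" and ?R = "Rh k (\<pi> (Suc k)) (V k)"
  have R: "Rh k q (V k) = ?R + ?J ?h"
    using bellman_res_policy_diff[of \<gamma> "ph k" "rh k" q "V k" "\<pi> (Suc k)"]
    by (simp add: diff_eq_eq add.commute)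
  have q: "q - \<pi> k = (\<pi> (Suc k) - \<pi> k) + ?h" by simp
  have w: "subgrad k \<bullet> ?h = - ((\<Lambda> k + \<beta> *\<^sub>R ?R) \<bullet> ?J ?h) - 1 / \<eta>\<^sub>\<pi> * ((\<pi> (Suc k) - \<pi> k) \<bullet> ?h)"
  proof -
    have "adjoint ?J x \<bullet> ?h = x \<bullet> ?J ?h" for x
      using adjoint_works[OF linear_bellman_lin, of ?h \<gamma> "ph k" "rh k" "V k" x] by (simp only: inner_commute)
    then show ?thesis by (simp add: subgrad_def inner_diff_left inner_add_left)
  qed
  show ?thesis unfolding smooth_def R q norm_add_sq w inner_add_left inner_add_right distrib_left inner_scaleR_left
    by simp
qed

text \<open>The policy step in the form of a proximal subgradient inequality. That \<open>K\<close>
  does not depend on \<open>k\<close> is what allows the passage to the limit at an accumulation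
  point.\<close>

lemma policy_variational:
  obtains K where "0 \<le> K" "\<And>k q. q \<in> policies \<Longrightarrow>
    \<phi> (\<pi> (Suc k)) + ereal (subgrad k \<bullet> (q - \<pi> (Suc k)))
      \<le> \<phi> q + ereal (K * (norm (q - \<pi> (Suc k)))\<^sup>2)"
proof -
  obtain B where B: "1 \<le> B" "\<And>k j h. norm (bellman_lin \<gamma> (ph k) (rh k) (V j) h) \<le> B * norm h"
    by (rule operator_bounds) (rule that)
  define K where "K = \<beta> / 2 * B\<^sup>2 + 1 / (2 * \<eta>\<^sub>\<pi>)"
  show thesis
  proof (rule that[of K])
    show "0 \<le> K" using parameters by (simp add: K_def)
  next
    fix k q assume q: "(q::real^'a^'s) \<in> policies"
    let ?h = "q - \<pi> (Suc k)"
    have "\<beta> / 2 * (norm (bellman_lin \<gamma> (ph k) (rh k) (V k) ?h))\<^sup>2 \<le> \<beta> / 2 * (B * norm ?h)\<^sup>2"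
      using parameters by (intro mult_left_mono power_mono B) auto
    then have "smooth k q \<le> smooth k (\<pi> (Suc k)) - subgrad k \<bullet> ?h + K * (norm ?h)\<^sup>2"
      unfolding smooth_expand[of k q] K_def by (simp add: power_mult_distrib algebra_simps)
    then show "\<phi> (\<pi> (Suc k)) + ereal (subgrad k \<bullet> ?h) \<le> \<phi> q + ereal (K * (norm ?h)\<^sup>2)"
      using policy_min[OF q, of k] phi_not_MInf[of q] unfolding phi_eq by (cases "\<phi> q") auto
  qed
qed

lemma psi_eq: "q \<in> policies \<Longrightarrow> \<psi> q = \<phi> q"
  by (simp add: indicator_fun_def)

lemma psi_iterate: "\<psi> (\<pi> k) = \<phi> (\<pi> k)"
  by (rule psi_eq[OF policy_in])

lemma subgrad_regular: "subgrad k \<in> regular_subdifferential \<psi> (\<pi> (Suc k))"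
proof -
  obtain K where K: "0 \<le> K" "\<And>k q. q \<in> policies \<Longrightarrow>
    \<phi> (\<pi> (Suc k)) + ereal (subgrad k \<bullet> (q - \<pi> (Suc k)))
      \<le> \<phi> q + ereal (K * (norm (q - \<pi> (Suc k)))\<^sup>2)"
    by (rule policy_variational) (rule that)
  show ?thesis
  proof (rule regular_subgradient_at_minimizer[OF _ K(1)])
    show "\<bar>\<psi> (\<pi> (Suc k))\<bar> \<noteq> \<infinity>" unfolding psi_iterate by (rule phi_finite)
    show "\<psi> (\<pi> (Suc k)) + ereal (subgrad k \<bullet> (q - \<pi> (Suc k)))
        \<le> \<psi> q + ereal (K * (norm (q - \<pi> (Suc k)))\<^sup>2)" for q
    proof (cases "q \<in> policies")
      case True
      then show ?thesis unfolding psi_iterate psi_eq[OF True] by (rule K)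
    next
      case False
      then show ?thesis by (simp add: indicator_fun_def phi_not_MInf)
    qed
  qed
qed

text \<open>What separates \<open>subgrad k\<close> from the true Jacobian term at the new iterates:
  the empirical model (error \<open>e k\<close>), the Jacobian at the old value
  (\<open>dV k\<close>), the old multiplier plus \<beta> times the residual at the old value in
  place of the new multiplier (again \<open>dV k\<close>), and the proximal term
  (\<open>d\<pi> k\<close>). All of these vanish.\<close>

lemma stationarity_gap:
  "(\<lambda>k. subgrad k + adjoint (bellman_lin \<gamma> p r (V (Suc k))) (\<Lambda> (Suc k))) \<longlonglongrightarrow> 0"
proof -
  obtain K where K: "1 \<le> K" "\<And>k. norm (\<Lambda> k) \<le> K"
    "\<And>k j h. norm (bellman_lin \<gamma> (ph k) (rh k) (V j) h) \<le> K * norm h"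
    "\<And>k j h. norm (bellman_lin \<gamma> p r (V j) h - bellman_lin \<gamma> (ph k) (rh k) (V j) h) \<le> K * e k * norm h"
    "\<And>k i x. norm (Mh k (\<pi> i) *v x) \<le> K * norm x"
    by (rule operator_bounds) (rule that)
  have bound: "norm (subgrad k + adjoint (bellman_lin \<gamma> p r (V (Suc k))) (\<Lambda> (Suc k)))
      \<le> K * (\<beta> * (K * dV k)) + (K * e k + n * dV k) * K + 1 / \<eta>\<^sub>\<pi> * d\<pi> k" for k
  proof -
    let ?f = "bellman_lin \<gamma> (ph k) (rh k) (V k)" and ?g = "bellman_lin \<gamma> p r (V (Suc k))"
    let ?x = "\<Lambda> k + \<beta> *\<^sub>R Rh k (\<pi> (Suc k)) (V k)" and ?y = "\<Lambda> (Suc k)"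
    have "?x - ?y = \<beta> *\<^sub>R (Rh k (\<pi> (Suc k)) (V k) - Rh k (\<pi> (Suc k)) (V (Suc k)))"
      unfolding multiplier_step by (simp add: algebra_simps)
    also have "norm \<dots> \<le> \<beta> * (K * dV k)"
      unfolding bellman_res_value_diff using parameters K(5)[of k "Suc k" "V k - V (Suc k)"]
      by (simp add: dV_def norm_minus_commute)
    finally have xy: "norm (?x - ?y) \<le> \<beta> * (K * dV k)" .
    have fg: "norm (?f h - ?g h) \<le> (K * e k + n * dV k) * norm h" for h
    proof -
      have "norm (bellman_lin \<gamma> p r (V k) h - ?g h) \<le> n * (1 * dV k + 0) * norm h"
        unfolding bellman_lin_value_diff dV_def n_def norm_minus_commute[of "V (Suc k)"]
        by (rule norm_bellman_lin_le[OF gamma_le]) (use stochastic_rows_le_1[OF stochastic(1)] in auto)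
      moreover have "?f h - ?g h = (bellman_lin \<gamma> p r (V k) h - ?g h) - (bellman_lin \<gamma> p r (V k) h - ?f h)"
        by simp
      ultimately show ?thesis
        using norm_triangle_ineq4[of "bellman_lin \<gamma> p r (V k) h - ?g h" "bellman_lin \<gamma> p r (V k) h - ?f h"]
          K(4)[where k = k and j = k and h = h] by (simp add: algebra_simps)
    qed
    have "norm (adjoint ?f ?x - adjoint ?g ?y) \<le> K * norm (?x - ?y) + (K * e k + n * dV k) * norm ?y"
      using K(1) e_nonneg[of k] n_ge_1
      by (intro norm_adjoint_diff_le linear_bellman_lin K fg) (auto simp: dV_def)
    also have "\<dots> \<le> K * (\<beta> * (K * dV k)) + (K * e k + n * dV k) * K"
      using K(1) K(2)[of "Suc k"] e_nonneg[of k] n_ge_1 xy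
      by (intro add_mono mult_left_mono) (auto simp: dV_def)
    finally have *: "norm (adjoint ?f ?x - adjoint ?g ?y) \<le> K * (\<beta> * (K * dV k)) + (K * e k + n * dV k) * K" .
    have "subgrad k + adjoint ?g ?y = - ((adjoint ?f ?x - adjoint ?g ?y) + (1 / \<eta>\<^sub>\<pi>) *\<^sub>R (\<pi> (Suc k) - \<pi> k))"
      by (simp add: subgrad_def)
    then have "norm (subgrad k + adjoint ?g ?y)
        \<le> norm (adjoint ?f ?x - adjoint ?g ?y) + norm ((1 / \<eta>\<^sub>\<pi>) *\<^sub>R (\<pi> (Suc k) - \<pi> k))"
      by (simp only: norm_minus_cancel norm_triangle_ineq)
    moreover have "norm ((1 / \<eta>\<^sub>\<pi>) *\<^sub>R (\<pi> (Suc k) - \<pi> k)) = 1 / \<eta>\<^sub>\<pi> * d\<pi> k"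
      using parameters by (simp add: d\<pi>_def)
    ultimately show ?thesis using * by linarith
  qed
  have "(\<lambda>k. K * (\<beta> * (K * dV k)) + (K * e k + n * dV k) * K + 1 / \<eta>\<^sub>\<pi> * d\<pi> k)
      \<longlonglongrightarrow> K * (\<beta> * (K * 0)) + (K * 0 + n * 0) * K + 1 / \<eta>\<^sub>\<pi> * 0"
    by (intro tendsto_intros d_tendsto e_tendsto)
  then show ?thesis
    by (rule LIMSEQ_zero_if_norm_le[OF bound]) simp
qed

section \<open>Limits of the residuals and accumulation points\<close>

lemma primal_feasibility: "(\<lambda>k. R (\<pi> k) (V k)) \<longlonglongrightarrow> 0"
proof (rule LIMSEQ_imp_Suc)
  obtain K where K: "1 \<le> K" "\<And>k i j. norm (R (\<pi> i) (V j) - Rh k (\<pi> i) (V j)) \<le> K * e k"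
    by (rule operator_bounds) (rule that)
  have "norm (R (\<pi> (Suc k)) (V (Suc k))) \<le> 1 / \<beta> * d\<Lambda> k + K * e k" for k
  proof -
    have "norm (Rh k (\<pi> (Suc k)) (V (Suc k))) = 1 / \<beta> * d\<Lambda> k"
      using parameters unfolding Rh_Suc by (simp add: d\<Lambda>_def)
    then show ?thesis
      using norm_triangle_sub[of "R (\<pi> (Suc k)) (V (Suc k))" "Rh k (\<pi> (Suc k)) (V (Suc k))"]
        K(2)[of "Suc k" "Suc k" k] by linarith
  qed
  moreover have "(\<lambda>k. 1 / \<beta> * d\<Lambda> k + K * e k) \<longlonglongrightarrow> 1 / \<beta> * 0 + K * 0"
    by (intro tendsto_intros d_tendsto e_tendsto)
  ultimately show "(\<lambda>k. R (\<pi> (Suc k)) (V (Suc k))) \<longlonglongrightarrow> 0"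
    by (rule LIMSEQ_zero_if_norm_le) simp
qed

lemma dual_feasibility: "(\<lambda>k. c + transpose (M_pol \<gamma> p (\<pi> k)) *v \<Lambda> k) \<longlonglongrightarrow> 0"
proof (rule LIMSEQ_imp_Suc)
  obtain K where K: "1 \<le> K" "\<And>k. norm (\<Lambda> k) \<le> K"
    "\<And>k i x. norm (M_pol \<gamma> p (\<pi> i) *v x - Mh k (\<pi> i) *v x) \<le> K * e k * norm x"
    by (rule operator_bounds) (rule that)
  have "norm (c + transpose (M_pol \<gamma> p (\<pi> (Suc k))) *v \<Lambda> (Suc k)) \<le> 1 / \<eta>\<^sub>V * dV k + K * e k * K" for k
  proof -
    let ?A = "M_pol \<gamma> p (\<pi> (Suc k))" and ?B = "Mh k (\<pi> (Suc k))"
    have "c + transpose ?A *v \<Lambda> (Suc k)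
        = (c + transpose ?B *v \<Lambda> (Suc k)) + transpose (?A - ?B) *v \<Lambda> (Suc k)"
      unfolding transpose_diff matrix_vector_mult_diff_rdistrib by simp
    also have "norm \<dots> \<le> norm (c + transpose ?B *v \<Lambda> (Suc k)) + norm (transpose (?A - ?B) *v \<Lambda> (Suc k))"
      by (rule norm_triangle_ineq)
    also have "norm (c + transpose ?B *v \<Lambda> (Suc k)) = 1 / \<eta>\<^sub>V * dV k"
      using parameters unfolding value_optimality by (simp add: dV_def)
    also have "norm (transpose (?A - ?B) *v \<Lambda> (Suc k)) \<le> K * e k * norm (\<Lambda> (Suc k))"
      by (rule norm_transpose_mult_le) (use K(3) in \<open>simp add: matrix_vector_mult_diff_rdistrib\<close>)
    also have "\<dots> \<le> K * e k * K"
      using K(1) e_nonneg[of k] by (intro mult_left_mono K) auto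
    finally show ?thesis by simp
  qed
  moreover have "(\<lambda>k. 1 / \<eta>\<^sub>V * dV k + K * e k * K) \<longlonglongrightarrow> 1 / \<eta>\<^sub>V * 0 + K * 0 * K"
    by (intro tendsto_intros d_tendsto e_tendsto)
  ultimately show "(\<lambda>k. c + transpose (M_pol \<gamma> p (\<pi> (Suc k))) *v \<Lambda> (Suc k)) \<longlonglongrightarrow> 0"
    by (rule LIMSEQ_zero_if_norm_le) simp
qed

lemma kkt_residual_tendsto: "(\<lambda>k. kkt_residual \<gamma> p r \<phi> c (\<pi> k) (V k) (\<Lambda> k)) \<longlonglongrightarrow> 0"
\<comment> \<open>At index 0 the subdifferential may be empty and the residual infinite; later
  policies are minimizers and have the subgradient \<open>subgrad\<close>.\<close>
proof (rule LIMSEQ_imp_Suc)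
  let ?g = "\<lambda>k. subgrad k + adjoint (bellman_lin \<gamma> p r (V (Suc k))) (\<Lambda> (Suc k))"
  let ?d = "\<lambda>k. c + transpose (M_pol \<gamma> p (\<pi> (Suc k))) *v \<Lambda> (Suc k)"
  let ?b = "\<lambda>k. (norm (?g k))\<^sup>2 + (norm (?d k))\<^sup>2 + (norm (R (\<pi> (Suc k)) (V (Suc k))))\<^sup>2"
  let ?G = "\<lambda>k. kkt_residual \<gamma> p r \<phi> c (\<pi> (Suc k)) (V (Suc k)) (\<Lambda> (Suc k))"
  have nonneg: "0 \<le> edist_set 0 X" for X :: "(real^'a^'s) set"
    unfolding edist_set_def by (rule INF_greatest) simp
  have upper: "?G k \<le> ereal (?b k)" for k
  proof -
    let ?S = "policy_stationarity_set \<gamma> p r \<phi> (\<pi> (Suc k)) (V (Suc k)) (\<Lambda> (Suc k))"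
    \<comment> \<open>An explicit element makes the distance finite and bounds it; on the empty set
      it would be infinite by convention.\<close>
    have "?g k \<in> ?S"
      unfolding policy_stationarity_set_def J_pol_eq
      using subgrad_regular[of k] regular_subset_limiting by blast
    then have "edist_set 0 ?S \<le> ereal (norm (?g k))"
      unfolding edist_set_def by (rule INF_lower2) simp
    then have "(edist_set 0 ?S)\<^sup>2 \<le> ereal ((norm (?g k))\<^sup>2)"
      unfolding power2_eq_square times_ereal.simps(1)[symmetric]
      by (intro ereal_mult_mono nonneg) auto
    then show ?thesis
      unfolding kkt_residual_def plus_ereal.simps(1)[symmetric] by (intro add_right_mono)
  qed
  have lower: "0 \<le> ?G k" for k
    unfolding kkt_residual_def power2_eq_square[of "edist_set _ _"]
    by (intro add_nonneg_nonneg ereal_0_le_mult nonneg) auto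
  have "?b \<longlonglongrightarrow> (norm (0::real^'a^'s))\<^sup>2 + (norm (0::real^'s))\<^sup>2 + (norm (0::real^'s))\<^sup>2"
    by (intro tendsto_intros stationarity_gap LIMSEQ_Suc[OF dual_feasibility] LIMSEQ_Suc[OF primal_feasibility])
  then have b: "(\<lambda>k. ereal (?b k)) \<longlonglongrightarrow> 0" by (simp add: zero_ereal_def)
  show "?G \<longlonglongrightarrow> 0"
    by (rule tendsto_sandwich[OF _ _ tendsto_const b]) (intro always_eventually allI lower upper)+
qed

text \<open>A limiting subgradient requires convergence of the function values, of which lower
  semicontinuity gives only the lower half. The upper half comes from
  \<open>policy_variational\<close> tested at the limit point itself.\<close>

lemma accumulation_point_kkt:
  assumes i: "strict_mono i" and lim: "((\<lambda>k. (\<pi> k, V k, \<Lambda> k)) \<circ> i) \<longlonglongrightarrow> (\<pi>s, Vs, \<Lambda>s)"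
  shows "kkt_point \<gamma> p r \<phi> c \<pi>s Vs \<Lambda>s"
proof -
  \<comment> \<open>Predecessors of the indices of the subsequence. Its first index is dropped
    because it may be 0; the others are positive by strict monotonicity.\<close>
  define k where "k j = i (Suc j) - 1" for j
  have ik: "i (Suc j) = Suc (k j)" for j
    using strict_mono_less[OF i, of j "Suc j"] by (simp add: k_def)
  have k: "filterlim k at_top sequentially"
    using filterlim_compose[OF filterlim_minus_const_nat_at_top
        filterlim_compose[OF filterlim_subseq[OF i] filterlim_Suc]]
    by (simp add: k_def[abs_def] o_def)
  have lim': "(\<lambda>j. (\<pi> (Suc (k j)), V (Suc (k j)), \<Lambda> (Suc (k j)))) \<longlonglongrightarrow> (\<pi>s, Vs, \<Lambda>s)"
    using LIMSEQ_Suc[OF lim] by (simp add: o_def ik)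
  have \<pi>: "(\<lambda>j. \<pi> (Suc (k j))) \<longlonglongrightarrow> \<pi>s" using tendsto_fst[OF lim'] by simp
  have V: "(\<lambda>j. V (Suc (k j))) \<longlonglongrightarrow> Vs" using tendsto_fst[OF tendsto_snd[OF lim']] by simp
  have \<Lambda>: "(\<lambda>j. \<Lambda> (Suc (k j))) \<longlonglongrightarrow> \<Lambda>s" using tendsto_snd[OF tendsto_snd[OF lim']] by simp
  have Suc_k: "filterlim (\<lambda>j. Suc (k j)) at_top sequentially"
    using filterlim_compose[OF filterlim_Suc k] .
  have R: "R \<pi>s Vs = 0"
    using LIMSEQ_unique[OF continuous_bellman_res[OF \<pi> V] filterlim_compose[OF primal_feasibility Suc_k]] .
  have D: "c + transpose (M_pol \<gamma> p \<pi>s) *v \<Lambda>s = 0"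
    using LIMSEQ_unique[OF tendsto_add[OF tendsto_const continuous_transpose_M_pol[OF \<pi> \<Lambda>]]
        filterlim_compose[OF dual_feasibility Suc_k]] .
  have \<pi>s: "\<pi>s \<in> policies"
    by (rule closed_sequentially[OF closed_policies policy_in \<pi>])
  let ?J = "\<lambda>v. bellman_lin \<gamma> p r v"
  have adj: "(\<lambda>j. adjoint (?J (V (Suc (k j)))) (\<Lambda> (Suc (k j)))) \<longlonglongrightarrow> adjoint (?J Vs) \<Lambda>s"
  proof -
    obtain K where K: "1 \<le> K" "\<And>j h. norm (?J (V j) h) \<le> K * norm h"
      by (rule operator_bounds) (rule that)
    have "norm (adjoint (?J (V (Suc (k j)))) (\<Lambda> (Suc (k j))) - adjoint (?J Vs) \<Lambda>s)
        \<le> K * norm (\<Lambda> (Suc (k j)) - \<Lambda>s) + n * norm (V (Suc (k j)) - Vs) * norm \<Lambda>s" for j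
      unfolding n_def using K
      by (intro norm_adjoint_bellman_lin_diff gamma_le stochastic) auto
    moreover have "(\<lambda>j. K * norm (\<Lambda> (Suc (k j)) - \<Lambda>s) + n * norm (V (Suc (k j)) - Vs) * norm \<Lambda>s)
        \<longlonglongrightarrow> K * norm (\<Lambda>s - \<Lambda>s) + n * norm (Vs - Vs) * norm \<Lambda>s"
      by (intro tendsto_intros \<Lambda> V)
    ultimately have "(\<lambda>j. adjoint (?J (V (Suc (k j)))) (\<Lambda> (Suc (k j))) - adjoint (?J Vs) \<Lambda>s) \<longlonglongrightarrow> 0"
      by (rule LIMSEQ_zero_if_norm_le) simp
    then show ?thesis by (simp add: LIM_zero_cancel)
  qed
  define w where "w = - adjoint (?J Vs) \<Lambda>s"
  have w: "(\<lambda>j. subgrad (k j)) \<longlonglongrightarrow> w"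
    using tendsto_diff[OF filterlim_compose[OF stationarity_gap k] adj] by (simp add: w_def)
  obtain K where K: "0 \<le> K" "\<And>k q. q \<in> policies \<Longrightarrow>
    \<phi> (\<pi> (Suc k)) + ereal (subgrad k \<bullet> (q - \<pi> (Suc k)))
      \<le> \<phi> q + ereal (K * (norm (q - \<pi> (Suc k)))\<^sup>2)"
    by (rule policy_variational) (rule that)
  define s where "s q j = K * (norm (q - \<pi> (Suc (k j))))\<^sup>2 - subgrad (k j) \<bullet> (q - \<pi> (Suc (k j)))" for q j
  have s_bound: "\<phi> (\<pi> (Suc (k j))) \<le> \<phi> q + ereal (s q j)" if "q \<in> policies" for q j
    using K(2)[OF that, of "k j"] phi_not_MInf[of q] unfolding phi_eq s_def by (cases "\<phi> q") auto
  have s_lim: "s q \<longlonglongrightarrow> K * (norm (q - \<pi>s))\<^sup>2 - w \<bullet> (q - \<pi>s)" for q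
    unfolding s_def[abs_def] by (intro tendsto_intros \<pi> w)
  note lsc = lsc_on_sequentially[OF phi_lsc \<pi>s policy_in \<pi>]
  obtain T where T: "\<And>j. s (\<pi> 0) j \<le> T"
    using s_lim[of "\<pi> 0"] by (metis Bseq_def abs_le_D1 convergentI convergent_imp_Bseq real_norm_def)
  \<comment> \<open>A priori \<phi> may be infinite at the limit. Testing with
    \<open>\<pi> 0\<close> keeps the \<phi>-values of the iterates below a fixed level, and lower
    semicontinuity passes this level on to the limit.\<close>
  have "\<phi> \<pi>s \<le> ereal (f 0 + T)"
  proof (rule ccontr)
    assume "\<not> \<phi> \<pi>s \<le> ereal (f 0 + T)"
    then have "\<forall>\<^sub>F j in sequentially. ereal (f 0 + T) < \<phi> (\<pi> (Suc (k j)))"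
      by (intro lsc) simp
    then obtain j where "ereal (f 0 + T) < \<phi> (\<pi> (Suc (k j)))"
      using eventually_happens' sequentially_bot by blast
    moreover have "\<phi> (\<pi> (Suc (k j))) \<le> ereal (f 0 + s (\<pi> 0) j)"
      using s_bound[OF policy_in[of 0], of j] by (simp add: phi_eq[of 0])
    ultimately show False using T[of j] by (simp add: phi_eq)
  qed
  then obtain fs where fs: "\<phi> \<pi>s = ereal fs"
    using phi_not_MInf[of \<pi>s] by (cases "\<phi> \<pi>s") auto
  have "(\<lambda>j. \<phi> (\<pi> (Suc (k j)))) \<longlonglongrightarrow> \<phi> \<pi>s"
  proof (rule order_tendstoI)
    show "\<forall>\<^sub>F j in sequentially. a < \<phi> (\<pi> (Suc (k j)))" if "a < \<phi> \<pi>s" for a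
      by (rule lsc[OF that])
  next
    fix a assume a: "\<phi> \<pi>s < a"
    have "(\<lambda>j. ereal (fs + s \<pi>s j)) \<longlonglongrightarrow> ereal (fs + (K * (norm (\<pi>s - \<pi>s))\<^sup>2 - w \<bullet> (\<pi>s - \<pi>s)))"
      by (intro tendsto_intros s_lim)
    then have "(\<lambda>j. ereal (fs + s \<pi>s j)) \<longlonglongrightarrow> \<phi> \<pi>s" by (simp add: fs)
    then have "\<forall>\<^sub>F j in sequentially. ereal (fs + s \<pi>s j) < a" using a by (rule order_tendstoD)
    then show "\<forall>\<^sub>F j in sequentially. \<phi> (\<pi> (Suc (k j))) < a"
      by (rule eventually_mono) (use s_bound[OF \<pi>s] fs in \<open>auto intro: le_less_trans\<close>)
  qed
  then have "(\<lambda>j. \<psi> (\<pi> (Suc (k j)))) \<longlonglongrightarrow> \<psi> \<pi>s"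
    unfolding psi_iterate psi_eq[OF \<pi>s] .
  moreover have "\<bar>\<psi> \<pi>s\<bar> \<noteq> \<infinity>" using psi_eq[OF \<pi>s] fs by simp
  ultimately have "w \<in> limiting_subdifferential \<psi> \<pi>s"
    unfolding limiting_subdifferential_def
    by (intro CollectI conjI exI[of _ "\<lambda>j. \<pi> (Suc (k j))"] exI[of _ "\<lambda>j. subgrad (k j)"] allI
        subgrad_regular \<pi> w) assumption+
  moreover have "0 = w + adjoint (J_pol \<gamma> p r \<pi>s Vs) \<Lambda>s" by (simp add: w_def J_pol_eq)
  ultimately have "0 \<in> policy_stationarity_set \<gamma> p r \<phi> \<pi>s Vs \<Lambda>s"
    unfolding policy_stationarity_set_def by blast
  then show ?thesis using R D by (simp add: kkt_point_def del: transpose_matrix_vector)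
qed

lemma increments_tendsto:
  "(\<lambda>k. \<pi> (Suc k) - \<pi> k) \<longlonglongrightarrow> 0" "(\<lambda>k. V (Suc k) - V k) \<longlonglongrightarrow> 0" "(\<lambda>k. \<Lambda> (Suc k) - \<Lambda> k) \<longlonglongrightarrow> 0"
  using d_tendsto unfolding d\<pi>_def dV_def d\<Lambda>_def by (simp_all add: tendsto_norm_zero_iff)

end

section \<open>Sampling errors\<close>

lemma subalgebra_trans: "subalgebra M G \<Longrightarrow> subalgebra G F \<Longrightarrow> subalgebra M F"
  by (auto simp: subalgebra_def)

lemma (in prob_space) sigma_finite_subalgebra_if_subalgebra:
  assumes "subalgebra M F"
  shows "sigma_finite_subalgebra M F"
  by (rule finite_measure_subalgebra_is_sigma_finite) (unfold_locales, rule assms)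

text \<open>The partial sum is measurable before the next difference is drawn, so their product has
  mean zero and the second moments add up.\<close>

lemma (in prob_space) martingale_difference_second_moment:
  fixes X :: "nat \<Rightarrow> 'a \<Rightarrow> real" and F :: "nat \<Rightarrow> 'a measure"
  assumes sub: "\<And>t. t < n \<Longrightarrow> subalgebra M (F t)"
    and meas: "\<And>t. t < n \<Longrightarrow> X t \<in> borel_measurable M"
    and adapted: "\<And>s t. s < t \<Longrightarrow> t < n \<Longrightarrow> X s \<in> borel_measurable (F t)"
    and centered: "\<And>t. t < n \<Longrightarrow> AE \<omega> in M. real_cond_exp M (F t) (X t) \<omega> = 0"
    and square: "\<And>t. t < n \<Longrightarrow> integrable M (\<lambda>\<omega>. (X t \<omega>)\<^sup>2)"
    and var: "\<And>t. t < n \<Longrightarrow> expectation (\<lambda>\<omega>. (X t \<omega>)\<^sup>2) \<le> v"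
  shows "integrable M (\<lambda>\<omega>. (\<Sum>t<n. X t \<omega>)\<^sup>2)" "expectation (\<lambda>\<omega>. (\<Sum>t<n. X t \<omega>)\<^sup>2) \<le> real n * v"
proof -
  have "integrable M (\<lambda>\<omega>. (\<Sum>t<j. X t \<omega>)\<^sup>2) \<and> expectation (\<lambda>\<omega>. (\<Sum>t<j. X t \<omega>)\<^sup>2) \<le> real j * v"
    if "j \<le> n" for j
    using that
  proof (induction j)
    case (Suc j)
    let ?S = "\<lambda>\<omega>. \<Sum>t<j. X t \<omega>"
    interpret F: sigma_finite_subalgebra M "F j"
      using Suc.prems by (intro sigma_finite_subalgebra_if_subalgebra sub) auto
    have S: "?S \<in> borel_measurable (F j)"
      using Suc.prems by (intro borel_measurable_sum adapted) auto
    have X: "X j \<in> borel_measurable M" using Suc.prems by (intro meas) auto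
    have S': "?S \<in> borel_measurable M" by (rule measurable_from_subalg[OF F.subalg S])
    have S2: "integrable M (\<lambda>\<omega>. (?S \<omega>)\<^sup>2)" and X2: "integrable M (\<lambda>\<omega>. (X j \<omega>)\<^sup>2)"
      using Suc square by auto
    have SX: "integrable M (\<lambda>\<omega>. ?S \<omega> * X j \<omega>)"
    proof (rule Bochner_Integration.integrable_bound[OF Bochner_Integration.integrable_add[OF S2 X2]])
      show "AE \<omega> in M. norm (?S \<omega> * X j \<omega>) \<le> norm ((?S \<omega>)\<^sup>2 + (X j \<omega>)\<^sup>2)"
      proof (rule AE_I2)
        fix \<omega>
        have "2 * (\<bar>?S \<omega>\<bar> * \<bar>X j \<omega>\<bar>) \<le> (?S \<omega>)\<^sup>2 + (X j \<omega>)\<^sup>2"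
          using zero_le_power2[of "\<bar>?S \<omega>\<bar> - \<bar>X j \<omega>\<bar>"] by (simp add: power2_diff)
        moreover have "0 \<le> \<bar>?S \<omega>\<bar> * \<bar>X j \<omega>\<bar>" by simp
        ultimately have "\<bar>?S \<omega>\<bar> * \<bar>X j \<omega>\<bar> \<le> (?S \<omega>)\<^sup>2 + (X j \<omega>)\<^sup>2" by linarith
        then show "norm (?S \<omega> * X j \<omega>) \<le> norm ((?S \<omega>)\<^sup>2 + (X j \<omega>)\<^sup>2)"
          by (simp add: abs_mult)
      qed
    qed (use S' X in measurable)
    have "expectation (\<lambda>\<omega>. ?S \<omega> * X j \<omega>) = expectation (\<lambda>\<omega>. ?S \<omega> * real_cond_exp M (F j) (X j) \<omega>)"
      by (rule F.real_cond_exp_intg(2)[OF SX S X, symmetric])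
    also have "\<dots> = expectation (\<lambda>\<omega>. 0)"
    proof (rule integral_cong_AE)
      show "AE \<omega> in M. ?S \<omega> * real_cond_exp M (F j) (X j) \<omega> = 0"
        using centered[of j] Suc.prems by (auto elim: eventually_mono)
    qed (use S' in measurable)
    finally have cross: "expectation (\<lambda>\<omega>. ?S \<omega> * X j \<omega>) = 0" by simp
    have split: "(\<Sum>t<Suc j. X t \<omega>)\<^sup>2 = (?S \<omega>)\<^sup>2 + 2 * (?S \<omega> * X j \<omega>) + (X j \<omega>)\<^sup>2" for \<omega>
      by (simp add: power2_sum)
    have "expectation (\<lambda>\<omega>. (\<Sum>t<Suc j. X t \<omega>)\<^sup>2)
        = expectation (\<lambda>\<omega>. (?S \<omega>)\<^sup>2) + expectation (\<lambda>\<omega>. (X j \<omega>)\<^sup>2)"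
      unfolding split using S2 X2 SX cross by simp
    also have "\<dots> \<le> real j * v + v"
      using Suc var[of j] by (intro add_mono) auto
    finally have "expectation (\<lambda>\<omega>. (\<Sum>t<Suc j. X t \<omega>)\<^sup>2) \<le> real (Suc j) * v"
      by (simp add: algebra_simps)
    moreover have "integrable M (\<lambda>\<omega>. (\<Sum>t<Suc j. X t \<omega>)\<^sup>2)"
      unfolding split using S2 X2 SX by simp
    ultimately show ?case by blast
  qed simp
  from this[of n] show "integrable M (\<lambda>\<omega>. (\<Sum>t<n. X t \<omega>)\<^sup>2)"
    "expectation (\<lambda>\<omega>. (\<Sum>t<n. X t \<omega>)\<^sup>2) \<le> real n * v" by auto
qed

text \<open>The expectation of the series is the sum of the expectations and hence finite, so the
  series is finite almost surely.\<close>

lemma AE_summable_if_summable_expectation_bound: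
  fixes f :: "nat \<Rightarrow> 'a \<Rightarrow> real"
  assumes int: "\<And>k. integrable M (f k)" and nonneg: "\<And>k \<omega>. 0 \<le> f k \<omega>"
    and le: "\<And>k. integral\<^sup>L M (f k) \<le> u k" and u: "summable u"
  shows "AE \<omega> in M. summable (\<lambda>k. f k \<omega>)"
proof -
  have u_nonneg: "0 \<le> u k" for k
    by (rule order_trans[OF Bochner_Integration.integral_nonneg le]) (rule nonneg)
  have "(\<integral>\<^sup>+\<omega>. (\<Sum>k. ennreal (f k \<omega>)) \<partial>M) = (\<Sum>k. \<integral>\<^sup>+\<omega>. ennreal (f k \<omega>) \<partial>M)"
    by (rule nn_integral_suminf) (use int in measurable)
  also have "\<dots> = (\<Sum>k. ennreal (integral\<^sup>L M (f k)))"
    by (intro suminf_cong nn_integral_eq_integral int) (simp add: nonneg)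
  also have "\<dots> \<le> (\<Sum>k. ennreal (u k))"
    by (intro suminf_le ennreal_leI le) auto
  also have "\<dots> = ennreal (suminf u)" by (rule suminf_ennreal2[OF u_nonneg u])
  finally have "(\<integral>\<^sup>+\<omega>. (\<Sum>k. ennreal (f k \<omega>)) \<partial>M) \<noteq> \<infinity>"
    by (auto simp: top_unique)
  then have "AE \<omega> in M. (\<Sum>k. ennreal (f k \<omega>)) \<noteq> \<infinity>"
    by (intro nn_integral_PInf_AE) (use int in measurable)
  then show ?thesis
    by (rule eventually_mono) (auto intro: summable_suminf_not_top nonneg)
qed

text \<open>A batch sum has second moment at most m v, its average at most v/m. Different batches
  are combined through expectations alone, whatever their dependence.\<close>

lemma (in prob_space) martingale_batch_averages_summable:
  fixes X :: "nat \<Rightarrow> nat \<Rightarrow> 'a \<Rightarrow> real" and F :: "nat \<Rightarrow> nat \<Rightarrow> 'a measure"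
  assumes m: "\<And>k. 1 \<le> m k"
    and sub: "\<And>k t. t < m k \<Longrightarrow> subalgebra M (F k t)"
    and meas: "\<And>k t. t < m k \<Longrightarrow> X k t \<in> borel_measurable M"
    and adapted: "\<And>k s t. s < t \<Longrightarrow> t < m k \<Longrightarrow> X k s \<in> borel_measurable (F k t)"
    and centered: "\<And>k t. t < m k \<Longrightarrow> AE \<omega> in M. real_cond_exp M (F k t) (X k t) \<omega> = 0"
    and square: "\<And>k t. t < m k \<Longrightarrow> integrable M (\<lambda>\<omega>. (X k t \<omega>)\<^sup>2)"
    and var: "\<And>k t. t < m k \<Longrightarrow> expectation (\<lambda>\<omega>. (X k t \<omega>)\<^sup>2) \<le> v k"
    and v: "summable (\<lambda>k. v k / real (m k))"
  shows "AE \<omega> in M. summable (\<lambda>k. ((\<Sum>t<m k. X k t \<omega>) / real (m k))\<^sup>2)"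
proof (rule AE_summable_if_summable_expectation_bound[OF _ _ _ v])
  fix k
  note mom = martingale_difference_second_moment[of "m k" "F k" "X k" "v k",
      OF sub meas adapted centered square var]
  show "integrable M (\<lambda>\<omega>. ((\<Sum>t<m k. X k t \<omega>) / real (m k))\<^sup>2)"
    unfolding power_divide by (rule integrable_divide) (rule mom(1))
  have "expectation (\<lambda>\<omega>. ((\<Sum>t<m k. X k t \<omega>) / real (m k))\<^sup>2)
      = expectation (\<lambda>\<omega>. (\<Sum>t<m k. X k t \<omega>)\<^sup>2) / (real (m k))\<^sup>2"
    unfolding power_divide by simp
  also have "\<dots> \<le> real (m k) * v k / (real (m k))\<^sup>2"
    by (intro divide_right_mono mom(2)) auto
  also have "\<dots> = v k / real (m k)" using m[of k] by (simp add: power2_eq_square)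
  finally show "expectation (\<lambda>\<omega>. ((\<Sum>t<m k. X k t \<omega>) / real (m k))\<^sup>2) \<le> v k / real (m k)" .
qed simp

lemma (in prob_space) weighted_centered_indicator:
  fixes w Z q :: "'a \<Rightarrow> real"
  assumes F: "subalgebra M F" and w: "w \<in> borel_measurable F" and Z: "Z \<in> borel_measurable M"
    and q: "q \<in> borel_measurable F"
    and w1: "\<And>\<omega>. \<omega> \<in> space M \<Longrightarrow> \<bar>w \<omega>\<bar> \<le> 1" and Z1: "\<And>\<omega>. \<omega> \<in> space M \<Longrightarrow> \<bar>Z \<omega>\<bar> \<le> 1"
    and q1: "\<And>\<omega>. \<omega> \<in> space M \<Longrightarrow> \<bar>q \<omega>\<bar> \<le> 1"
    and law: "AE \<omega> in M. real_cond_exp M F Z \<omega> = q \<omega>"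
  shows "AE \<omega> in M. real_cond_exp M F (\<lambda>\<omega>. w \<omega> * (Z \<omega> - q \<omega>)) \<omega> = 0"
    "integrable M (\<lambda>\<omega>. (w \<omega> * (Z \<omega> - q \<omega>))\<^sup>2)"
    "expectation (\<lambda>\<omega>. (w \<omega> * (Z \<omega> - q \<omega>))\<^sup>2) \<le> 4"
proof -
  interpret F: sigma_finite_subalgebra M F by (rule sigma_finite_subalgebra_if_subalgebra[OF F])
  note w' = measurable_from_subalg[OF F w] and q' = measurable_from_subalg[OF F q]
  have bounded: "\<bar>w \<omega> * (Z \<omega> - q \<omega>)\<bar> \<le> 2" if "\<omega> \<in> space M" for \<omega>
  proof -
    have "\<bar>w \<omega>\<bar> * \<bar>Z \<omega> - q \<omega>\<bar> \<le> 1 * 2"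
      using w1[OF that] Z1[OF that] q1[OF that] by (intro mult_mono) auto
    then show ?thesis by (simp add: abs_mult)
  qed
  have Zi: "integrable M Z" by (rule integrable_const_bound[of _ 1]) (use Z Z1 in auto)
  have qi: "integrable M q" by (rule integrable_const_bound[of _ 1]) (use q' q1 in auto)
  have wi: "integrable M (\<lambda>\<omega>. w \<omega> * (Z \<omega> - q \<omega>))"
    by (rule integrable_const_bound[of _ 2]) (use w' Z q' bounded in auto)
  have "AE \<omega> in M. real_cond_exp M F (\<lambda>\<omega>. w \<omega> * (Z \<omega> - q \<omega>)) \<omega>
      = w \<omega> * real_cond_exp M F (\<lambda>\<omega>. Z \<omega> - q \<omega>) \<omega>"
    by (rule F.real_cond_exp_mult[OF w _ wi]) (use Z q' in measurable)
  with F.real_cond_exp_diff[OF Zi qi] F.real_cond_exp_F_meas[OF qi q] law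
  show "AE \<omega> in M. real_cond_exp M F (\<lambda>\<omega>. w \<omega> * (Z \<omega> - q \<omega>)) \<omega> = 0"
    by eventually_elim simp
  have sq: "(w \<omega> * (Z \<omega> - q \<omega>))\<^sup>2 \<le> 4" if "\<omega> \<in> space M" for \<omega>
    using power_mono[OF bounded[OF that], of 2] by simp
  show i: "integrable M (\<lambda>\<omega>. (w \<omega> * (Z \<omega> - q \<omega>))\<^sup>2)"
    by (rule integrable_const_bound[of _ 4]) (use w' Z q' sq in auto)
  have "expectation (\<lambda>\<omega>. (w \<omega> * (Z \<omega> - q \<omega>))\<^sup>2) \<le> expectation (\<lambda>_. 4)"
    by (rule integral_mono[OF i]) (use sq in auto)
  then show "expectation (\<lambda>\<omega>. (w \<omega> * (Z \<omega> - q \<omega>))\<^sup>2) \<le> 4" by (simp add: prob_space)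
qed

text \<open>Integrability of the noise has to be derived: \<open>nn_cond_exp\<close> makes sense
  without it, so the conditional bound integrates to a finite second moment. Only then can the known
  weight be taken out of \<open>real_cond_exp\<close>.\<close>

lemma (in prob_space) weighted_centered_noise:
  fixes w Z :: "'a \<Rightarrow> real"
  assumes F: "subalgebra M F" and w: "w \<in> borel_measurable F" and Z: "Z \<in> borel_measurable M"
    and w1: "\<And>\<omega>. \<omega> \<in> space M \<Longrightarrow> \<bar>w \<omega>\<bar> \<le> 1"
    and centered: "AE \<omega> in M. real_cond_exp M F Z \<omega> = 0"
    and var: "AE \<omega> in M. nn_cond_exp M F (\<lambda>\<omega>. ennreal (\<bar>Z \<omega>\<bar>\<^sup>2)) \<omega> \<le> ennreal v" and v: "0 \<le> v"
  shows "AE \<omega> in M. real_cond_exp M F (\<lambda>\<omega>. w \<omega> * Z \<omega>) \<omega> = 0"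
    "integrable M (\<lambda>\<omega>. (w \<omega> * Z \<omega>)\<^sup>2)"
    "expectation (\<lambda>\<omega>. (w \<omega> * Z \<omega>)\<^sup>2) \<le> v"
proof -
  interpret F: sigma_finite_subalgebra M F by (rule sigma_finite_subalgebra_if_subalgebra[OF F])
  note w' = measurable_from_subalg[OF F w]
  have "(\<integral>\<^sup>+\<omega>. ennreal (\<bar>Z \<omega>\<bar>\<^sup>2) \<partial>M) = (\<integral>\<^sup>+\<omega>. nn_cond_exp M F (\<lambda>\<omega>. ennreal (\<bar>Z \<omega>\<bar>\<^sup>2)) \<omega> \<partial>M)"
    using F.nn_cond_exp_intg[of "\<lambda>_. 1" "\<lambda>\<omega>. ennreal (\<bar>Z \<omega>\<bar>\<^sup>2)"] Z by simp
  also have "\<dots> \<le> (\<integral>\<^sup>+\<omega>. ennreal v \<partial>M)" by (rule nn_integral_mono_AE[OF var])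
  also have "\<dots> = ennreal v" by (simp add: emeasure_space_1)
  finally have nn: "(\<integral>\<^sup>+\<omega>. ennreal ((Z \<omega>)\<^sup>2) \<partial>M) \<le> ennreal v" by simp
  have Z2: "integrable M (\<lambda>\<omega>. (Z \<omega>)\<^sup>2)"
    by (rule integrableI_nonneg) (use Z nn in \<open>auto simp: less_top[symmetric] top_unique\<close>)
  have "ennreal (expectation (\<lambda>\<omega>. (Z \<omega>)\<^sup>2)) \<le> ennreal v"
    using nn nn_integral_eq_integral[OF Z2] by simp
  then have EZ2: "expectation (\<lambda>\<omega>. (Z \<omega>)\<^sup>2) \<le> v" using v by (simp add: ennreal_le_iff)
  have Zi: "integrable M Z" by (rule square_integrable_imp_integrable[OF Z Z2])
  have le: "\<bar>w \<omega> * Z \<omega>\<bar> \<le> \<bar>Z \<omega>\<bar>" if "\<omega> \<in> space M" for \<omega>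
    using mult_right_mono[OF w1[OF that], of "\<bar>Z \<omega>\<bar>"] by (simp add: abs_mult)
  have wi: "integrable M (\<lambda>\<omega>. w \<omega> * Z \<omega>)"
    by (rule Bochner_Integration.integrable_bound[OF Zi]) (use w' Z le in auto)
  have "AE \<omega> in M. real_cond_exp M F (\<lambda>\<omega>. w \<omega> * Z \<omega>) \<omega> = w \<omega> * real_cond_exp M F Z \<omega>"
    by (rule F.real_cond_exp_mult[OF w Z wi])
  with centered show "AE \<omega> in M. real_cond_exp M F (\<lambda>\<omega>. w \<omega> * Z \<omega>) \<omega> = 0"
    by eventually_elim simp
  have sq: "(w \<omega> * Z \<omega>)\<^sup>2 \<le> (Z \<omega>)\<^sup>2" if "\<omega> \<in> space M" for \<omega>
    using le[OF that] by (rule abs_le_square_iff[THEN iffD1])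
  show i: "integrable M (\<lambda>\<omega>. (w \<omega> * Z \<omega>)\<^sup>2)"
    by (rule Bochner_Integration.integrable_bound[OF Z2]) (use w' Z sq in auto)
  have "expectation (\<lambda>\<omega>. (w \<omega> * Z \<omega>)\<^sup>2) \<le> expectation (\<lambda>\<omega>. (Z \<omega>)\<^sup>2)"
    by (rule integral_mono[OF i Z2]) (use sq in auto)
  with EZ2 show "expectation (\<lambda>\<omega>. (w \<omega> * Z \<omega>)\<^sup>2) \<le> v" by simp
qed

section \<open>Batch averages along the sampled chain\<close>

context markovian_sampling begin

lemma subalg_M_G: "t < m k \<Longrightarrow> subalgebra M (G k t)"
  by (rule subalgebra_trans[OF subalg_next subalg_G])

lemma subalg_M_H: "t < m k \<Longrightarrow> subalgebra M (H k t)"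
  by (rule subalgebra_trans[OF subalg_M_G subalg_H])

lemma subalg_H_next:
  assumes "s < t" "t < m k"
  shows "subalgebra (H k t) (next_history m H k s)"
  using assms
proof (induction t)
  case (Suc t)
  have H: "H k (Suc t) = next_history m H k t" using Suc.prems by (simp add: next_history_def)
  show ?case
  proof (cases "s = t")
    case True
    then show ?thesis using H by (simp add: subalgebra_def)
  next
    case False
    then have "subalgebra (H k t) (next_history m H k s)" using Suc by auto
    then show ?thesis unfolding H
      using Suc.prems by (meson Suc_lessD subalgebra_trans subalg_G subalg_H)
  qed
qed simp

lemma subalg_G_next: "s < t \<Longrightarrow> t < m k \<Longrightarrow> subalgebra (G k t) (next_history m H k s)"
  by (rule subalgebra_trans[OF subalg_H subalg_H_next])

lemma subalg_H_0: "t < m k \<Longrightarrow> subalgebra (H k t) (H k 0)"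
proof (cases t)
  case (Suc j)
  assume t: "t < m k"
  have "subalgebra (next_history m H k 0) (H k 0)"
    using batch_nonempty[of k] by (intro subalgebra_trans[OF subalg_G subalg_H]) auto
  then show ?thesis using subalg_H_next[of 0 t k] t Suc subalgebra_trans by blast
qed (simp add: subalgebra_def)

lemma state_meas_G: "t < m k \<Longrightarrow> S k t \<in> measurable (G k t) (count_space UNIV)"
  by (rule measurable_from_subalg[OF subalg_H state_meas])

text \<open>A 0-1 selector of steps, known before the reward and the next state are drawn. It
  selects the non-reset visits of a pair, and also the reset steps with a given action.\<close>

definition weight :: "('s \<Rightarrow> 'a \<Rightarrow> bool \<Rightarrow> bool) \<Rightarrow> nat \<Rightarrow> nat \<Rightarrow> 'w \<Rightarrow> real" where
  "weight g k t \<omega> = of_bool (g (S k t \<omega>) (A k t \<omega>) (C k t \<omega>))"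

lemma weight_meas: "t < m k \<Longrightarrow> weight g k t \<in> borel_measurable (G k t)"
proof -
  assume t: "t < m k"
  have "(\<lambda>\<omega>. g (S k t \<omega>) (A k t \<omega>) (C k t \<omega>)) \<in> measurable (G k t) (count_space UNIV)"
    by (rule measurable_compose_countable[OF _ state_meas_G[OF t]],
        rule measurable_compose_countable[OF _ action_meas[OF t]],
        rule measurable_compose_countable[OF _ coin_meas[OF t]]) simp
  then show ?thesis unfolding weight_def[abs_def] by measurable
qed

definition next_law :: "'s \<Rightarrow> nat \<Rightarrow> nat \<Rightarrow> 'w \<Rightarrow> real" where
  "next_law s' k t \<omega> = (if C k t \<omega> then pmf \<rho> s' else pmf (P (S k t \<omega>) (A k t \<omega>)) s')"

lemma next_law_meas: "t < m k \<Longrightarrow> next_law s' k t \<in> borel_measurable (G k t)"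
proof -
  assume t: "t < m k"
  show ?thesis unfolding next_law_def[abs_def]
    by (rule measurable_compose_countable[OF _ state_meas_G[OF t]],
        rule measurable_compose_countable[OF _ action_meas[OF t]],
        rule measurable_compose_countable[OF _ coin_meas[OF t]]) simp
qed

definition next_ind :: "'s \<Rightarrow> nat \<Rightarrow> nat \<Rightarrow> 'w \<Rightarrow> real" where
  "next_ind s' k t = indicator {\<omega> \<in> space M. N k t \<omega> = s'}"

lemma next_ind_meas: "t < m k \<Longrightarrow> next_ind s' k t \<in> borel_measurable (next_history m H k t)"
proof -
  assume t: "t < m k"
  have "space M = space (next_history m H k t)" using subalg_next[OF t] by (simp add: subalgebra_def)
  then show ?thesis unfolding next_ind_def using next_meas[OF t] by simp
qed

lemma next_state_averages:
  assumes "summable (\<lambda>k. 1 / real (m k))"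
  shows "AE \<omega> in M. summable (\<lambda>k. ((\<Sum>t<m k. weight g k t \<omega> * (next_ind s' k t \<omega> - next_law s' k t \<omega>)) / real (m k))\<^sup>2)"
proof (rule martingale_batch_averages_summable[where F = G and v = "\<lambda>_. 4"])
  fix k t assume t: "t < m k"
  note F = subalg_M_G[OF t]
  have Z: "next_ind s' k t \<in> borel_measurable M"
    by (rule measurable_from_subalg[OF subalg_next[OF t] next_ind_meas[OF t]])
  have law: "AE \<omega> in M. real_cond_exp M (G k t) (next_ind s' k t) \<omega> = next_law s' k t \<omega>"
    unfolding next_ind_def next_law_def by (rule next_state_law[OF t])
  note wc = weighted_centered_indicator[OF F weight_meas[OF t] Z next_law_meas[OF t] _ _ _ law, of g]
  show "AE \<omega> in M. real_cond_exp M (G k t) (\<lambda>\<omega>. weight g k t \<omega> * (next_ind s' k t \<omega> - next_law s' k t \<omega>)) \<omega> = 0"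
    "integrable M (\<lambda>\<omega>. (weight g k t \<omega> * (next_ind s' k t \<omega> - next_law s' k t \<omega>))\<^sup>2)"
    "expectation (\<lambda>\<omega>. (weight g k t \<omega> * (next_ind s' k t \<omega> - next_law s' k t \<omega>))\<^sup>2) \<le> 4"
    by (rule wc; simp add: weight_def next_ind_def next_law_def pmf_le_1 split: split_indicator)+
  show "(\<lambda>\<omega>. weight g k t \<omega> * (next_ind s' k t \<omega> - next_law s' k t \<omega>)) \<in> borel_measurable M"
    using Z measurable_from_subalg[OF F weight_meas[OF t]] measurable_from_subalg[OF F next_law_meas[OF t]]
    by measurable
next
  fix k s t assume st: "s < t" "t < m k"
  then have s: "s < m k" by simp
  note sub = subalg_G_next[OF st]
  show "(\<lambda>\<omega>. weight g k s \<omega> * (next_ind s' k s \<omega> - next_law s' k s \<omega>)) \<in> borel_measurable (G k t)"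
    using measurable_from_subalg[OF sub next_ind_meas[OF s]]
      measurable_from_subalg[OF subalgebra_trans[OF sub subalg_G[OF s]] weight_meas[OF s]]
      measurable_from_subalg[OF subalgebra_trans[OF sub subalg_G[OF s]] next_law_meas[OF s]]
    by measurable
next
  show "summable (\<lambda>k. 4 / real (m k))" using summable_mult[OF assms, of 4] by simp
qed (use subalg_M_G batch_nonempty in auto)

definition action_ind :: "'a \<Rightarrow> bool \<Rightarrow> nat \<Rightarrow> nat \<Rightarrow> 'w \<Rightarrow> real" where
  "action_ind a d k t = indicator {\<omega> \<in> space M. A k t \<omega> = a \<and> C k t \<omega> = d}"

definition action_law :: "'a \<Rightarrow> bool \<Rightarrow> nat \<Rightarrow> nat \<Rightarrow> 'w \<Rightarrow> real" where
  "action_law a d k t \<omega> = \<pi>b k \<omega> $ S k t \<omega> $ a * (if d then 1 - \<gamma> else \<gamma>)"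

lemma action_ind_meas: "t < m k \<Longrightarrow> action_ind a d k t \<in> borel_measurable (G k t)"
proof -
  assume t: "t < m k"
  have "space M = space (G k t)" using subalg_M_G[OF t] by (simp add: subalgebra_def)
  then show ?thesis unfolding action_ind_def using action_meas[OF t] coin_meas[OF t] by simp
qed

lemma action_law_meas: "t < m k \<Longrightarrow> action_law a d k t \<in> borel_measurable (H k t)"
proof -
  assume t: "t < m k"
  have \<pi>b: "\<pi>b k \<in> borel_measurable (H k t)"
    by (rule measurable_from_subalg[OF subalg_H_0[OF t] behavior_frozen])
  have "(\<lambda>\<omega>. \<pi>b k \<omega> $ s $ a) \<in> borel_measurable (H k t)" for s
    by (rule measurable_compose[OF \<pi>b borel_measurable_continuous_onI]) (intro continuous_intros)
  then have "(\<lambda>\<omega>. \<pi>b k \<omega> $ S k t \<omega> $ a) \<in> borel_measurable (H k t)"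
    by (rule measurable_compose_countable[OF _ state_meas[OF t]])
  then show ?thesis unfolding action_law_def[abs_def] by simp
qed

lemma behavior_le_1: "\<omega> \<in> space M \<Longrightarrow> 0 \<le> \<pi>b k \<omega> $ s $ a \<and> \<pi>b k \<omega> $ s $ a \<le> 1"
proof -
  assume "\<omega> \<in> space M"
  then have p: "\<And>a. 0 \<le> \<pi>b k \<omega> $ s $ a" "(\<Sum>a\<in>UNIV. \<pi>b k \<omega> $ s $ a) = 1"
    using behavior_policy[of \<omega> k] by (auto simp: policies_def)
  then show ?thesis using member_le_sum[of a UNIV "\<lambda>a. \<pi>b k \<omega> $ s $ a"] by auto
qed

text \<open>Actions and coins are centered given \<open>H\<close>, before they are drawn, and so the
  selector may depend on the state only; next states and noise are centered given
  \<open>G\<close>.\<close>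

lemma action_averages:
  fixes g :: "'s \<Rightarrow> bool"
  assumes \<gamma>: "0 \<le> \<gamma>" "\<gamma> \<le> 1" and "summable (\<lambda>k. 1 / real (m k))"
  shows "AE \<omega> in M. summable (\<lambda>k. ((\<Sum>t<m k. of_bool (g (S k t \<omega>)) * (action_ind a d k t \<omega> - action_law a d k t \<omega>)) / real (m k))\<^sup>2)"
proof (rule martingale_batch_averages_summable[where F = H and v = "\<lambda>_. 4"])
  fix k t assume t: "t < m k"
  note F = subalg_M_H[OF t]
  have w: "(\<lambda>\<omega>. of_bool (g (S k t \<omega>)) :: real) \<in> borel_measurable (H k t)"
    by (rule measurable_compose[OF state_meas[OF t]]) simp
  have Z: "action_ind a d k t \<in> borel_measurable M"
    by (rule measurable_from_subalg[OF subalg_M_G[OF t] action_ind_meas[OF t]])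
  have law: "AE \<omega> in M. real_cond_exp M (H k t) (action_ind a d k t) \<omega> = action_law a d k t \<omega>"
    unfolding action_ind_def action_law_def by (rule action_coin_law[OF t])
  have law1: "\<bar>action_law a d k t \<omega>\<bar> \<le> 1" if "\<omega> \<in> space M" for \<omega>
    using behavior_le_1[OF that, of k "S k t \<omega>" a] \<gamma>
    unfolding action_law_def abs_mult by (intro mult_le_one) auto
  note wc = weighted_centered_indicator[OF F w Z action_law_meas[OF t] _ _ law1 law]
  show "AE \<omega> in M. real_cond_exp M (H k t) (\<lambda>\<omega>. of_bool (g (S k t \<omega>)) * (action_ind a d k t \<omega> - action_law a d k t \<omega>)) \<omega> = 0"
    "integrable M (\<lambda>\<omega>. (of_bool (g (S k t \<omega>)) * (action_ind a d k t \<omega> - action_law a d k t \<omega>))\<^sup>2)"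
    "expectation (\<lambda>\<omega>. (of_bool (g (S k t \<omega>)) * (action_ind a d k t \<omega> - action_law a d k t \<omega>))\<^sup>2) \<le> 4"
    by (rule wc; simp add: action_ind_def split: split_indicator)+
  show "(\<lambda>\<omega>. of_bool (g (S k t \<omega>)) * (action_ind a d k t \<omega> - action_law a d k t \<omega>)) \<in> borel_measurable M"
    using Z measurable_from_subalg[OF F w] measurable_from_subalg[OF F action_law_meas[OF t]]
    by measurable
next
  fix k s t assume st: "s < t" "t < m k"
  then have s: "s < m k" by simp
  note sub = subalgebra_trans[OF subalg_H_next[OF st] subalg_G[OF s]]
  note sub' = subalgebra_trans[OF sub subalg_H[OF s]]
  have w: "(\<lambda>\<omega>. of_bool (g (S k s \<omega>)) :: real) \<in> borel_measurable (H k t)"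
    by (rule measurable_compose[OF measurable_from_subalg[OF sub' state_meas[OF s]]]) simp
  show "(\<lambda>\<omega>. of_bool (g (S k s \<omega>)) * (action_ind a d k s \<omega> - action_law a d k s \<omega>)) \<in> borel_measurable (H k t)"
    using w measurable_from_subalg[OF sub action_ind_meas[OF s]]
      measurable_from_subalg[OF sub' action_law_meas[OF s]]
    by measurable
next
  show "summable (\<lambda>k. 4 / real (m k))" using summable_mult[OF assms(3), of 4] by simp
qed (use subalg_M_H batch_nonempty in auto)

end

context markovian_sampling_rewards begin

lemma noise_averages:
  assumes "summable (\<lambda>k. (\<sigma> k)\<^sup>2 / real (m k))"
  shows "AE \<omega> in M. summable (\<lambda>k. ((\<Sum>t<m k. weight g k t \<omega> * \<zeta> k t \<omega>) / real (m k))\<^sup>2)"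
proof (rule martingale_batch_averages_summable[where F = G and v = "\<lambda>k. (\<sigma> k)\<^sup>2"])
  fix k t assume t: "t < m k"
  note F = subalg_M_G[OF t]
  have Z: "\<zeta> k t \<in> borel_measurable M"
    by (rule measurable_from_subalg[OF subalg_next[OF t] noise_meas[OF t]])
  note wc = weighted_centered_noise[OF F weight_meas[OF t] Z _ noise_centered[OF t] noise_variance[OF t], of g]
  show "AE \<omega> in M. real_cond_exp M (G k t) (\<lambda>\<omega>. weight g k t \<omega> * \<zeta> k t \<omega>) \<omega> = 0"
    "integrable M (\<lambda>\<omega>. (weight g k t \<omega> * \<zeta> k t \<omega>)\<^sup>2)"
    "expectation (\<lambda>\<omega>. (weight g k t \<omega> * \<zeta> k t \<omega>)\<^sup>2) \<le> (\<sigma> k)\<^sup>2"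
    by (rule wc; simp add: weight_def)+
  show "(\<lambda>\<omega>. weight g k t \<omega> * \<zeta> k t \<omega>) \<in> borel_measurable M"
    using Z measurable_from_subalg[OF F weight_meas[OF t]] by measurable
next
  fix k s t assume st: "s < t" "t < m k"
  then have s: "s < m k" by simp
  note sub = subalg_G_next[OF st]
  show "(\<lambda>\<omega>. weight g k s \<omega> * \<zeta> k s \<omega>) \<in> borel_measurable (G k t)"
    using measurable_from_subalg[OF sub noise_meas[OF s]]
      measurable_from_subalg[OF subalgebra_trans[OF sub subalg_G[OF s]] weight_meas[OF s]]
    by measurable
qed (use assms subalg_M_G batch_nonempty in auto)

section \<open>Visit counts and errors of the empirical model\<close>

definition visited :: "'s \<Rightarrow> 'a \<Rightarrow> nat \<Rightarrow> 'w \<Rightarrow> nat set" where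
  "visited s a k \<omega> = visits (m k) (\<lambda>t. S k t \<omega>) (\<lambda>t. A k t \<omega>) (\<lambda>t. C k t \<omega>) s a"

lemma finite_visited: "finite (visited s a k \<omega>)"
  by (simp add: visited_def visits_def)

lemma sum_visited:
  "(\<Sum>t\<in>visited s a k \<omega>. x t) = (\<Sum>t<m k. weight (\<lambda>s' a' d. s' = s \<and> a' = a \<and> \<not> d) k t \<omega> * x t)"
proof -
  have "visited s a k \<omega> = {t \<in> {..<m k}. S k t \<omega> = s \<and> A k t \<omega> = a \<and> \<not> C k t \<omega>}"
    by (auto simp: visited_def visits_def)
  then show ?thesis by (simp add: sum.inter_filter weight_def) (rule sum.cong, auto)
qed

text \<open>Four counts are linked by fluctuations. Reset steps with action \<open>a\<close> number
  at least \<alpha>(1-\<gamma>) m up to \<open>E\<close>; a fraction \<open>pmf \<rho> s\<close> of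
  them leads to \<open>s\<close>, up to \<open>D\<close>; each arrival in \<open>s\<close> is a
  visit to \<open>s\<close>, up to one; and a fraction of at least \<gamma>\<alpha> of those are
  non-reset steps with action \<open>a\<close>, up to \<open>Z\<close>. The initial state of the
  batch plays no part in the bound.\<close>

lemma card_visited_lower:
  fixes s :: 's and a :: 'a
  assumes \<omega>: "\<omega> \<in> space M" and \<gamma>: "0 < \<gamma>" "\<gamma> < 1"
    and \<alpha>: "0 < \<alpha>" "\<And>k s a. \<alpha> \<le> \<pi>b k \<omega> $ s $ a"
  defines "Z \<equiv> \<lambda>k. (\<Sum>t<m k. of_bool (S k t \<omega> = s) * (action_ind a False k t \<omega> - action_law a False k t \<omega>))"
    and "D \<equiv> \<lambda>k. (\<Sum>t<m k. weight (\<lambda>_ a' d. a' = a \<and> d) k t \<omega> * (next_ind s k t \<omega> - next_law s k t \<omega>))"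
    and "E \<equiv> \<lambda>k. (\<Sum>t<m k. of_bool True * (action_ind a True k t \<omega> - action_law a True k t \<omega>))"
  shows "Z k + \<gamma> * \<alpha> * (D k + pmf \<rho> s * (E k + \<alpha> * (1 - \<gamma>) * real (m k)) - 1) \<le> real (card (visited s a k \<omega>))"
proof -
  have "Z k = (\<Sum>t<m k. weight (\<lambda>s' a' d. s' = s \<and> a' = a \<and> \<not> d) k t \<omega>
      - of_bool (S k t \<omega> = s) * action_law a False k t \<omega>)"
    unfolding Z_def
    by (intro sum.cong) (auto simp: weight_def action_ind_def \<omega> algebra_simps split: split_indicator)
  also have "\<dots> \<le> (\<Sum>t<m k. weight (\<lambda>s' a' d. s' = s \<and> a' = a \<and> \<not> d) k t \<omega>
      - of_bool (S k t \<omega> = s) * (\<gamma> * \<alpha>))"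
  proof (intro sum_mono diff_left_mono mult_left_mono)
    show "\<gamma> * \<alpha> \<le> action_law a False k t \<omega>" for t
      using mult_left_mono[OF \<alpha>(2), of \<gamma>] \<gamma> by (simp add: action_law_def mult.commute)
  qed simp
  also have "\<dots> = real (card (visited s a k \<omega>)) - (\<gamma> * \<alpha>) * (\<Sum>t<m k. of_bool (S k t \<omega> = s))"
    using sum_visited[where s = s and a = a and k = k and \<omega> = \<omega> and x = "\<lambda>_. 1::real"]
    by (simp add: sum_subtractf mult.commute flip: sum_distrib_right)
  finally have 1: "Z k + (\<gamma> * \<alpha>) * (\<Sum>t<m k. of_bool (S k t \<omega> = s)) \<le> real (card (visited s a k \<omega>))"
    by simp
  \<comment> \<open>The next state drawn in the last step starts no step of this batch, hence the
    loss of one.\<close>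
  have 2: "(\<Sum>t<m k. next_ind s k t \<omega>) - 1 \<le> (\<Sum>t<m k. of_bool (S k t \<omega> = s))"
  proof -
    obtain j where j: "m k = Suc j" using batch_nonempty[of k] by (cases "m k") auto
    have "(\<Sum>t<m k. next_ind s k t \<omega>) \<le> (\<Sum>t<j. next_ind s k t \<omega>) + 1"
      by (simp add: j next_ind_def indicator_le_1)
    also have "(\<Sum>t<j. next_ind s k t \<omega>) = (\<Sum>t<j. of_bool (S k (Suc t) \<omega> = s))"
      using chain[of _ k \<omega>] by (intro sum.cong) (auto simp: j \<omega> next_ind_def split: split_indicator)
    also have "\<dots> \<le> (\<Sum>t<m k. of_bool (S k t \<omega> = s))"
      by (simp add: j sum.lessThan_Suc_shift del: sum.lessThan_Suc)
    finally show ?thesis by simp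
  qed
  \<comment> \<open>Counting only resets with the fixed action allows direct use of the joint law of
    action and coin, at the price of a factor \<alpha>.\<close>
  let ?w = "weight (\<lambda>_ a' d. a' = a \<and> d)"
  have "D k = (\<Sum>t<m k. ?w k t \<omega> * next_ind s k t \<omega> - ?w k t \<omega> * pmf \<rho> s)"
    unfolding D_def by (intro sum.cong) (auto simp: weight_def next_law_def)
  also have "\<dots> \<le> (\<Sum>t<m k. next_ind s k t \<omega> - ?w k t \<omega> * pmf \<rho> s)"
    by (intro sum_mono diff_right_mono) (simp add: weight_def next_ind_def)
  also have "\<dots> = (\<Sum>t<m k. next_ind s k t \<omega>) - pmf \<rho> s * (\<Sum>t<m k. ?w k t \<omega>)"
    by (simp add: sum_subtractf sum_distrib_left mult.commute)
  finally have 3: "D k + pmf \<rho> s * (\<Sum>t<m k. ?w k t \<omega>) \<le> (\<Sum>t<m k. next_ind s k t \<omega>)" by simp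
  have "E k = (\<Sum>t<m k. ?w k t \<omega> - action_law a True k t \<omega>)"
    unfolding E_def by (intro sum.cong) (auto simp: weight_def action_ind_def \<omega> split: split_indicator)
  also have "\<dots> \<le> (\<Sum>t<m k. ?w k t \<omega> - \<alpha> * (1 - \<gamma>))"
    using \<alpha>(2) \<gamma> by (intro sum_mono diff_left_mono) (simp add: action_law_def)
  also have "\<dots> = (\<Sum>t<m k. ?w k t \<omega>) - \<alpha> * (1 - \<gamma>) * real (m k)"
    by (simp add: sum_subtractf)
  finally have 4: "E k + \<alpha> * (1 - \<gamma>) * real (m k) \<le> (\<Sum>t<m k. ?w k t \<omega>)" by simp
  have "D k + pmf \<rho> s * (E k + \<alpha> * (1 - \<gamma>) * real (m k)) - 1 \<le> (\<Sum>t<m k. of_bool (S k t \<omega> = s))"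
    using 2 3 mult_left_mono[OF 4, of "pmf \<rho> s"] by simp
  moreover have "0 \<le> \<gamma> * \<alpha>" using \<gamma> \<alpha>(1) by simp
  ultimately have "(\<gamma> * \<alpha>) * (D k + pmf \<rho> s * (E k + \<alpha> * (1 - \<gamma>) * real (m k)) - 1)
      \<le> (\<gamma> * \<alpha>) * (\<Sum>t<m k. of_bool (S k t \<omega> = s))"
    by (rule mult_left_mono)
  then show ?thesis using 1 by (rule order_trans[OF add_left_mono])
qed

text \<open>Divided by the batch length, the lower bound of \<open>card_visited_lower\<close> tends
  to the constant \<open>c\<close> of the proof, and half of it is exceeded eventually. The rate is
  deterministic; the batch from which it holds depends on the realization.\<close>

lemma visits_linear_growth:
  assumes \<gamma>: "0 < \<gamma>" "\<gamma> < 1" and \<rho>: "0 < pmf \<rho> s"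
    and \<alpha>: "0 < \<alpha>" "\<And>k \<omega> s a. \<omega> \<in> space M \<Longrightarrow> \<alpha> \<le> \<pi>b k \<omega> $ s $ a"
    and m: "summable (\<lambda>k. 1 / real (m k))"
  shows "\<exists>c>0. AE \<omega> in M. \<forall>\<^sub>F k in sequentially. c * real (m k) \<le> real (card (visited s a k \<omega>))"
proof -
  define c where "c = \<gamma> * \<alpha> * (pmf \<rho> s * (\<alpha> * (1 - \<gamma>)))"
  have c: "0 < c" using \<gamma> \<rho> \<alpha>(1) by (simp add: c_def)
  let ?Z = "\<lambda>k \<omega>. \<Sum>t<m k. of_bool (S k t \<omega> = s) * (action_ind a False k t \<omega> - action_law a False k t \<omega>)"
  let ?D = "\<lambda>k \<omega>. \<Sum>t<m k. weight (\<lambda>_ a' d. a' = a \<and> d) k t \<omega> * (next_ind s k t \<omega> - next_law s k t \<omega>)"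
  let ?E = "\<lambda>k \<omega>. \<Sum>t<m k. of_bool True * (action_ind a True k t \<omega> - action_law a True k t \<omega>)"
  have "AE \<omega> in M. summable (\<lambda>k. (?Z k \<omega> / real (m k))\<^sup>2)"
    using \<gamma> m by (intro action_averages) auto
  moreover have "AE \<omega> in M. summable (\<lambda>k. (?D k \<omega> / real (m k))\<^sup>2)"
    using m by (rule next_state_averages)
  moreover have "AE \<omega> in M. summable (\<lambda>k. (?E k \<omega> / real (m k))\<^sup>2)"
    using \<gamma> m by (intro action_averages) auto
  moreover have "AE \<omega> in M. \<omega> \<in> space M" by simp
  ultimately have "AE \<omega> in M. \<forall>\<^sub>F k in sequentially. (c / 2) * real (m k) \<le> real (card (visited s a k \<omega>))"
  proof eventually_elim
    case (elim \<omega>)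
    note zero = LIMSEQ_zero_if_summable_square
    let ?l = "\<lambda>k. ?Z k \<omega> / real (m k)
      + \<gamma> * \<alpha> * (?D k \<omega> / real (m k) + pmf \<rho> s * (?E k \<omega> / real (m k) + \<alpha> * (1 - \<gamma>)) - 1 / real (m k))"
    have "?l \<longlonglongrightarrow> 0 + \<gamma> * \<alpha> * (0 + pmf \<rho> s * (0 + \<alpha> * (1 - \<gamma>)) - 0)"
      by (intro tendsto_intros zero[OF elim(1)] zero[OF elim(2)] zero[OF elim(3)] summable_LIMSEQ_zero[OF m])
    then have "?l \<longlonglongrightarrow> c" by (simp add: c_def)
    then have "\<forall>\<^sub>F k in sequentially. c / 2 < ?l k" using c by (intro order_tendstoD(1)) auto
    then show ?case
    proof (rule eventually_mono)
      fix k assume "c / 2 < ?l k"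
      moreover have mk: "0 < real (m k)" using batch_nonempty[of k] by simp
      ultimately have "(c / 2) * real (m k) \<le> ?l k * real (m k)" by (intro mult_right_mono) auto
      also have "\<dots> = ?Z k \<omega> + \<gamma> * \<alpha> * (?D k \<omega> + pmf \<rho> s * (?E k \<omega> + \<alpha> * (1 - \<gamma>) * real (m k)) - 1)"
      proof -
        have gen: "(z / x + g * (d / x + q * (y / x + b) - 1 / x)) * x = z + g * (d + q * (y + b * x) - 1)"
          if "0 < x" for z x g d q y b :: real
          using that by (simp add: field_simps)
        show ?thesis by (rule gen[OF mk])
      qed
      also have "\<dots> \<le> real (card (visited s a k \<omega>))"
        by (rule card_visited_lower[OF elim(4) \<gamma> \<alpha>(1) \<alpha>(2)[OF elim(4)]])
      finally show "(c / 2) * real (m k) \<le> real (card (visited s a k \<omega>))" .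
    qed
  qed
  then show ?thesis using c by (intro exI[of _ "c / 2"]) auto
qed

text \<open>On non-reset visits of the pair \<open>next_law\<close> is the constant
  \<open>pmf (P s a) s'\<close>, so the numerator is a weighted martingale sum over the whole batch,
  although the denominator is random.\<close>

lemma empirical_P_error:
  assumes \<omega>: "\<omega> \<in> space M" and ne: "visited s a k \<omega> \<noteq> {}"
  shows "empirical_P P\<^sub>0 (m k) (\<lambda>t. S k t \<omega>) (\<lambda>t. A k t \<omega>) (\<lambda>t. C k t \<omega>) (\<lambda>t. N k t \<omega>) s a s' - pmf (P s a) s'
    = (\<Sum>t<m k. weight (\<lambda>s' a' d. s' = s \<and> a' = a \<and> \<not> d) k t \<omega> * (next_ind s' k t \<omega> - next_law s' k t \<omega>))
      / real (card (visited s a k \<omega>))"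
proof -
  let ?V = "visited s a k \<omega>"
  have "(\<Sum>t\<in>?V. next_ind s' k t \<omega> - next_law s' k t \<omega>) = (\<Sum>t\<in>?V. of_bool (N k t \<omega> = s') - pmf (P s a) s')"
    by (intro sum.cong) (auto simp: visited_def visits_def next_ind_def next_law_def \<omega> split: split_indicator)
  also have "\<dots> = real (card {t \<in> ?V. N k t \<omega> = s'}) - real (card ?V) * pmf (P s a) s'"
    by (simp add: sum_subtractf finite_visited sum.inter_filter[symmetric] of_bool_def)
  finally show ?thesis
    using ne finite_visited[of s a k \<omega>] unfolding sum_visited[symmetric]
    by (simp add: empirical_P_def flip: visited_def) (simp add: field_simps card_gt_0_iff)
qed

lemma empirical_r_error:
  assumes \<omega>: "\<omega> \<in> space M" and ne: "visited s a k \<omega> \<noteq> {}"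
  shows "empirical_r r\<^sub>0 (m k) (\<lambda>t. S k t \<omega>) (\<lambda>t. A k t \<omega>) (\<lambda>t. C k t \<omega>) (\<lambda>t. Y k t \<omega>) s a - r s a
    = (\<Sum>t\<in>visited s a k \<omega>. b k t \<omega>) / real (card (visited s a k \<omega>))
      + (\<Sum>t<m k. weight (\<lambda>s' a' d. s' = s \<and> a' = a \<and> \<not> d) k t \<omega> * \<zeta> k t \<omega>)
      / real (card (visited s a k \<omega>))"
proof -
  let ?V = "visited s a k \<omega>"
  have "(\<Sum>t\<in>?V. Y k t \<omega>) = (\<Sum>t\<in>?V. r s a + b k t \<omega> + \<zeta> k t \<omega>)"
    using reward_observation[OF _ \<omega>] by (intro sum.cong) (auto simp: visited_def visits_def)
  also have "\<dots> = real (card ?V) * r s a + (\<Sum>t\<in>?V. b k t \<omega>) + (\<Sum>t\<in>?V. \<zeta> k t \<omega>)"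
    by (simp add: sum.distrib)
  finally show ?thesis
    using ne finite_visited[of s a k \<omega>] unfolding sum_visited[symmetric]
    by (simp add: empirical_r_def flip: visited_def) (simp add: field_simps card_gt_0_iff)
qed

text \<open>By linear growth of the visits a row is unvisited, and filled with default values, in
  finitely many batches only, which do not affect summability. From then on the random denominator
  is replaced by a multiple of the batch length.\<close>

lemma model_error_summable:
  assumes \<gamma>: "0 < \<gamma>" "\<gamma> < 1" and \<rho>: "\<And>s. 0 < pmf \<rho> s"
    and \<alpha>: "0 < \<alpha>" "\<And>k \<omega> s a. \<omega> \<in> space M \<Longrightarrow> \<alpha> \<le> \<pi>b k \<omega> $ s $ a"
    and batch: "summable (\<lambda>k. (1 + (\<sigma> k)\<^sup>2) / real (m k))"
    and bias: "summable (\<lambda>k. (bias k)\<^sup>2)"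
  shows "AE \<omega> in M. \<forall>s a.
    (\<forall>s'. summable (\<lambda>k. (empirical_P P\<^sub>0 (m k) (\<lambda>t. S k t \<omega>) (\<lambda>t. A k t \<omega>) (\<lambda>t. C k t \<omega>)
        (\<lambda>t. N k t \<omega>) s a s' - pmf (P s a) s')\<^sup>2)) \<and>
    summable (\<lambda>k. (empirical_r r\<^sub>0 (m k) (\<lambda>t. S k t \<omega>) (\<lambda>t. A k t \<omega>) (\<lambda>t. C k t \<omega>)
        (\<lambda>t. Y k t \<omega>) s a - r s a)\<^sup>2)"
proof -
  have m: "summable (\<lambda>k. 1 / real (m k))" and \<sigma>: "summable (\<lambda>k. (\<sigma> k)\<^sup>2 / real (m k))"
    by (rule summable_comparison_test'[OF batch, of 0]; simp add: divide_right_mono)+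
  have row: "AE \<omega> in M.
    (\<forall>s'. summable (\<lambda>k. (empirical_P P\<^sub>0 (m k) (\<lambda>t. S k t \<omega>) (\<lambda>t. A k t \<omega>) (\<lambda>t. C k t \<omega>)
        (\<lambda>t. N k t \<omega>) s a s' - pmf (P s a) s')\<^sup>2)) \<and>
    summable (\<lambda>k. (empirical_r r\<^sub>0 (m k) (\<lambda>t. S k t \<omega>) (\<lambda>t. A k t \<omega>) (\<lambda>t. C k t \<omega>)
        (\<lambda>t. Y k t \<omega>) s a - r s a)\<^sup>2)" for s a
  proof -
    obtain c where c: "0 < c"
      and growth: "AE \<omega> in M. \<forall>\<^sub>F k in sequentially. c * real (m k) \<le> real (card (visited s a k \<omega>))"
      using visits_linear_growth[OF \<gamma> \<rho>[of s] \<alpha> m, of a] by blast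
    let ?w = "weight (\<lambda>s' a' d. s' = s \<and> a' = a \<and> \<not> d)"
    have nxt: "AE \<omega> in M. \<forall>s'. summable (\<lambda>k.
        ((\<Sum>t<m k. ?w k t \<omega> * (next_ind s' k t \<omega> - next_law s' k t \<omega>)) / real (m k))\<^sup>2)"
      using next_state_averages[OF m] by (subst AE_all_countable) blast
    have noise: "AE \<omega> in M. summable (\<lambda>k. ((\<Sum>t<m k. ?w k t \<omega> * \<zeta> k t \<omega>) / real (m k))\<^sup>2)"
      by (rule noise_averages[OF \<sigma>])
    have "AE \<omega> in M. \<forall>k. \<forall>s a.
        let T = visits (m k) (\<lambda>t. S k t \<omega>) (\<lambda>t. A k t \<omega>) (\<lambda>t. C k t \<omega>) s a
        in T \<noteq> {} \<longrightarrow> \<bar>(\<Sum>t\<in>T. b k t \<omega>) / real (card T)\<bar> \<le> bias k"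
      using average_bias by (subst AE_all_countable) blast
    then have bias_le: "AE \<omega> in M. \<forall>k. visited s a k \<omega> \<noteq> {} \<longrightarrow>
        \<bar>(\<Sum>t\<in>visited s a k \<omega>. b k t \<omega>) / real (card (visited s a k \<omega>))\<bar> \<le> bias k"
      by (rule eventually_mono) (auto simp: visited_def Let_def)
    show ?thesis
      using growth nxt noise bias_le AE_space
    proof eventually_elim
      case (elim \<omega>)
      have ne: "visited s a k \<omega> \<noteq> {}" if "c * real (m k) \<le> real (card (visited s a k \<omega>))" for k
        using that c batch_nonempty[of k] by (auto simp: mult_le_0_iff)
      have mk: "0 < real (m k)" for k using batch_nonempty[of k] by simp
      have "summable (\<lambda>k. (empirical_P P\<^sub>0 (m k) (\<lambda>t. S k t \<omega>) (\<lambda>t. A k t \<omega>) (\<lambda>t. C k t \<omega>)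
        (\<lambda>t. N k t \<omega>) s a s' - pmf (P s a) s')\<^sup>2)" for s'
      proof (rule summable_comparison_test_ev)
        show "summable (\<lambda>k. ((\<Sum>t<m k. ?w k t \<omega> * (next_ind s' k t \<omega> - next_law s' k t \<omega>)) / real (m k))\<^sup>2 / c\<^sup>2)"
          using elim(2) by (intro summable_divide) blast
        show "\<forall>\<^sub>F k in sequentially. norm ((empirical_P P\<^sub>0 (m k) (\<lambda>t. S k t \<omega>) (\<lambda>t. A k t \<omega>) (\<lambda>t. C k t \<omega>)
            (\<lambda>t. N k t \<omega>) s a s' - pmf (P s a) s')\<^sup>2)
          \<le> ((\<Sum>t<m k. ?w k t \<omega> * (next_ind s' k t \<omega> - next_law s' k t \<omega>)) / real (m k))\<^sup>2 / c\<^sup>2"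
          using elim(1)
        proof (rule eventually_mono)
          fix k assume k: "c * real (m k) \<le> real (card (visited s a k \<omega>))"
          show "norm ((empirical_P P\<^sub>0 (m k) (\<lambda>t. S k t \<omega>) (\<lambda>t. A k t \<omega>) (\<lambda>t. C k t \<omega>)
            (\<lambda>t. N k t \<omega>) s a s' - pmf (P s a) s')\<^sup>2)
          \<le> ((\<Sum>t<m k. ?w k t \<omega> * (next_ind s' k t \<omega> - next_law s' k t \<omega>)) / real (m k))\<^sup>2 / c\<^sup>2"
            unfolding empirical_P_error[OF elim(5) ne[OF k]] real_norm_def abs_power2
            by (rule square_divide_le[OF c mk k])
        qed
      qed
      moreover have "summable (\<lambda>k. (empirical_r r\<^sub>0 (m k) (\<lambda>t. S k t \<omega>) (\<lambda>t. A k t \<omega>) (\<lambda>t. C k t \<omega>)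
        (\<lambda>t. Y k t \<omega>) s a - r s a)\<^sup>2)"
      proof (rule summable_comparison_test_ev)
        show "summable (\<lambda>k. 2 * (bias k)\<^sup>2 + 2 * (((\<Sum>t<m k. ?w k t \<omega> * \<zeta> k t \<omega>) / real (m k))\<^sup>2 / c\<^sup>2))"
          using elim(3) bias by (intro summable_add summable_mult summable_divide)
        show "\<forall>\<^sub>F k in sequentially. norm ((empirical_r r\<^sub>0 (m k) (\<lambda>t. S k t \<omega>) (\<lambda>t. A k t \<omega>) (\<lambda>t. C k t \<omega>)
            (\<lambda>t. Y k t \<omega>) s a - r s a)\<^sup>2)
          \<le> 2 * (bias k)\<^sup>2 + 2 * (((\<Sum>t<m k. ?w k t \<omega> * \<zeta> k t \<omega>) / real (m k))\<^sup>2 / c\<^sup>2)"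
          using elim(1)
        proof (rule eventually_mono)
          fix k assume k: "c * real (m k) \<le> real (card (visited s a k \<omega>))"
          let ?n = "real (card (visited s a k \<omega>))"
          let ?x = "(\<Sum>t\<in>visited s a k \<omega>. b k t \<omega>) / ?n" and ?y = "(\<Sum>t<m k. ?w k t \<omega> * \<zeta> k t \<omega>) / ?n"
          have sq: "(u + v)\<^sup>2 \<le> 2 * u\<^sup>2 + 2 * v\<^sup>2" for u v :: real
            using zero_le_power2[of "u - v"] by (simp add: power2_eq_square algebra_simps)
          have "\<bar>?x\<bar> \<le> \<bar>bias k\<bar>" using elim(4) ne[OF k] bias_nonneg[of k] by auto
          then have x: "?x\<^sup>2 \<le> (bias k)\<^sup>2" by (rule abs_le_square_iff[THEN iffD1])
          have y: "?y\<^sup>2 \<le> ((\<Sum>t<m k. ?w k t \<omega> * \<zeta> k t \<omega>) / real (m k))\<^sup>2 / c\<^sup>2"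
            by (rule square_divide_le[OF c mk k])
          show "norm ((empirical_r r\<^sub>0 (m k) (\<lambda>t. S k t \<omega>) (\<lambda>t. A k t \<omega>) (\<lambda>t. C k t \<omega>)
            (\<lambda>t. Y k t \<omega>) s a - r s a)\<^sup>2)
          \<le> 2 * (bias k)\<^sup>2 + 2 * (((\<Sum>t<m k. ?w k t \<omega> * \<zeta> k t \<omega>) / real (m k))\<^sup>2 / c\<^sup>2)"
            unfolding empirical_r_error[OF elim(5) ne[OF k]] real_norm_def abs_power2
            using sq[of ?x ?y] x y by linarith
        qed
      qed
      ultimately show ?case by blast
    qed
  qed
  then show ?thesis by (subst AE_all_countable, intro allI, subst AE_all_countable, intro allI)
qed

end

section \<open>Convergence\<close>

theorem theorem4p8:
  fixes M :: "'w measure"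
    and \<gamma> :: real
    and P :: "'s::finite \<Rightarrow> 'a::finite \<Rightarrow> 's pmf"
    and r :: "'s \<Rightarrow> 'a \<Rightarrow> real"
    and \<rho> :: "'s pmf"
    and c :: "real^'s"
    and \<phi> :: "real^'a^'s \<Rightarrow> ereal"
    and m :: "nat \<Rightarrow> nat"
    and \<pi>b :: "nat \<Rightarrow> 'w \<Rightarrow> real^'a^'s"
    and H G :: "nat \<Rightarrow> nat \<Rightarrow> 'w measure"
    and S N :: "nat \<Rightarrow> nat \<Rightarrow> 'w \<Rightarrow> 's"
    and A :: "nat \<Rightarrow> nat \<Rightarrow> 'w \<Rightarrow> 'a"
    and C :: "nat \<Rightarrow> nat \<Rightarrow> 'w \<Rightarrow> bool"
    and Y b \<zeta> :: "nat \<Rightarrow> nat \<Rightarrow> 'w \<Rightarrow> real"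
    and bias \<sigma> :: "nat \<Rightarrow> real"
    and P\<^sub>0 :: "'s \<Rightarrow> 'a \<Rightarrow> 's pmf"
    and r\<^sub>0 :: "'s \<Rightarrow> 'a \<Rightarrow> real"
    and p :: "'s \<Rightarrow> 'a \<Rightarrow> 's \<Rightarrow> real"
    and Phat :: "nat \<Rightarrow> 'w \<Rightarrow> 's \<Rightarrow> 'a \<Rightarrow> 's \<Rightarrow> real"
    and rhat :: "nat \<Rightarrow> 'w \<Rightarrow> 's \<Rightarrow> 'a \<Rightarrow> real"
    and \<pi> :: "nat \<Rightarrow> 'w \<Rightarrow> real^'a^'s"
    and V \<Lambda> :: "nat \<Rightarrow> 'w \<Rightarrow> real^'s"
    and \<pi>init :: "real^'a^'s"
    and \<kappa> \<beta> \<eta>\<^sub>\<pi> \<eta>\<^sub>V L\<^sub>M \<rho>min \<alpha> Rmax :: real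
  assumes discount: "0 < \<gamma>" "\<gamma> < 1"
    and phi_proper: "proper_fun \<phi>"
    and phi_lsc: "lsc_on policies \<phi>"
    and phi_bdd: "bounded_below_on policies \<phi>"
    and phi_dom: "effective_domain \<phi> \<inter> policies \<noteq> {}"
    \<comment> \<open>sampling, noise and bias\<close>
    and sampling: "markovian_sampling_rewards M \<gamma> P \<rho> m \<pi>b H G S N A C Y r b \<zeta> bias \<sigma>"
    and rho_cover: "0 < \<rho>min" "\<And>s. \<rho>min \<le> pmf \<rho> s"
    and behavior_cover: "0 < \<alpha>" "\<And>k \<omega> s a. \<omega> \<in> space M \<Longrightarrow> \<alpha> \<le> \<pi>b k \<omega> $ s $ a"
    and reward_bound: "\<And>s a. \<bar>r s a\<bar> \<le> Rmax"
    \<comment> \<open>true and empirical models\<close>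
    and true_P: "p = (\<lambda>s a s'. pmf (P s a) s')"
    and Phat: "\<And>k \<omega>. Phat k \<omega> =
      empirical_P P\<^sub>0 (m k) (\<lambda>t. S k t \<omega>) (\<lambda>t. A k t \<omega>) (\<lambda>t. C k t \<omega>) (\<lambda>t. N k t \<omega>)"
    and rhat: "\<And>k \<omega>. rhat k \<omega> =
      empirical_r r\<^sub>0 (m k) (\<lambda>t. S k t \<omega>) (\<lambda>t. A k t \<omega>) (\<lambda>t. C k t \<omega>) (\<lambda>t. Y k t \<omega>)"
    and kappa_true: "\<And>q. q \<in> policies \<Longrightarrow> spectral_norm (matrix_inv (M_pol \<gamma> p q)) \<le> \<kappa>"
    and kappa_emp: "\<And>k \<omega> q. \<omega> \<in> space M \<Longrightarrow> q \<in> policies \<Longrightarrow>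
      spectral_norm (matrix_inv (M_pol \<gamma> (Phat k \<omega>) q)) \<le> \<kappa>"
    \<comment> \<open>algorithm\<close>
    and parameters: "0 < \<beta>" "0 < \<eta>\<^sub>\<pi>" "0 < \<eta>\<^sub>V"
    and iterates_history:
      "\<And>k. \<pi> k \<in> measurable (H k 0) borel"
      "\<And>k. V k \<in> measurable (H k 0) borel"
      "\<And>k. \<Lambda> k \<in> measurable (H k 0) borel"
    and policy_step: "\<And>k \<omega>. \<omega> \<in> space M \<Longrightarrow>
      is_arg_min (\<lambda>q. aug_lagrangian \<gamma> (Phat k \<omega>) (rhat k \<omega>) \<phi> c \<beta> q (V k \<omega>) (\<Lambda> k \<omega>)
                       + ereal (1 / (2 * \<eta>\<^sub>\<pi>) * (norm (q - \<pi> k \<omega>))\<^sup>2))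
        (\<lambda>q. q \<in> policies) (\<pi> (Suc k) \<omega>)"
    and value_step: "\<And>k \<omega>. \<omega> \<in> space M \<Longrightarrow>
      is_arg_min (\<lambda>v. aug_lagrangian \<gamma> (Phat k \<omega>) (rhat k \<omega>) \<phi> c \<beta> (\<pi> (Suc k) \<omega>) v (\<Lambda> k \<omega>)
                       + ereal (1 / (2 * \<eta>\<^sub>V) * (norm (v - V k \<omega>))\<^sup>2))
        (\<lambda>v. True) (V (Suc k) \<omega>)"
    and multiplier_step: "\<And>k \<omega>. \<omega> \<in> space M \<Longrightarrow>
      \<Lambda> (Suc k) \<omega> = \<Lambda> k \<omega>
        + \<beta> *\<^sub>R bellman_res \<gamma> (Phat k \<omega>) (rhat k \<omega>) (\<pi> (Suc k) \<omega>) (V (Suc k) \<omega>)"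
    \<comment> \<open>algorithmic margin\<close>
    and init_policy: "\<And>\<omega>. \<omega> \<in> space M \<Longrightarrow> \<pi> 0 \<omega> = \<pi>init"
      "\<pi>init \<in> effective_domain (\<lambda>q. \<phi> q + indicator_fun policies q)"
    and M_lipschitz: "\<And>q q'. q \<in> policies \<Longrightarrow> q' \<in> policies \<Longrightarrow>
      spectral_norm (M_pol \<gamma> p q' - M_pol \<gamma> p q) \<le> L\<^sub>M * norm (q' - q)"
    and merit_bdd: "bounded_below_on policies
      (\<lambda>q. \<phi> q + ereal (c \<bullet> (matrix_inv (M_pol \<gamma> p q) *v r_pol r q)))"
    and margin: "\<beta> > max (60 * \<kappa>\<^sup>2 / \<eta>\<^sub>V) (30 * \<eta>\<^sub>\<pi> * \<kappa>^4 * L\<^sub>M\<^sup>2 * (norm c)\<^sup>2)"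
    and init_moments: "integrable M (\<lambda>\<omega>. (norm (V 0 \<omega>))^4)"
      "integrable M (\<lambda>\<omega>. (norm (\<Lambda> 0 \<omega>))^4)"
    \<comment> \<open>batch-size conditions\<close>
    and batch_sizes: "summable (\<lambda>k. (1 + (\<sigma> k)\<^sup>2) / real (m k))"
    and bias_summable: "summable (\<lambda>k. (bias k)\<^sup>2)"
  shows "AE \<omega> in M.
      (\<lambda>k. \<pi> (Suc k) \<omega> - \<pi> k \<omega>) \<longlonglongrightarrow> 0 \<and>
      (\<lambda>k. V (Suc k) \<omega> - V k \<omega>) \<longlonglongrightarrow> 0 \<and>
      (\<lambda>k. \<Lambda> (Suc k) \<omega> - \<Lambda> k \<omega>) \<longlonglongrightarrow> 0 \<and>
      (\<lambda>k. bellman_res \<gamma> p r (\<pi> k \<omega>) (V k \<omega>)) \<longlonglongrightarrow> 0 \<and>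
      (\<lambda>k. kkt_residual \<gamma> p r \<phi> c (\<pi> k \<omega>) (V k \<omega>) (\<Lambda> k \<omega>)) \<longlonglongrightarrow> 0 \<and>
      (\<forall>\<pi>s Vs \<Lambda>s.
         (\<exists>i. strict_mono i \<and>
            ((\<lambda>k. (\<pi> k \<omega>, V k \<omega>, \<Lambda> k \<omega>)) \<circ> i) \<longlonglongrightarrow> (\<pi>s, Vs, \<Lambda>s))
         \<longrightarrow> kkt_point \<gamma> p r \<phi> c \<pi>s Vs \<Lambda>s)"
proof -
  interpret sampling_model: markovian_sampling_rewards M \<gamma> P \<rho> m \<pi>b H G S N A C Y r b \<zeta> bias \<sigma>
    by (rule sampling)
  have "AE \<omega> in M. \<forall>s a.
      (\<forall>s'. summable (\<lambda>k. (Phat k \<omega> s a s' - p s a s')\<^sup>2)) \<and>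
      summable (\<lambda>k. (rhat k \<omega> s a - r s a)\<^sup>2)"
    unfolding Phat rhat true_P
    by (rule sampling_model.model_error_summable[OF discount less_le_trans[OF rho_cover]
          behavior_cover batch_sizes bias_summable])
  then show ?thesis
    using AE_space
  proof eventually_elim
    case (elim \<omega>)
    \<comment> \<open>The square root of \<open>e2 k\<close> is the Euclidean norm of all entry
      errors: it dominates each of them, and its square is a finite sum of summable
      sequences.\<close>
    define e2 where "e2 k = (\<Sum>s\<in>UNIV. \<Sum>a\<in>UNIV. (\<Sum>s'\<in>UNIV. (Phat k \<omega> s a s' - p s a s')\<^sup>2)
      + (rhat k \<omega> s a - r s a)\<^sup>2)" for k
    define e where "e k = sqrt (e2 k)" for k
    have row_le: "(\<Sum>s'\<in>UNIV. (Phat k \<omega> s a s' - p s a s')\<^sup>2) + (rhat k \<omega> s a - r s a)\<^sup>2 \<le> e2 k" for k s a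
    proof -
      let ?x = "\<lambda>s a. (\<Sum>s'\<in>UNIV. (Phat k \<omega> s a s' - p s a s')\<^sup>2) + (rhat k \<omega> s a - r s a)\<^sup>2"
      have nonneg: "0 \<le> ?x s a" for s a by (intro add_nonneg_nonneg sum_nonneg) auto
      have "?x s a \<le> (\<Sum>a\<in>UNIV. ?x s a)" by (rule member_le_sum) (use nonneg in auto)
      also have "\<dots> \<le> e2 k" unfolding e2_def
        by (rule member_le_sum[where f = "\<lambda>s. \<Sum>a\<in>UNIV. ?x s a"]) (use nonneg in \<open>auto intro: sum_nonneg\<close>)
      finally show ?thesis .
    qed
    have P_le: "(p s a s' - Phat k \<omega> s a s')\<^sup>2 \<le> e2 k" for k s a s'
    proof -
      have "(Phat k \<omega> s a s' - p s a s')\<^sup>2 \<le> (\<Sum>s'\<in>UNIV. (Phat k \<omega> s a s' - p s a s')\<^sup>2)"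
        by (rule member_le_sum) auto
      also have "\<dots> \<le> (\<Sum>s'\<in>UNIV. (Phat k \<omega> s a s' - p s a s')\<^sup>2) + (rhat k \<omega> s a - r s a)\<^sup>2" by simp
      also have "\<dots> \<le> e2 k" by (rule row_le)
      finally show ?thesis by (simp add: power2_commute)
    qed
    have r_le: "(r s a - rhat k \<omega> s a)\<^sup>2 \<le> e2 k" for k s a
    proof -
      have "(rhat k \<omega> s a - r s a)\<^sup>2 \<le> (\<Sum>s'\<in>UNIV. (Phat k \<omega> s a s' - p s a s')\<^sup>2) + (rhat k \<omega> s a - r s a)\<^sup>2"
        by (simp add: sum_nonneg)
      also have "\<dots> \<le> e2 k" by (rule row_le)
      finally show ?thesis by (simp add: power2_commute)
    qed
    have e2_nonneg: "0 \<le> e2 k" for k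
      by (rule order_trans[OF zero_le_power2 r_le])
    have "summable e2"
      unfolding e2_def using elim(1) by (intro summable_sum summable_add) auto
    interpret admm: inexact_bellman_admm \<gamma> p r \<phi> c "\<lambda>k. Phat k \<omega>" "\<lambda>k. rhat k \<omega>"
      "\<lambda>k. \<pi> k \<omega>" "\<lambda>k. V k \<omega>" "\<lambda>k. \<Lambda> k \<omega>" \<kappa> \<beta> \<eta>\<^sub>\<pi> \<eta>\<^sub>V L\<^sub>M e
    proof
      show "stochastic_rows p"
        unfolding true_P stochastic_rows_def by (simp add: sum_pmf_eq_1)
      show "stochastic_rows (Phat k \<omega>)" for k
        unfolding Phat by (rule stochastic_empirical_P)
      show "\<bar>p s a s' - Phat k \<omega> s a s'\<bar> \<le> e k" for k s a s'
        unfolding e_def using real_sqrt_le_mono[OF P_le] by simp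
      show "\<bar>r s a - rhat k \<omega> s a\<bar> \<le> e k" for k s a
        unfolding e_def using real_sqrt_le_mono[OF r_le] by simp
      show "summable (\<lambda>k. (e k)\<^sup>2)"
        using \<open>summable e2\<close> e2_nonneg by (simp add: e_def)
      show "60 * \<kappa>\<^sup>2 / \<eta>\<^sub>V < \<beta>" "30 * \<eta>\<^sub>\<pi> * \<kappa> ^ 4 * L\<^sub>M\<^sup>2 * (norm c)\<^sup>2 < \<beta>"
        using margin by auto
      show "\<pi> 0 \<omega> \<in> effective_domain (\<lambda>q. \<phi> q + indicator_fun policies q)"
        using init_policy elim(2) by simp
    qed (fact discount phi_proper phi_lsc phi_bdd parameters M_lipschitz
        kappa_emp[OF elim(2)] policy_step[OF elim(2)] value_step[OF elim(2)] multiplier_step[OF elim(2)])+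
    show ?case
      using admm.increments_tendsto admm.primal_feasibility admm.kkt_residual_tendsto admm.accumulation_point_kkt
      by (auto simp: o_def)
  qed
qed

end
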